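(* There exists a Cantor set $X \subset \mathbb{C}^3$ whose polynomial hull $\widehat{X}$ is nontrivial (that is, $\widehat{X} \setminus X \neq \emptyset$) but contains no analytic discs.
   Context: A Cantor set is a topological space homeomorphic to the standard middle-thirds Cantor set; equivalently, a nonempty, compact, totally disconnected, metrizable space without isolated points. For a compact set $X \subset \mathbb{C}^N$, the polynomial hull of $X$ is $\widehat{X} = \{ z \in \mathbb{C}^N : |p(z)| \leq \max_{x \in X} |p(x)| \text{ for all polynomials } p \}$, where the polynomials are holomorphic polynomials in $N$ complex variables with complex coefficients. The polynomial hull of $X$ is said to be nontrivial if $\widehat{X} \setminus X$ is nonempty. An analytic disc in $\mathbb{C}^N$ is an injective holomorphic map $\sigma : \{ z \in \mathbb{C} : |z| < 1 \} \to \mathbb{C}^N$. A subset $S$ of $\mathbb{C}^N$ is said to contain no analytic discs if there is no analytic disc in $\mathbb{C}^N$ whose image is contained in $S$. *)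

theory Defs
  imports "HOL-Analysis.Analysis"
begin

(* cantor_stage n is the union of the 2^n closed intervals of length 3^(-n) left after n steps
   of removing open middle thirds from [0,1]. *)
primrec cantor_stage :: "nat \<Rightarrow> real set" where
  "cantor_stage 0 = {0..1}"
| "cantor_stage (Suc n) =
     (\<lambda>x. x / 3) ` cantor_stage n \<union> (\<lambda>x. 2 / 3 + x / 3) ` cantor_stage n"

definition middle_thirds_cantor_set :: "real set" where
  "middle_thirds_cantor_set = (\<Inter>n. cantor_stage n)"

definition is_cantor_set :: "'a::topological_space set \<Rightarrow> bool" where
  "is_cantor_set X \<longleftrightarrow> X homeomorphic middle_thirds_cantor_set"

(* Elements of A are the exponent vectors of the monomials, c gives their coefficients. *)
definition complex_polynomial :: "(complex ^ 'n \<Rightarrow> complex) \<Rightarrow> bool" where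
  "complex_polynomial p \<longleftrightarrow>
     (\<exists>(A :: ('n \<Rightarrow> nat) set) (c :: ('n \<Rightarrow> nat) \<Rightarrow> complex). finite A \<and>
        p = (\<lambda>z. \<Sum>\<alpha>\<in>A. c \<alpha> * (\<Prod>i\<in>UNIV. (z $ i) ^ \<alpha> i)))"

(* Meant for nonempty compact X, where the supremum is a maximum
   (complex_polynomial_attains_SUP below). *)
definition polynomial_hull :: "(complex ^ 'n) set \<Rightarrow> (complex ^ 'n) set" where
  "polynomial_hull X =
     {z. \<forall>p. complex_polynomial p \<longrightarrow> norm (p z) \<le> (SUP x\<in>X. norm (p x))}"

lemma continuous_on_complex_polynomial:
  assumes "complex_polynomial p"
  shows "continuous_on S p"
  using assms unfolding complex_polynomial_def by (auto intro!: continuous_intros)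

lemma complex_polynomial_attains_SUP:
  assumes "complex_polynomial p" "compact X" "X \<noteq> {}"
  shows "\<exists>x\<in>X. norm (p x) = (SUP y\<in>X. norm (p y)) \<and> (\<forall>y\<in>X. norm (p y) \<le> norm (p x))"
proof -
  have "continuous_on X (\<lambda>x. norm (p x))"
    using assms by (intro continuous_intros continuous_on_complex_polynomial)
  then obtain x where x: "x \<in> X" "\<forall>y\<in>X. norm (p y) \<le> norm (p x)"
    using continuous_attains_sup[of X "\<lambda>x. norm (p x)"] assms by blast
  then have "(SUP y\<in>X. norm (p y)) = norm (p x)"
    by (intro cSup_eq_maximum) auto
  with x show ?thesis by auto
qed

definition nontrivial_polynomial_hull :: "(complex ^ 'n) set \<Rightarrow> bool" where
  "nontrivial_polynomial_hull X \<longleftrightarrow> polynomial_hull X - X \<noteq> {}"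

(* holomorphic_on is only available for complex-valued functions; a map into C^n is holomorphic
   when all of its components are. *)
definition analytic_disc :: "(complex \<Rightarrow> complex ^ 'n) \<Rightarrow> bool" where
  "analytic_disc \<sigma> \<longleftrightarrow>
     inj_on \<sigma> (ball 0 1) \<and> (\<forall>i. (\<lambda>z. \<sigma> z $ i) holomorphic_on ball 0 1)"

definition contains_no_analytic_discs :: "(complex ^ 'n) set \<Rightarrow> bool" where
  "contains_no_analytic_discs S \<longleftrightarrow> \<not> (\<exists>\<sigma>. analytic_disc \<sigma> \<and> \<sigma> ` ball 0 1 \<subseteq> S)"

end

theory Submission
  imports Defs "HOL-Complex_Analysis.Great_Picard"
begin

text \<open>Two constructions are combined.

First, a totally disconnected compact set K in the plane z3 = 0 with nontrivial hull
(totally_disconnected_with_hull). Let E be a compact, totally disconnected subset of the complex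
plane of positive area and let f be its Cauchy transform. This f is continuous on the whole plane,
holomorphic off E, tends to 0 at infinity and is not identically zero. For any polynomial P, the
values of P(f(z), z f(z)) at points z with f(z) nonzero are then bounded by the maximum over E. So
the hull of the image K of E under z |-> (f(z), z f(z)) contains the image of -1. Where f is
nonzero this map is injective, and it collapses the zeros of f to one point; hence K is totally
disconnected and does not contain the image of -1.

Second, Wermer's idea for destroying analytic structure is applied above the hull of K. Let p_0,
p_1, ... be multiples of the functions v1 - a and v2 - a, with a running through a countable dense
set. The set X consists of the points v + w e3 with v in K and w = sum of c_j r_j, where every r_j
is one of the square roots of p_j(v). Changing the sign of a root far out in the series moves a
point of X a little, so X is perfect, and fibres and base are totally disconnected; hence X is a
Cantor set. The product over all sign choices of w minus the n-th partial sum is a polynomial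
root_poly c n, and it is tiny on X, hence on the hull, if the tail of the series is tiny. The hull
of X is nontrivial because a point y in the hull of a set L lifts to the hull of the set obtained
by adjoining a square root, for a suitable choice of the root at y (in_hull_root): otherwise two
polynomials that are large at one lifted point each could be added to one that is large at both,
and its norm down to the base would violate the hull inequality. In the limit the hull of X meets
the fibre over every point of the hull of K.

Why the hull of X contains no disc: a disc on which v1 and v2 are constant would lie in a fibre,
which is covered by 2^n discs of radius 4^(-n) for every n. Otherwise one of v1, v2, say u, is
nonconstant, and after restricting and rescaling the disc its centre is a simple zero of u - a_k
for arbitrarily large k. If the third coordinate were exactly a partial sum up to c_k sqrt(p_k)
along the disc, then it would differ from a function that is differentiable at the centre by a sum
of at most two square roots of functions with simple zeros and different derivatives, which is
impossible (two_root_contradiction, root_sum_contradiction). By Montel's theorem the discs in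
question form a compact family, so that root_poly c (k+1) even exceeds some fixed positive number
somewhere on each of them (no_disc_near_zero_set). This number depends on c_0, ..., c_k only; so
the later coefficients can be chosen small enough for root_poly c (k+1) to stay below it on X, and
hence on the hull.\<close>

section \<open>Characterising Cantor sets\<close>

definition totally_disconnected :: "'a::topological_space set \<Rightarrow> bool" where
  "totally_disconnected X \<longleftrightarrow> (\<forall>T\<subseteq>X. connected T \<longrightarrow> (\<forall>x\<in>T. \<forall>y\<in>T. x = y))"

text \<open>Total disconnectedness is used through the clopen subsets: in a compact set they separate points
from closed sets, and there are only countably many of them.\<close>

definition clopen_in :: "'a::topological_space set \<Rightarrow> 'a set \<Rightarrow> bool" where
  "clopen_in X K \<longleftrightarrow> openin (top_of_set X) K \<and> closedin (top_of_set X) K"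

lemma clopen_in_whole: "clopen_in X X"
  by (simp add: clopen_in_def)

lemma clopen_in_Int: "clopen_in X K \<Longrightarrow> clopen_in X L \<Longrightarrow> clopen_in X (K \<inter> L)"
  by (auto simp: clopen_in_def)

lemma clopen_in_Diff: "clopen_in X K \<Longrightarrow> clopen_in X L \<Longrightarrow> clopen_in X (K - L)"
  by (auto simp: clopen_in_def intro: openin_diff closedin_diff)

lemma clopen_in_subset: "clopen_in X K \<Longrightarrow> K \<subseteq> X"
  by (auto simp: clopen_in_def dest: openin_imp_subset)

text \<open>In a compact space the component of a point is the intersection of the clopen sets containing it,
so a point that is its own component has arbitrarily small clopen neighbourhoods.\<close>

lemma clopen_separation:
  fixes X :: "'a::euclidean_space set"
  assumes "compact X" "totally_disconnected X" "x \<in> X" "open U" "x \<in> U"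
  obtains K where "clopen_in X K" "x \<in> K" "K \<subseteq> U"
proof -
  let ?C = "connected_component_set X x"
  have C: "?C = {x}"
  proof -
    have "?C \<subseteq> X" "connected ?C" "x \<in> ?C"
      using assms by (auto simp: connected_component_subset)
    then show ?thesis using assms(2) unfolding totally_disconnected_def by blast
  qed
  have comp: "{x} \<in> components X"
    using C assms(3) by (metis componentsI)
  obtain K where "openin (top_of_set X) K" "compact K" "{x} \<subseteq> K" "K \<subseteq> U"
    using Sura_Bura_clopen_subset[OF _ comp, of U] assms
    by (metis closed_imp_locally_compact compact_imp_closed compact_sing empty_subsetI insert_subset)
  then show ?thesis using that[of K] assms(1) openin_imp_subset
    by (metis clopen_in_def closed_subset compact_imp_closed insert_subset)
qed

text \<open>A clopen subset is compact, hence a finite union of sets of a countable basis.\<close>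

lemma countable_clopen:
  fixes X :: "'a::euclidean_space set"
  assumes "compact X"
  shows "countable {K. clopen_in X K}"
proof -
  obtain B :: "'a set set" where B: "countable B" "topological_basis B"
    using ex_countable_basis by blast
  have "{K. clopen_in X K} \<subseteq> (\<lambda>F. X \<inter> \<Union>F) ` {F. finite F \<and> F \<subseteq> B}"
  proof clarify
    fix K assume K: "clopen_in X K"
    then have "compact K" using assms closedin_compact clopen_in_def by blast
    obtain V where V: "open V" "K = X \<inter> V"
      using K unfolding clopen_in_def openin_open by auto
    obtain B' where B': "B' \<subseteq> B" "\<Union>B' = V"
      using B(2) V(1) unfolding topological_basis_def by blast
    have "K \<subseteq> \<Union>B'" using V B' by blast
    moreover have "\<And>b. b \<in> B' \<Longrightarrow> open b" using B B' topological_basis_open by blast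
    ultimately obtain F where F: "F \<subseteq> B'" "finite F" "K \<subseteq> \<Union>F"
      using \<open>compact K\<close> by (meson compactE)
    have "K = X \<inter> \<Union>F" using F B' V by blast
    then show "K \<in> (\<lambda>F. X \<inter> \<Union>F) ` {F. finite F \<and> F \<subseteq> B}" using F B' by blast
  qed
  moreover have "countable {F. finite F \<and> F \<subseteq> B}"
    using B(1) by (rule countable_Collect_finite_subset)
  ultimately show ?thesis by (meson countable_image countable_subset)
qed

lemma perfect_clopen_split:
  fixes X :: "'a::euclidean_space set"
  assumes "compact X" "totally_disconnected X" and perf: "\<And>x. x \<in> X \<Longrightarrow> x islimpt X"
    and U: "clopen_in X U" "U \<noteq> {}"
  shows "\<exists>V. clopen_in X V \<and> V \<subseteq> U \<and> V \<noteq> {} \<and> U - V \<noteq> {}"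
proof -
  obtain x where x: "x \<in> U" using U by blast
  then have xX: "x \<in> X" using U clopen_in_subset by blast
  obtain W where W: "open W" "U = X \<inter> W"
    using U unfolding clopen_in_def openin_open by auto
  obtain y where y: "y \<in> X" "y \<in> W" "y \<noteq> x"
    using perf[OF xX] x W unfolding islimpt_def by blast
  obtain K where K: "clopen_in X K" "x \<in> K" "K \<subseteq> W - {y}"
    using clopen_separation[OF assms(1,2) xX, of "W - {y}"] W x y
    by (metis Diff_iff Int_iff open_delete singletonD)
  have "K \<subseteq> U" using K clopen_in_subset W by blast
  then show ?thesis using K y W by blast
qed

text \<open>Brouwer's characterisation. Enumerate the clopen sets as B_0, B_1, ... and split X repeatedly into two
nonempty clopen halves, using B_n in step n wherever it cuts properly. The sequence of halves that
contain a given point determines the point, because some B_n separates it from any other one;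
every sequence occurs, by compactness.\<close>

theorem homeomorphic_binary_sequences:
  fixes X :: "'a::euclidean_space set"
  assumes X: "compact X" "totally_disconnected X" "X \<noteq> {}" and perf: "\<And>x. x \<in> X \<Longrightarrow> x islimpt X"
  shows "X homeomorphic (range (\<lambda>b :: nat \<Rightarrow> bool. \<lambda>n. of_bool (b n) :: real))"
proof -
  let ?C = "{K. clopen_in X K}"
  define B where "B = from_nat_into ?C"
  have ne: "?C \<noteq> {}" using clopen_in_whole by blast
  have B: "clopen_in X (B n)" for n
    using from_nat_into[OF ne] by (simp add: B_def)
  have Bsurj: "\<exists>n. K = B n" if "clopen_in X K" for K
    using from_nat_into_surj[OF countable_clopen[OF X(1)], of K] that by (auto simp: B_def)
  define sp where "sp D U = (if U \<inter> D \<noteq> {} \<and> U - D \<noteq> {} then U \<inter> D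
     else (SOME V. clopen_in X V \<and> V \<subseteq> U \<and> V \<noteq> {} \<and> U - V \<noteq> {}))" for D U
  have sp: "clopen_in X (sp D U) \<and> sp D U \<subseteq> U \<and> sp D U \<noteq> {} \<and> U - sp D U \<noteq> {}"
    if "clopen_in X D" "clopen_in X U" "U \<noteq> {}" for D U
  proof (cases "U \<inter> D \<noteq> {} \<and> U - D \<noteq> {}")
    case True
    then show ?thesis using clopen_in_Int that by (auto simp: sp_def)
  next
    case False
    then have "sp D U = (SOME V. clopen_in X V \<and> V \<subseteq> U \<and> V \<noteq> {} \<and> U - V \<noteq> {})"
      unfolding sp_def by (rule if_not_P)
    then show ?thesis
      using someI_ex[OF perfect_clopen_split[OF X(1,2) perf that(2,3)]] by auto
  qed
  define M where "M b = rec_nat X (\<lambda>n U. if b n then sp (B n) U else U - sp (B n) U)" for b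
  have M0: "M b 0 = X" and MS: "M b (Suc n) = (if b n then sp (B n) (M b n) else M b n - sp (B n) (M b n))" for b n
    by (simp_all add: M_def)
  have M: "clopen_in X (M b n) \<and> M b n \<noteq> {}" for b n
  proof (induction n)
    case 0 then show ?case using X clopen_in_whole by (simp add: M0)
  next
    case (Suc n)
    then show ?case using sp[OF B, of "M b n" n] clopen_in_Diff[of X "M b n" "sp (B n) (M b n)"]
      by (auto simp add: MS)
  qed
  \<comment> \<open>N x follows the point x through the splittings, M b follows the prescribed sequence b.\<close>
  define N where "N x = rec_nat X (\<lambda>n U. if x \<in> sp (B n) U then sp (B n) U else U - sp (B n) U)" for x
  have N0: "N x 0 = X" and NS: "N x (Suc n) = (if x \<in> sp (B n) (N x n) then sp (B n) (N x n) else N x n - sp (B n) (N x n))" for x n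
    by (simp_all add: N_def)
  define h where "h x n \<longleftrightarrow> x \<in> sp (B n) (N x n)" for x n
  have NM: "N x n = M (h x) n" for x n
    by (induction n) (simp_all add: N0 NS M0 MS h_def)
  have xN: "x \<in> N x n" if "x \<in> X" for x n
    by (induction n) (use that in \<open>simp_all add: N0 NS\<close>)
  have Meq: "\<forall>m\<le>n. M b m = N x m \<and> (m < n \<longrightarrow> b m = h x m)" if "x \<in> M b n" for x b n
    using that
  proof (induction n)
    case 0 then show ?case by (simp add: M0 N0)
  next
    case (Suc n)
    have sub: "sp (B n) (M b n) \<subseteq> M b n" using sp[OF B, of "M b n" n] M[of b n] by simp
    then have "x \<in> M b n" using Suc.prems by (auto simp: MS split: if_splits)
    then have IH: "\<forall>m\<le>n. M b m = N x m \<and> (m < n \<longrightarrow> b m = h x m)" using Suc.IH by blast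
    then have MN: "M b n = N x n" by simp
    have bh: "b n = h x n" using Suc.prems unfolding MS MN h_def by (simp split: if_splits)
    then have MN': "M b (Suc n) = N x (Suc n)" unfolding MS NS MN h_def by simp
    show ?case
    proof (intro allI impI)
      fix m assume m: "m \<le> Suc n"
      then consider "m = Suc n" | "m = n" | "m < n" by linarith
      then show "M b m = N x m \<and> (m < Suc n \<longrightarrow> b m = h x m)"
        using IH bh MN MN' by cases simp_all
    qed
  qed
  let ?r = "\<lambda>b :: nat \<Rightarrow> bool. \<lambda>n. of_bool (b n) :: real"
  have "continuous_on X (\<lambda>x. ?r (h x))"
  proof (rule continuous_on_coordinatewise_then_product)
    fix n
    have *: "\<exists>T. openin (top_of_set X) T \<and> x \<in> T \<and> (\<forall>y\<in>T. h y n = h x n)" if x: "x \<in> X" for x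
    proof (intro exI conjI)
      show "openin (top_of_set X) (N x (Suc n))" using M[of "h x" "Suc n"] by (simp add: NM clopen_in_def)
      show "x \<in> N x (Suc n)" using xN[OF x] .
      show "\<forall>y\<in>N x (Suc n). h y n = h x n"
      proof
        fix y assume "y \<in> N x (Suc n)"
        then have "y \<in> M (h x) (Suc n)" unfolding NM .
        from spec[OF Meq[OF this], of n] show "h y n = h x n" by simp
      qed
    qed
    then have "((\<lambda>y. of_bool (h y n) :: real) \<longlongrightarrow> of_bool (h x n)) (at x within X)" if x: "x \<in> X" for x
    proof -
      obtain W where "open W" "x \<in> W" "\<forall>y\<in>X \<inter> W. h y n = h x n"
        using * x unfolding openin_open by blast
      then show ?thesis
        by (intro tendsto_eventually) (auto simp: eventually_at_topological)
    qed
    then show "continuous_on X (\<lambda>x. of_bool (h x n) :: real)"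
      unfolding continuous_on_def by blast
  qed
  moreover have "inj_on h X"
  proof (rule inj_onI, rule ccontr)
    fix x y assume xy: "x \<in> X" "y \<in> X" "h x = h y" "x \<noteq> y"
    obtain K where K: "clopen_in X K" "x \<in> K" "K \<subseteq> -{y}"
      using clopen_separation[OF X(1,2) xy(1), of "-{y}"] xy(4) by auto
    obtain n where n: "K = B n" using Bsurj K by blast
    have "N x n = N y n" by (simp add: NM xy)
    then have "x \<in> N x n" "y \<in> N x n" using xN xy by auto
    then have "sp (B n) (N x n) = N x n \<inter> B n" using K n by (auto simp: sp_def)
    then have "h x n \<noteq> h y n" using \<open>N x n = N y n\<close> \<open>x \<in> N x n\<close> K n by (auto simp: h_def)
    then show False using xy by simp
  qed
  moreover have "h ` X = UNIV"
  proof -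
    have "b \<in> h ` X" for b
    proof -
      have sub: "M b (Suc n) \<subseteq> M b n" for n using sp[OF B, of "M b n" n] M[of b n] by (auto simp: MS)
      have "(\<Inter>n. M b n) \<noteq> {}"
      proof (rule compact_nest)
        show "compact (M b n)" for n using M[of b n] X(1) closedin_compact clopen_in_def by blast
        show "M b n \<noteq> {}" for n using M by blast
        show "M b n \<subseteq> M b m" if "m \<le> n" for m n using lift_Suc_antimono_le[of "M b", OF sub that] .
      qed
      then obtain x where x: "\<And>n. x \<in> M b n" by blast
      have "b n = h x n" for n using spec[OF Meq[OF x[of "Suc n"]], of n] by simp
      moreover have "x \<in> X" using x[of 0] unfolding M0 .
      ultimately have "b = h x" by (simp add: fun_eq_iff)
      with \<open>x \<in> X\<close> show ?thesis by blast
    qed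
    then show ?thesis by blast
  qed
  ultimately have "continuous_on X (?r \<circ> h)" "inj_on (?r \<circ> h) X" "?r ` (h ` X) = range ?r"
    by (auto simp: inj_on_def fun_eq_iff o_def)
  then have "continuous_on X (?r \<circ> h)" "inj_on (?r \<circ> h) X" "(?r \<circ> h) ` X = range ?r"
    by (simp_all only: image_comp)
  then show ?thesis using homeomorphic_compact[OF X(1)] by blast
qed

lemma cantor_stage_closed: "closed (cantor_stage n)"
proof (induction n)
  case (Suc n)
  have "closed ((\<lambda>x. x / 3) ` cantor_stage n)"
    using closed_scaling[OF Suc, of "1/3"] by (simp add: field_simps)
  moreover have "(\<lambda>x. 2 / 3 + x / 3) ` cantor_stage n = (+) (2/3) ` ((\<lambda>x. x / 3) ` cantor_stage n)"
    by (simp add: image_image)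
  ultimately show ?case by (simp add: closed_translation closed_Un)
qed simp

lemma cantor_stage_bounds: "cantor_stage n \<subseteq> {0..1}"
  by (induction n) force+

abbreviation cantor :: "real set" where "cantor \<equiv> middle_thirds_cantor_set"

lemma compact_cantor: "compact cantor"
proof -
  have "closed cantor"
    unfolding middle_thirds_cantor_set_def using cantor_stage_closed by blast
  moreover have "cantor \<subseteq> {0..1}"
    unfolding middle_thirds_cantor_set_def using cantor_stage_bounds by blast
  ultimately show ?thesis
    by (meson bounded_closed_interval bounded_subset compact_eq_bounded_closed)
qed

lemma cantor_endpoints: "0 \<in> cantor" "1 \<in> cantor"
proof -
  have "0 \<in> cantor_stage n \<and> 1 \<in> cantor_stage n" for n
    by (induction n) (auto intro!: image_eqI[of _ _ 0] image_eqI[of _ _ 1])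
  then show "0 \<in> cantor" "1 \<in> cantor"
    by (auto simp: middle_thirds_cantor_set_def)
qed

lemma cantor_left: "x \<in> cantor \<Longrightarrow> x / 3 \<in> cantor"
  and cantor_right: "x \<in> cantor \<Longrightarrow> 2 / 3 + x / 3 \<in> cantor"
proof -
  assume x: "x \<in> cantor"
  then have "x \<in> cantor_stage n" for n by (auto simp: middle_thirds_cantor_set_def)
  then have st: "x \<in> cantor_stage n" for n .
  have "0 \<le> x" "x \<le> 1" using st[of 0] by auto
  with st have "x / 3 \<in> cantor_stage n \<and> 2 / 3 + x / 3 \<in> cantor_stage n" for n
    by (cases n) auto
  then show "x / 3 \<in> cantor" "2 / 3 + x / 3 \<in> cantor"
    by (auto simp: middle_thirds_cantor_set_def)
qed

text \<open>Together with cantor_left and cantor_right, the self-similarity from which both total disconnectedness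
and perfectness follow by induction on the scale.\<close>

lemma cantor_cases:
  assumes x: "x \<in> cantor"
  obtains y where "y \<in> cantor" "x = y / 3"
  | y where "y \<in> cantor" "x = 2 / 3 + y / 3"
proof (cases "x \<le> 1 / 2")
  case True
  have "3 * x \<in> cantor_stage n" for n
  proof -
    have "x \<in> cantor_stage (Suc n)" using x unfolding middle_thirds_cantor_set_def by blast
    then obtain z where "z \<in> cantor_stage n" "x = z / 3 \<or> x = 2 / 3 + z / 3"
      unfolding cantor_stage.simps by blast
    moreover have "0 \<le> z" using calculation(1) cantor_stage_bounds[of n] by auto
    ultimately show ?thesis using True by (auto simp: mult.commute)
  qed
  then show ?thesis using that(1)[of "3 * x"] unfolding middle_thirds_cantor_set_def by simp
next
  case False
  have "3 * x - 2 \<in> cantor_stage n" for n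
  proof -
    have "x \<in> cantor_stage (Suc n)" using x unfolding middle_thirds_cantor_set_def by blast
    then obtain z where "z \<in> cantor_stage n" "x = z / 3 \<or> x = 2 / 3 + z / 3"
      unfolding cantor_stage.simps by blast
    moreover have "z \<le> 1" using calculation(1) cantor_stage_bounds[of n] by auto
    ultimately show ?thesis using False by auto
  qed
  then have "3 * x - 2 \<in> cantor" by (simp add: middle_thirds_cantor_set_def)
  then show ?thesis by (rule that(2)) (simp add: field_simps)
qed

lemma cantor_stage_connected:
  "T \<subseteq> cantor_stage n \<Longrightarrow> connected T \<Longrightarrow> x \<in> T \<Longrightarrow> y \<in> T \<Longrightarrow> x \<le> y \<Longrightarrow> y - x \<le> (1/3)^n"
proof (induction n arbitrary: T x y)
  case 0
  then have "x \<in> {0..1}" "y \<in> {0..1}" by auto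
  then show ?case by auto
next
  case (Suc n)
  have ivl: "z \<in> T" if "x \<le> z" "z \<le> y" for z
    using Suc.prems that connected_contains_Icc[of T x y] by auto
  have "1/2 \<notin> T" 
  proof
    assume "1/2 \<in> T"
    then obtain z where "z \<in> cantor_stage n" "1/2 = z / 3 \<or> 1/2 = 2 / 3 + z / 3"
      using Suc.prems(1) unfolding cantor_stage.simps by blast
    moreover have "0 \<le> z \<and> z \<le> 1" using calculation(1) cantor_stage_bounds[of n] by auto
    ultimately show False by auto
  qed
  then have nh: "\<not> (x \<le> 1/2 \<and> 1/2 \<le> y)" using ivl by blast
  have sub: "{x..y} \<subseteq> (\<lambda>x. x / 3) ` cantor_stage n \<union> (\<lambda>x. 2 / 3 + x / 3) ` cantor_stage n"
  proof -
    have "{x..y} \<subseteq> T" using ivl by auto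
    then show ?thesis using Suc.prems(1) unfolding cantor_stage.simps by blast
  qed
  consider "y < 1/2" | "1/2 < x" using nh Suc.prems by linarith
  then show ?case
  proof cases
    case 1
    have "{3*x..3*y} \<subseteq> cantor_stage n"
    proof
      fix z assume "z \<in> {3*x..3*y}"
      then have "z/3 \<in> {x..y}" by auto
      then show "z \<in> cantor_stage n" using sub cantor_stage_bounds[of n] 1 by fastforce
    qed
    from Suc.IH[OF this, of "3*x" "3*y"] show ?thesis using Suc.prems by auto
  next
    case 2
    have "{3*x-2..3*y-2} \<subseteq> cantor_stage n"
    proof
      fix z assume "z \<in> {3*x-2..3*y-2}"
      then have "2/3+z/3 \<in> {x..y}" by auto
      then show "z \<in> cantor_stage n" using sub cantor_stage_bounds[of n] 2 by fastforce
    qed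
    from Suc.IH[OF this, of "3*x-2" "3*y-2"] show ?thesis using Suc.prems by auto
  qed
qed

lemma totally_disconnected_cantor: "totally_disconnected cantor"
  unfolding totally_disconnected_def
proof (intro allI impI ballI)
  fix T x y assume T: "T \<subseteq> cantor" "connected T" "x \<in> T" "y \<in> T"
  have *: "b - a \<le> (1/3)^n" if "a \<in> T" "b \<in> T" "a \<le> b" for a b n
    using cantor_stage_connected[of T n a b] T that by (auto simp: middle_thirds_cantor_set_def)
  have "b - a \<le> 0" if "a \<in> T" "b \<in> T" "a \<le> b" for a b
    by (rule LIMSEQ_le_const[of "\<lambda>n. (1/3)^n"]) (use *[OF that] in \<open>auto intro!: LIMSEQ_power_zero\<close>)
  from this[of x y] this[of y x] show "x = y" using T by linarith
qed

lemma perfect_cantor: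
  assumes "x \<in> cantor"
  shows "x islimpt cantor"
proof -
  have *: "\<exists>y\<in>cantor. y \<noteq> x \<and> \<bar>y - x\<bar> \<le> (1/3)^n"
    if "x \<in> cantor" for x n
    using that
  proof (induction n arbitrary: x)
    case 0
    then have "x \<in> cantor_stage 0" unfolding middle_thirds_cantor_set_def by blast
    then have "0 \<le> x" "x \<le> 1" by auto
    then show ?case using cantor_endpoints
      by (cases "x = 0") (auto intro: bexI[of _ 1] bexI[of _ 0])
  next
    case (Suc n)
    from Suc.prems show ?case
    proof (cases rule: cantor_cases)
      case (1 z)
      then obtain y where "y \<in> cantor" "y \<noteq> z" "\<bar>y - z\<bar> \<le> (1/3)^n" using Suc.IH by blast
      then show ?thesis using 1 cantor_left[of y]
        by (intro bexI[of _ "y/3"]) (auto simp: abs_if field_simps split: if_splits)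
    next
      case (2 z)
      then obtain y where "y \<in> cantor" "y \<noteq> z" "\<bar>y - z\<bar> \<le> (1/3)^n" using Suc.IH by blast
      then show ?thesis using 2 cantor_right[of y]
        by (intro bexI[of _ "2/3 + y/3"]) (auto simp: abs_if field_simps split: if_splits)
    qed
  qed
  show ?thesis
    unfolding islimpt_approachable
  proof (intro allI impI)
    fix e :: real assume "0 < e"
    then obtain n where "(1/3)^n < e" using real_arch_pow_inv[of e "1/3"] by auto
    then show "\<exists>x'\<in>cantor. x' \<noteq> x \<and> dist x' x < e"
      using *[OF assms, of n] by (force simp: dist_real_def)
  qed
qed

text \<open>Both sets are homeomorphic to the space of binary sequences, the middle-thirds set being itself
compact, totally disconnected and perfect.\<close>

theorem is_cantor_setI:
  fixes X :: "'a::euclidean_space set"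
  assumes "compact X" "totally_disconnected X" "X \<noteq> {}" "\<And>x. x \<in> X \<Longrightarrow> x islimpt X"
  shows "is_cantor_set X"
proof -
  have "cantor homeomorphic (range (\<lambda>b :: nat \<Rightarrow> bool. \<lambda>n. of_bool (b n) :: real))"
    using homeomorphic_binary_sequences compact_cantor totally_disconnected_cantor perfect_cantor cantor_endpoints
    by blast
  then show ?thesis
    unfolding is_cantor_set_def using homeomorphic_binary_sequences[OF assms]
    by (meson homeomorphic_sym homeomorphic_trans)
qed

section \<open>Polynomials and polynomial hulls\<close>

lemma complex_polynomial_monomial:
  "complex_polynomial (\<lambda>z. c * (\<Prod>i\<in>UNIV. (z $ i) ^ \<alpha> i))"
  unfolding complex_polynomial_def
  by (intro exI[of _ "{\<alpha>}"] exI[of _ "\<lambda>_. c"]) simp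

lemma complex_polynomial_const [intro!]: "complex_polynomial (\<lambda>z. c)"
  using complex_polynomial_monomial[of c "\<lambda>_. 0"] by simp

lemma complex_polynomial_coord [intro!]:
  fixes i :: "'n::finite"
  shows "complex_polynomial (\<lambda>z. z $ i)"
proof -
  have "(\<Prod>j\<in>UNIV. (z $ j) ^ (if j = i then 1 else 0)) = z $ i" for z :: "complex ^ 'n"
    by (subst prod.mono_neutral_right[of _ "{i}"]) auto
  then show ?thesis
    using complex_polynomial_monomial[of 1 "\<lambda>j. if j = i then 1 else 0"] by simp
qed

lemma complex_polynomial_add [intro!]:
  assumes "complex_polynomial p" "complex_polynomial q"
  shows "complex_polynomial (\<lambda>z. p z + q z)"
proof -
  obtain A c B d where *: "finite A" "p = (\<lambda>z. \<Sum>\<alpha>\<in>A. c \<alpha> * (\<Prod>i\<in>UNIV. (z $ i) ^ \<alpha> i))"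
    "finite B" "q = (\<lambda>z. \<Sum>\<alpha>\<in>B. d \<alpha> * (\<Prod>i\<in>UNIV. (z $ i) ^ \<alpha> i))"
    using assms unfolding complex_polynomial_def by blast
  define e where "e \<alpha> = (if \<alpha> \<in> A then c \<alpha> else 0) + (if \<alpha> \<in> B then d \<alpha> else 0)" for \<alpha>
  have "p z + q z = (\<Sum>\<alpha>\<in>A \<union> B. e \<alpha> * (\<Prod>i\<in>UNIV. (z $ i) ^ \<alpha> i))" for z
  proof -
    have "p z = (\<Sum>\<alpha>\<in>A \<union> B. (if \<alpha> \<in> A then c \<alpha> else 0) * (\<Prod>i\<in>UNIV. (z $ i) ^ \<alpha> i))"
      unfolding * using *(1,3) by (intro sum.mono_neutral_cong_left) auto
    moreover have "q z = (\<Sum>\<alpha>\<in>A \<union> B. (if \<alpha> \<in> B then d \<alpha> else 0) * (\<Prod>i\<in>UNIV. (z $ i) ^ \<alpha> i))"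
      unfolding * using *(1,3) by (intro sum.mono_neutral_cong_left) auto
    ultimately show ?thesis by (simp add: e_def distrib_right sum.distrib)
  qed
  then show ?thesis
    unfolding complex_polynomial_def using *
    by (intro exI[of _ "A \<union> B"] exI[of _ e]) (simp add: fun_eq_iff)
qed

lemma complex_polynomial_sum:
  assumes "\<And>i. i \<in> I \<Longrightarrow> complex_polynomial (f i)"
  shows "complex_polynomial (\<lambda>z. \<Sum>i\<in>I. f i z)"
proof (cases "finite I")
  case True
  then show ?thesis using assms by (induction I rule: finite_induct) auto
qed auto

lemma complex_polynomial_mult [intro!]:
  assumes "complex_polynomial p" "complex_polynomial q"
  shows "complex_polynomial (\<lambda>z. p z * q z)"
proof -
  obtain A c B d where *: "finite A" "p = (\<lambda>z. \<Sum>\<alpha>\<in>A. c \<alpha> * (\<Prod>i\<in>UNIV. (z $ i) ^ \<alpha> i))"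
    "finite B" "q = (\<lambda>z. \<Sum>\<alpha>\<in>B. d \<alpha> * (\<Prod>i\<in>UNIV. (z $ i) ^ \<alpha> i))"
    using assms unfolding complex_polynomial_def by blast
  have "p z * q z = (\<Sum>\<alpha>\<in>A. \<Sum>\<beta>\<in>B. (c \<alpha> * d \<beta>) * (\<Prod>i\<in>UNIV. (z $ i) ^ (\<alpha> i + \<beta> i)))" for z
    unfolding * by (simp add: sum_product power_add prod.distrib mult_ac)
  then show ?thesis
    by (simp add: complex_polynomial_sum complex_polynomial_monomial)
qed

lemma complex_polynomial_power [intro!]:
  "complex_polynomial p \<Longrightarrow> complex_polynomial (\<lambda>z. p z ^ n)"
  by (induction n) auto

lemma complex_polynomial_diff [intro!]:
  "complex_polynomial p \<Longrightarrow> complex_polynomial q \<Longrightarrow> complex_polynomial (\<lambda>z. p z - q z)"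
  using complex_polynomial_add[of p "\<lambda>z. (-1) * q z"] complex_polynomial_mult[of "\<lambda>z. -1" q]
  by auto

text \<open>Polynomials are generated by constants and coordinates, which turns statements on all polynomials
into inductions that never mention exponent vectors.\<close>

lemma complex_polynomial_induct [consumes 1, case_names const coord add mult]:
  fixes p :: "complex ^ 'n \<Rightarrow> complex"
  assumes "complex_polynomial p"
    and const: "\<And>c. S (\<lambda>z. c)"
    and coord: "\<And>i. S (\<lambda>z. z $ i)"
    and add: "\<And>p q. S p \<Longrightarrow> S q \<Longrightarrow> S (\<lambda>z. p z + q z)"
    and mult: "\<And>p q. S p \<Longrightarrow> S q \<Longrightarrow> S (\<lambda>z. p z * q z)"
  shows "S p"
proof -
  obtain A c where *: "finite A" "p = (\<lambda>z. \<Sum>\<alpha>\<in>A. c \<alpha> * (\<Prod>i\<in>UNIV. (z $ i) ^ \<alpha> i))"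
    using assms(1) unfolding complex_polynomial_def by blast
  have pow: "S (\<lambda>z. (z $ i) ^ n)" for i n
    by (induction n) (simp_all add: const coord mult)
  have "S (\<lambda>z. \<Prod>i\<in>I. (z $ i) ^ \<alpha> i)" if "finite I" for I \<alpha>
    using that by (induction I rule: finite_induct) (simp_all add: const pow mult)
  then have mono: "S (\<lambda>z. \<Prod>i\<in>UNIV. (z $ i) ^ \<alpha> i)" for \<alpha> by simp
  have "S (\<lambda>z. \<Sum>\<alpha>\<in>A'. c \<alpha> * (\<Prod>i\<in>UNIV. (z $ i) ^ \<alpha> i))" if "finite A'" for A'
    using that by (induction A' rule: finite_induct) (simp_all add: const mult add mono)
  then show ?thesis using * by simp
qed

text \<open>Membership in the hull without the supremum. The bound B need not be attained, so that it can be
used with any estimate on L.\<close>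

definition in_hull :: "(complex ^ 'n) set \<Rightarrow> complex ^ 'n \<Rightarrow> bool" where
  "in_hull L y \<longleftrightarrow>
     (\<forall>P B. complex_polynomial P \<longrightarrow> (\<forall>x\<in>L. norm (P x) \<le> B) \<longrightarrow> norm (P y) \<le> B)"

lemma in_hullD: "in_hull L y \<Longrightarrow> complex_polynomial P \<Longrightarrow> (\<And>x. x \<in> L \<Longrightarrow> norm (P x) \<le> B) \<Longrightarrow> norm (P y) \<le> B"
  by (auto simp: in_hull_def)

lemma polynomial_hull_iff:
  assumes "compact L" "L \<noteq> {}"
  shows "y \<in> polynomial_hull L \<longleftrightarrow> in_hull L y"
proof
  assume y: "y \<in> polynomial_hull L"
  show "in_hull L y"
    unfolding in_hull_def
  proof (intro allI impI)
    fix P B assume P: "complex_polynomial P" "\<forall>x\<in>L. norm (P x) \<le> B"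
    have "norm (P y) \<le> (SUP x\<in>L. norm (P x))" using y P by (auto simp: polynomial_hull_def)
    also have "\<dots> \<le> B" using assms P by (intro cSUP_least) auto
    finally show "norm (P y) \<le> B" .
  qed
next
  assume y: "in_hull L y"
  show "y \<in> polynomial_hull L"
    unfolding polynomial_hull_def
  proof (intro CollectI allI impI)
    fix P :: "complex ^ 'a \<Rightarrow> complex" assume P: "complex_polynomial P"
    then show "norm (P y) \<le> (SUP x\<in>L. norm (P x))"
      using complex_polynomial_attains_SUP[OF P assms] by (intro in_hullD[OF y P]) auto
  qed
qed

lemma in_hull_nonempty: "in_hull L y \<Longrightarrow> L \<noteq> {}"
  using in_hullD[of L y "\<lambda>_. 1" 0] by auto

text \<open>A suitable power of P, after rescaling, makes the gap between the values at y and on L as large as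
desired.\<close>

lemma amplify:
  assumes P: "complex_polynomial P" "\<And>x. x \<in> L \<Longrightarrow> norm (P x) \<le> B" "L \<noteq> {}" "B < norm (P y)"
  obtains P' where "complex_polynomial P'" "\<And>x. x \<in> L \<Longrightarrow> norm (P' x) \<le> 1/3" "norm (P' y) \<ge> 3"
proof -
  have B0: "0 \<le> B" using P(2,3) norm_ge_zero order_trans by blast
  obtain t where t: "B < t" "t < norm (P y)" using dense P(4) by blast
  have Ppos: "0 < norm (P y)" using B0 P(4) by linarith
  then have lt1: "t / norm (P y) < 1" using t(2) by (simp add: field_simps)
  have "B / t < 1" using t B0 by simp
  have l1: "(\<lambda>n. (B/t)^n) \<longlonglongrightarrow> 0" and l2: "(\<lambda>n. (t / norm (P y))^n) \<longlonglongrightarrow> 0"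
    using t B0 lt1 \<open>B / t < 1\<close> by (intro LIMSEQ_power_zero; simp)+
  have "\<forall>\<^sub>F n in sequentially. (B/t)^n < 1/3 \<and> (t / norm (P y))^n < 1/3"
    by (rule eventually_conj[OF order_tendstoD(2)[OF l1] order_tendstoD(2)[OF l2]]) simp_all
  then obtain n where n: "(B/t)^n < 1/3" "(t / norm (P y))^n < 1/3"
    using eventually_happens'[OF sequentially_bot] by blast
  show ?thesis
  proof (rule that[of "\<lambda>z. (of_real (1/t) * P z)^n"])
    show "complex_polynomial (\<lambda>z. (of_real (1/t) * P z)^n)"
      by (intro complex_polynomial_power complex_polynomial_mult complex_polynomial_const P(1))
    show "norm ((of_real (1/t) * P x)^n) \<le> 1/3" if "x \<in> L" for x
    proof -
      have "norm ((of_real (1/t) * P x)^n) = (norm (P x) / t)^n"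
        using t B0 by (simp add: norm_power norm_mult norm_divide)
      also have "\<dots> \<le> (B/t)^n" using P(2)[OF that] t B0 by (intro power_mono divide_right_mono) auto
      finally show ?thesis using n by simp
    qed
    have "3 \<le> (norm (P y) / t)^n" using n(2) t B0 Ppos by (simp add: power_divide field_simps)
    then show "3 \<le> norm ((of_real (1/t) * P y)^n)"
      using t B0 by (simp add: norm_power norm_mult norm_divide)
  qed
qed

text \<open>Substituting v + c r e_k with r a square root of p(v): even powers of r are polynomials in v again.\<close>

lemma polynomial_root_split:
  assumes P: "complex_polynomial P" and p: "complex_polynomial p"
  shows "\<exists>A B. complex_polynomial A \<and> complex_polynomial B \<and>
    (\<forall>v r. r\<^sup>2 = p v \<longrightarrow> P (v + axis k (c * r)) = A v + B v * r)"
  using P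
proof (induction P rule: complex_polynomial_induct)
  case (const d)
  show ?case by (intro exI[of _ "\<lambda>_. d"] exI[of _ "\<lambda>_. 0"]) auto
next
  case (coord i)
  show ?case
    by (intro exI[of _ "\<lambda>v. v $ i"] exI[of _ "\<lambda>_. if i = k then c else 0"]) (auto simp: axis_def)
next
  case (add f g)
  then obtain A B A' B' where *: "complex_polynomial A" "complex_polynomial B"
    "complex_polynomial A'" "complex_polynomial B'"
    "\<And>v r. r\<^sup>2 = p v \<Longrightarrow> f (v + axis k (c * r)) = A v + B v * r"
    "\<And>v r. r\<^sup>2 = p v \<Longrightarrow> g (v + axis k (c * r)) = A' v + B' v * r" by blast
  then show ?case
    by (intro exI[of _ "\<lambda>v. A v + A' v"] exI[of _ "\<lambda>v. B v + B' v"]) (auto simp: algebra_simps)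
next
  case (mult f g)
  then obtain A B A' B' where *: "complex_polynomial A" "complex_polynomial B"
    "complex_polynomial A'" "complex_polynomial B'"
    "\<And>v r. r\<^sup>2 = p v \<Longrightarrow> f (v + axis k (c * r)) = A v + B v * r"
    "\<And>v r. r\<^sup>2 = p v \<Longrightarrow> g (v + axis k (c * r)) = A' v + B' v * r" by blast
  have "(A v + B v * r) * (A' v + B' v * r) = (A v * A' v + B v * B' v * p v) + (A v * B' v + B v * A' v) * r"
    if "r\<^sup>2 = p v" for v r
    unfolding that[symmetric] by (simp add: algebra_simps power2_eq_square)
  then show ?case using * p
    by (intro exI[of _ "\<lambda>v. A v * A' v + B v * B' v * p v"] exI[of _ "\<lambda>v. A v * B' v + B v * A' v"]) auto
qed

text \<open>The norm of P over the base, that is the product of its values at the two lifted points; it does not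
depend on which root is called r.\<close>

lemma polynomial_norm:
  assumes P: "complex_polynomial P" and p: "complex_polynomial p"
  obtains N where "complex_polynomial N"
    "\<And>v r. r\<^sup>2 = p v \<Longrightarrow> N v = P (v + axis k (c * r)) * P (v + axis k (- (c * r)))"
proof -
  obtain A B where *: "complex_polynomial A" "complex_polynomial B"
    "\<And>v r. r\<^sup>2 = p v \<Longrightarrow> P (v + axis k (c * r)) = A v + B v * r"
    using polynomial_root_split[OF P p, of k c] by auto
  show ?thesis
  proof (rule that[of "\<lambda>v. A v * A v - B v * B v * p v"])
    show "complex_polynomial (\<lambda>v. A v * A v - B v * B v * p v)"
      by (intro complex_polynomial_diff complex_polynomial_mult * p)
    show "A v * A v - B v * B v * p v = P (v + axis k (c * r)) * P (v + axis k (- (c * r)))"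
      if "r\<^sup>2 = p v" for v r
    proof -
      have "P (v + axis k (- (c * r))) = A v - B v * r" using *(3)[of "-r" v] that by simp
      then have "P (v + axis k (c * r)) * P (v + axis k (- (c * r))) = (A v + B v * r) * (A v - B v * r)"
        using *(3)[OF that] by simp
      then show ?thesis unfolding that[symmetric] by (simp add: algebra_simps power2_eq_square)
    qed
  qed
qed

text \<open>If neither lifted point of y were in the hull, there would be P1 and P2, at most 1/3 on the lifted
set, with values at least 3 at one lifted point each. The norm inequality then makes P1 small where
P2 is large and vice versa, so P1 + P2 is large at both points and violates the norm inequality.\<close>

lemma in_hull_root:
  assumes p: "complex_polynomial p" and y: "in_hull L y"
  shows "\<exists>r. r\<^sup>2 = p y \<and> in_hull {x + axis k (c * r) | x r. x \<in> L \<and> r\<^sup>2 = p x} (y + axis k (c * r))"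
proof (rule ccontr)
  define L' where "L' = {x + axis k (c * r) | x r. x \<in> L \<and> r\<^sup>2 = p x}"
  assume "\<not> ?thesis"
  then have no: "\<not> in_hull L' (y + axis k (c * r))" if "r\<^sup>2 = p y" for r
    using that unfolding L'_def by blast
  have L'I: "x + axis k (c * r) \<in> L'" if "x \<in> L" "r\<^sup>2 = p x" for x r
    using that unfolding L'_def by blast
  define s where "s = csqrt (p y)"
  have s: "s\<^sup>2 = p y" "(-s)\<^sup>2 = p y" by (auto simp: s_def)
  obtain x where "x \<in> L" using in_hull_nonempty[OF y] by blast
  then have ne: "L' \<noteq> {}" using L'I[of x "csqrt (p x)"] by auto
  have prod: "norm (P (y + axis k (c * s))) * norm (P (y + axis k (- (c * s)))) \<le> M * M"
    if P: "complex_polynomial P" and M: "\<And>x. x \<in> L' \<Longrightarrow> norm (P x) \<le> M" for P M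
  proof -
    obtain N where N: "complex_polynomial N"
      "\<And>v r. r\<^sup>2 = p v \<Longrightarrow> N v = P (v + axis k (c * r)) * P (v + axis k (- (c * r)))"
      using polynomial_norm[OF P p, of k c] by metis
    have "norm (N y) \<le> M * M"
    proof (rule in_hullD[OF y N(1)])
      fix x assume x: "x \<in> L"
      have "x + axis k (c * csqrt (p x)) \<in> L'" using x L'I by simp
      moreover have "x + axis k (- (c * csqrt (p x))) \<in> L'"
        using L'I[OF x, of "- csqrt (p x)"] by simp
      ultimately show "norm (N x) \<le> M * M"
        using N(2)[of "csqrt (p x)" x] by (auto simp: norm_mult intro!: mult_mono' M)
    qed
    then show ?thesis using N(2)[OF s(1)] by (simp add: norm_mult)
  qed
  have ex: "\<exists>P. complex_polynomial P \<and> (\<forall>x\<in>L'. norm (P x) \<le> 1/3) \<and> norm (P (y + axis k (c * r))) \<ge> 3"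
    if r: "r\<^sup>2 = p y" for r
  proof -
    obtain P B where "complex_polynomial P" "\<forall>x\<in>L'. norm (P x) \<le> B" "\<not> norm (P (y + axis k (c * r))) \<le> B"
      using no[OF r] unfolding in_hull_def by blast
    then have "complex_polynomial P" "\<And>x. x \<in> L' \<Longrightarrow> norm (P x) \<le> B" "B < norm (P (y + axis k (c * r)))"
      by auto
    then obtain P' where "complex_polynomial P'" "\<And>x. x \<in> L' \<Longrightarrow> norm (P' x) \<le> 1/3"
      "norm (P' (y + axis k (c * r))) \<ge> 3"
      using amplify[OF _ _ ne, of P B "y + axis k (c * r)"] by metis
    then show ?thesis by blast
  qed
  obtain P1 where P1: "complex_polynomial P1" "\<And>x. x \<in> L' \<Longrightarrow> norm (P1 x) \<le> 1/3"
    "norm (P1 (y + axis k (c * s))) \<ge> 3" using ex[OF s(1)] by blast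
  obtain P2 where P2: "complex_polynomial P2" "\<And>x. x \<in> L' \<Longrightarrow> norm (P2 x) \<le> 1/3"
    "norm (P2 (y + axis k (- (c * s)))) \<ge> 3" using ex[OF s(2)] by auto
  have "3 * norm (P1 (y + axis k (- (c * s)))) \<le> (1/3) * (1/3)"
    using prod[OF P1(1,2)] P1(3) mult_right_mono[OF P1(3), of "norm (P1 (y + axis k (- (c * s))))"] by simp
  then have a: "norm (P1 (y + axis k (- (c * s)))) \<le> 1" by simp
  have "norm (P2 (y + axis k (c * s))) * 3 \<le> (1/3) * (1/3)"
    using prod[OF P2(1,2)] P2(3) mult_left_mono[OF P2(3), of "norm (P2 (y + axis k (c * s)))"] by simp
  then have b: "norm (P2 (y + axis k (c * s))) \<le> 1" by simp
  have "norm (P1 x + P2 x) \<le> 2/3" if "x \<in> L'" for x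
    using norm_triangle_ineq[of "P1 x" "P2 x"] P1(2)[OF that] P2(2)[OF that] by linarith
  from prod[OF complex_polynomial_add[OF P1(1) P2(1)] this]
  have "norm (P1 (y + axis k (c * s)) + P2 (y + axis k (c * s))) *
    norm (P1 (y + axis k (- (c * s))) + P2 (y + axis k (- (c * s)))) \<le> 2/3 * (2/3)" .
  moreover have "norm (P1 (y + axis k (c * s)) + P2 (y + axis k (c * s))) \<ge> 2"
    using norm_diff_ineq[of "P1 (y + axis k (c * s))" "P2 (y + axis k (c * s))"] P1(3) b by linarith
  moreover have "norm (P1 (y + axis k (- (c * s))) + P2 (y + axis k (- (c * s)))) \<ge> 2"
    using norm_diff_ineq[of "P2 (y + axis k (- (c * s)))" "P1 (y + axis k (- (c * s)))"] P2(3) a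
    by (simp add: add.commute)
  ultimately have "(2::real) * 2 \<le> 2/3 * (2/3)"
    using order_trans[OF mult_mono[of 2 _ "2::real"]] by fastforce
  then show False by simp
qed

section \<open>Cauchy transforms of planar sets\<close>

lemma emeasure_complex_cbox:
  assumes "a \<le> c" "b \<le> d"
  shows "emeasure lborel (cbox (Complex a b) (Complex c d)) = ennreal ((c - a) * (d - b))"
  using assms by (subst emeasure_lborel_cbox) (auto simp: Basis_complex_def inner_complex_def)

definition square_around :: "complex \<Rightarrow> real \<Rightarrow> complex set" where
  "square_around z e = cbox (Complex (Re z - e) (Im z - e)) (Complex (Re z + e) (Im z + e))"

lemma mem_square_around: "w \<in> square_around z e \<longleftrightarrow> \<bar>Re w - Re z\<bar> \<le> e \<and> \<bar>Im w - Im z\<bar> \<le> e"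
  by (auto simp: square_around_def in_cbox_complex_iff abs_le_iff)

text \<open>Dominating 1 / |w - z| by a sum of multiples of indicators of squares with side halved at each step
avoids polar coordinates: the k-th square has area proportional to 4^(-k), and outside the next one
the kernel is at most of order 2^k.\<close>

lemma kernel_bound_square:
  assumes e: "0 < e"
  shows "(\<integral>\<^sup>+w. ennreal (1 / norm (w - z)) * indicator (square_around z e) w \<partial>lborel) \<le> ennreal (16 * e)"
proof -
  let ?Q = "\<lambda>k. square_around z (e / 2 ^ k)"
  let ?t = "\<lambda>k w. ennreal (2 ^ (k + 1) / e) * indicator (?Q k) w"
  have term_le: "g j \<le> suminf g" for g :: "nat \<Rightarrow> ennreal" and j
    using sum_le_suminf[of g "{j}"] by simp
  have pt: "ennreal (1 / norm (w - z)) * indicator (square_around z e) w \<le> (\<Sum>k. ?t k w)" for w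
  proof (cases "w \<in> square_around z e \<and> w \<noteq> z")
    case True
    define m where "m = max \<bar>Re w - Re z\<bar> \<bar>Im w - Im z\<bar>"
    have m: "0 < m" using True by (auto simp: m_def complex_eq_iff less_max_iff_disj)
    have memQ: "w \<in> ?Q k \<longleftrightarrow> m \<le> e / 2 ^ k" for k by (auto simp: mem_square_around m_def)
    have "\<exists>k. \<not> m \<le> e / 2 ^ k"
    proof -
      obtain k where "(1/2) ^ k < m / e" using real_arch_pow_inv[of "m/e" "1/2"] m e by auto
      then show ?thesis using e by (intro exI[of _ k]) (simp add: field_simps)
    qed
    then obtain k where k: "\<not> m \<le> e / 2 ^ k" "\<And>j. j < k \<Longrightarrow> m \<le> e / 2 ^ j"
      using exists_least_iff[of "\<lambda>k. \<not> m \<le> e / 2 ^ k"] by blast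
    have "m \<le> e" using True memQ[of 0] by simp
    then have "k \<noteq> 0" using k(1) by (cases k) auto
    then obtain j where j: "k = Suc j" by (cases k) auto
    have "m \<le> norm (w - z)" using abs_Re_le_cmod[of "w - z"] abs_Im_le_cmod[of "w - z"] by (simp add: m_def)
    then have "e / 2 ^ k < norm (w - z)" using k(1) by linarith
    moreover from this have "0 < norm (w - z)" by (rule order.strict_trans[rotated]) (use e in simp)
    ultimately have "1 / norm (w - z) \<le> 2 ^ (j + 1) / e" using e unfolding j by (simp add: field_simps)
    moreover have "w \<in> ?Q j" unfolding memQ using k(2)[of j] j by simp
    ultimately have "ennreal (1 / norm (w - z)) * indicator (square_around z e) w \<le> ?t j w"
      using True by (simp add: ennreal_leI)
    also have "\<dots> \<le> (\<Sum>k. ?t k w)" by (rule term_le)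
    finally show ?thesis .
  next
    case False
    then have "ennreal (1 / norm (w - z)) * indicator (square_around z e) w = 0" by (auto simp: indicator_def)
    then show ?thesis by (simp only: zero_le)
  qed
  have term_int: "(\<integral>\<^sup>+w. ?t k w \<partial>lborel) = ennreal (8 * e * (1/2) ^ k)" for k
  proof -
    have "emeasure lborel (?Q k) = ennreal ((2 * (e / 2 ^ k)) * (2 * (e / 2 ^ k)))"
      unfolding square_around_def using e by (subst emeasure_complex_cbox) auto
    moreover have "?Q k \<in> sets lborel" by (simp add: square_around_def)
    ultimately have "(\<integral>\<^sup>+w. ?t k w \<partial>lborel) = ennreal (2 ^ (k + 1) / e) * ennreal ((2 * (e / 2 ^ k)) * (2 * (e / 2 ^ k)))"
      by (simp add: nn_integral_cmult_indicator)
    also have "\<dots> = ennreal (2 ^ (k + 1) / e * ((2 * (e / 2 ^ k)) * (2 * (e / 2 ^ k))))"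
      by (rule ennreal_mult[symmetric]) (use e in auto)
    also have "2 ^ (k + 1) / e * ((2 * (e / 2 ^ k)) * (2 * (e / 2 ^ k))) = 8 * e * (1/2) ^ k"
      using e by (simp add: field_simps power_divide)
    finally show ?thesis .
  qed
  have "(\<integral>\<^sup>+w. ennreal (1 / norm (w - z)) * indicator (square_around z e) w \<partial>lborel) \<le> (\<integral>\<^sup>+w. (\<Sum>k. ?t k w) \<partial>lborel)"
    by (intro nn_integral_mono pt)
  also have "\<dots> = (\<Sum>k. \<integral>\<^sup>+w. ?t k w \<partial>lborel)"
    by (intro nn_integral_suminf) (auto simp: square_around_def)
  also have "\<dots> = (\<Sum>k. ennreal (8 * e * (1/2) ^ k))" by (simp only: term_int)
  also have "\<dots> = ennreal (\<Sum>k. 8 * e * (1/2) ^ k)"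
    using e by (intro suminf_ennreal2) (auto intro!: summable_mult summable_geometric)
  also have "(\<Sum>k. 8 * e * (1/2) ^ k) = 16 * e"
    by (subst suminf_mult) (auto simp: suminf_geometric)
  finally show ?thesis .
qed

definition cauchy_transform :: "complex set \<Rightarrow> complex \<Rightarrow> complex" where
  "cauchy_transform E z = (LINT w:E|lborel. 1 / (w - z))"

context
  fixes E :: "complex set"
  assumes E: "compact E"
begin

lemma E_sets [measurable]: "E \<in> sets lborel"
  using E by (simp add: borel_compact)

lemma E_emeasure: "emeasure lborel E < \<infinity>"
  using emeasure_compact_finite[OF E] .

lemma E_integrable: "integrable lborel (indicator E :: complex \<Rightarrow> real)"
  by (rule integrable_real_indicator[OF E_sets]) (use E_emeasure in simp)

lemma integrable_bounded_on:
  fixes h :: "complex \<Rightarrow> complex"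
  assumes "h \<in> borel_measurable borel" "\<And>w. w \<in> E \<Longrightarrow> norm (h w) \<le> B"
  shows "set_integrable lborel E h" "norm (LINT w:E|lborel. h w) \<le> B * measure lborel E"
proof -
  have c: "set_integrable lborel E (\<lambda>_. B)"
    unfolding set_integrable_def using E_integrable by simp
  show h: "set_integrable lborel E h"
    unfolding set_integrable_def
  proof (rule Bochner_Integration.integrable_bound[OF c[unfolded set_integrable_def]])
    show "(\<lambda>x. indicator E x *\<^sub>R h x) \<in> borel_measurable lborel" using assms(1) by measurable
    show "AE x in lborel. norm (indicator E x *\<^sub>R h x) \<le> norm (indicator E x *\<^sub>R B)"
      using assms(2) by (intro AE_I2) (fastforce simp: indicator_def)
  qed
  have "norm (LINT w:E|lborel. h w) \<le> (LINT w|lborel. norm (indicator E w *\<^sub>R h w))"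
    unfolding set_lebesgue_integral_def by (rule integral_norm_bound)
  also have "\<dots> \<le> (LINT w|lborel. indicator E w *\<^sub>R B)"
    using h c assms(2) unfolding set_integrable_def
    by (intro integral_mono integrable_norm) (auto simp: indicator_def)
  also have "\<dots> = B * measure lborel E" by simp
  finally show "norm (LINT w:E|lborel. h w) \<le> B * measure lborel E" .
qed

lemma kernel_integrable: "set_integrable lborel E (\<lambda>w. 1 / (w - z))"
proof -
  obtain R where R: "\<And>w. w \<in> E \<Longrightarrow> norm w \<le> R" using compact_imp_bounded[OF E] unfolding bounded_iff by blast
  define e where "e = \<bar>R\<bar> + norm z + 1"
  have sub: "E \<subseteq> square_around z e"
  proof
    fix w assume "w \<in> E"
    then have "norm (w - z) \<le> e" using R[of w] norm_triangle_ineq4[of w z] by (simp add: e_def)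
    then show "w \<in> square_around z e"
      using abs_Re_le_cmod[of "w - z"] abs_Im_le_cmod[of "w - z"] by (simp add: mem_square_around)
  qed
  show ?thesis
    unfolding set_integrable_def
  proof (rule integrableI_bounded)
    show "(\<lambda>x. indicator E x *\<^sub>R (1 / (x - z))) \<in> borel_measurable lborel" by measurable
    have "(\<integral>\<^sup>+ x. ennreal (norm (indicat_real E x *\<^sub>R (1 / (x - z)))) \<partial>lborel)
        \<le> (\<integral>\<^sup>+w. ennreal (1 / norm (w - z)) * indicator (square_around z e) w \<partial>lborel)"
      using sub by (intro nn_integral_mono) (auto simp: indicator_def norm_divide)
    also have "\<dots> \<le> ennreal (16 * e)" by (rule kernel_bound_square) (simp add: e_def add_nonneg_pos)
    also have "\<dots> < \<infinity>" by simp
    finally show "(\<integral>\<^sup>+ x. ennreal (norm (indicat_real E x *\<^sub>R (1 / (x - z)))) \<partial>lborel) < \<infinity>" .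
  qed
qed

text \<open>The kernel is replaced by a bounded continuous one that differs from it only near the singularity;
by the bound on small squares this changes the transform uniformly little, so the transform is a
uniform limit of continuous functions.\<close>

lemma continuous_cauchy_transform: "continuous_on UNIV (cauchy_transform E)"
proof -
  \<comment> \<open>The truncated kernel equals 1/u for |u| at least 1/(n+1).\<close>
  define k where "k n u = cnj u / of_real (max ((norm u)\<^sup>2) ((1 / real (Suc n))\<^sup>2))" for n and u :: complex
  have maxpos: "0 < max ((norm u)\<^sup>2) ((1 / real (Suc n))\<^sup>2)" for n and u :: complex
    by (simp add: less_max_iff_disj)
  have kcont: "continuous_on UNIV (k n)" for n
    unfolding k_def using maxpos by (intro continuous_intros) (metis of_real_eq_0_iff less_irrefl)
  have kmeas: "(\<lambda>w. k n (w - z)) \<in> borel_measurable borel" for n z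
    by (intro borel_measurable_continuous_onI continuous_on_compose2[OF kcont[of n]] continuous_intros) auto
  have kbound: "norm (k n u) \<le> real (Suc n)" for n u
  proof -
    let ?d = "1 / real (Suc n)"
    have "norm u * ?d \<le> max ((norm u)\<^sup>2) (?d\<^sup>2)"
    proof (cases "norm u \<le> ?d")
      case True
      then have "norm u * ?d \<le> ?d * ?d" by (intro mult_right_mono) auto
      then show ?thesis by (simp add: power2_eq_square)
    next
      case False
      then have "norm u * ?d \<le> norm u * norm u" by (intro mult_left_mono) auto
      then show ?thesis by (simp add: power2_eq_square)
    qed
    then show ?thesis
      using maxpos[of u n] by (simp add: k_def norm_divide divide_le_eq mult.commute field_simps)
  qed
  have kdiff: "norm (1 / u - k n u) \<le> (if norm u \<le> 1 / real (Suc n) then 1 / norm u else 0)" for n u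
  proof (cases "norm u \<le> 1 / real (Suc n)")
    case True
    show ?thesis
    proof (cases "u = 0")
      case False
      have "(norm u)\<^sup>2 \<le> (1 / real (Suc n))\<^sup>2" using True by (intro power_mono) auto
      then have "k n u = cnj u / of_real ((1 / real (Suc n))\<^sup>2)" by (simp add: k_def max_def)
      moreover have "1 / u = cnj u / of_real ((norm u)\<^sup>2)"
        using False complex_norm_square[of u] by (simp add: field_simps)
      ultimately have "1 / u - k n u = cnj u * of_real (1 / (norm u)\<^sup>2 - 1 / (1 / real (Suc n))\<^sup>2)"
        by (simp add: algebra_simps)
      then have "norm (1 / u - k n u) = norm u * \<bar>1 / (norm u)\<^sup>2 - 1 / (1 / real (Suc n))\<^sup>2\<bar>"
        by (simp only: norm_mult norm_of_real complex_mod_cnj)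
      also have "\<dots> \<le> norm u * (1 / (norm u)\<^sup>2)"
      proof (rule mult_left_mono)
        have "1 / (1 / real (Suc n))\<^sup>2 \<le> 1 / (norm u)\<^sup>2"
          using \<open>(norm u)\<^sup>2 \<le> (1 / real (Suc n))\<^sup>2\<close> False by (intro divide_left_mono) auto
        moreover have "0 \<le> 1 / (1 / real (Suc n))\<^sup>2" by simp
        ultimately show "\<bar>1 / (norm u)\<^sup>2 - 1 / (1 / real (Suc n))\<^sup>2\<bar> \<le> 1 / (norm u)\<^sup>2"
          unfolding abs_le_iff by linarith
      qed simp
      also have "\<dots> = 1 / norm u" using False by (simp add: power2_eq_square)
      finally show ?thesis using True by simp
    qed (simp add: k_def)
  next
    case False
    then have "(1 / real (Suc n))\<^sup>2 \<le> (norm u)\<^sup>2" by (intro power_mono) auto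
    then have "k n u = cnj u / of_real ((norm u)\<^sup>2)" by (simp add: k_def max_absorb1)
    moreover have "u \<noteq> 0" using False by auto
    ultimately have "k n u = 1 / u" using complex_norm_square[of u] by (simp add: field_simps)
    then show ?thesis using False by simp
  qed
  define F where "F n z = (LINT w:E|lborel. k n (w - z))" for n z
  have kint: "set_integrable lborel E (\<lambda>w. k n (w - z))" for n z
    using integrable_bounded_on(1)[OF kmeas, of n z "real (Suc n)"] kbound by blast
  have close: "norm (cauchy_transform E z - F n z) \<le> 16 * (1 / real (Suc n))" for n z
  proof -
    let ?h = "\<lambda>w. indicator E w *\<^sub>R (1 / (w - z) - k n (w - z))"
    have eq: "cauchy_transform E z - F n z = (LINT w|lborel. ?h w)"
      unfolding cauchy_transform_def F_def
      by (subst set_integral_diff(2)[OF kernel_integrable kint, symmetric]) (simp add: set_lebesgue_integral_def)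
    have hint: "integrable lborel ?h"
      using set_integral_diff(1)[OF kernel_integrable kint] by (simp add: set_integrable_def)
    have "ennreal (norm (LINT w|lborel. ?h w)) \<le> (\<integral>\<^sup>+ w. norm (?h w) \<partial>lborel)"
      by (rule integral_norm_bound_ennreal[OF hint])
    also have "\<dots> \<le> (\<integral>\<^sup>+w. ennreal (1 / norm (w - z)) * indicator (square_around z (1 / real (Suc n))) w \<partial>lborel)"
    proof (rule nn_integral_mono)
      fix w
      have "norm (?h w) \<le> norm (1 / (w - z) - k n (w - z))" by (simp add: indicator_def)
      also note kdiff[of "w - z" n]
      finally have *: "norm (?h w) \<le> (if norm (w - z) \<le> 1 / real (Suc n) then 1 / norm (w - z) else 0)" .
      show "ennreal (norm (?h w)) \<le> ennreal (1 / norm (w - z)) * indicator (square_around z (1 / real (Suc n))) w"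
      proof (cases "norm (w - z) \<le> 1 / real (Suc n)")
        case True
        then have "w \<in> square_around z (1 / real (Suc n))"
          using abs_Re_le_cmod[of "w - z"] abs_Im_le_cmod[of "w - z"] by (auto simp: mem_square_around)
        then show ?thesis using * True by (simp add: ennreal_leI)
      next
        case False
        then have "norm (?h w) = 0" using * norm_ge_zero[of "?h w"] by (simp only: if_False)
        then show ?thesis by (simp only: ennreal_0 zero_le)
      qed
    qed
    also have "\<dots> \<le> ennreal (16 * (1 / real (Suc n)))" by (rule kernel_bound_square) simp
    finally show ?thesis unfolding eq by (subst (asm) ennreal_le_iff) auto
  qed
  have Fcont: "continuous_on UNIV (F n)" for n
    unfolding continuous_on_sequentially o_def F_def set_lebesgue_integral_def
  proof (intro allI ballI impI)
    fix x :: "nat \<Rightarrow> complex" and z assume "(\<forall>m. x m \<in> UNIV) \<and> x \<longlonglongrightarrow> z"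
    then have x: "x \<longlonglongrightarrow> z" by simp
    show "(\<lambda>m. LINT w|lborel. indicator E w *\<^sub>R k n (w - x m)) \<longlonglongrightarrow> (LINT w|lborel. indicator E w *\<^sub>R k n (w - z))"
    proof (rule integral_dominated_convergence[where w = "\<lambda>w. indicator E w *\<^sub>R real (Suc n)"])
      show "integrable lborel (\<lambda>w. indicator E w *\<^sub>R real (Suc n))"
        using E_integrable by simp
      show "AE w in lborel. (\<lambda>m. indicator E w *\<^sub>R k n (w - x m)) \<longlonglongrightarrow> indicator E w *\<^sub>R k n (w - z)"
      proof (rule AE_I2)
        fix w
        have "(\<lambda>m. k n (w - x m)) \<longlonglongrightarrow> k n (w - z)"
          using kcont[of n] x by (intro isCont_tendsto_compose[of _ "k n"] tendsto_intros)
            (auto simp: continuous_on_eq_continuous_at)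
        then show "(\<lambda>m. indicator E w *\<^sub>R k n (w - x m)) \<longlonglongrightarrow> indicator E w *\<^sub>R k n (w - z)"
          by (intro tendsto_intros)
      qed
      show "AE w in lborel. norm (indicator E w *\<^sub>R k n (w - x m)) \<le> indicator E w *\<^sub>R real (Suc n)" for m
        using kbound by (intro AE_I2) (simp add: indicator_def)
      show "(\<lambda>w. indicator E w *\<^sub>R k n (w - z)) \<in> borel_measurable lborel"
        using kmeas[of n z] by measurable
      show "(\<lambda>w. indicator E w *\<^sub>R k n (w - x m)) \<in> borel_measurable lborel" for m
        using kmeas[of n "x m"] by measurable
    qed
  qed
  have "uniform_limit UNIV F (cauchy_transform E) sequentially"
    unfolding uniform_limit_iff
  proof (intro allI impI)
    fix e :: real assume "0 < e"
    have "(\<lambda>n. 16 * (1 / real (Suc n))) \<longlonglongrightarrow> 16 * 0"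
      by (intro tendsto_intros LIMSEQ_inverse_real_of_nat[unfolded inverse_eq_divide])
    then have "\<forall>\<^sub>F n in sequentially. 16 * (1 / real (Suc n)) < e"
      using order_tendstoD(2)[of _ "16 * 0" sequentially e] \<open>0 < e\<close> by simp
    then show "\<forall>\<^sub>F n in sequentially. \<forall>x\<in>UNIV. dist (F n x) (cauchy_transform E x) < e"
      by (rule eventually_mono) (metis close dist_commute dist_norm order_le_less_trans)
  qed
  then show ?thesis
    by (rule uniform_limit_theorem[rotated]) (auto simp: Fcont)
qed

lemma holomorphic_cauchy_transform: "cauchy_transform E holomorphic_on - E"
proof (rule holomorphic_onI)
  fix z0 assume "z0 \<in> - E"
  then obtain r where r: "r > 0" "ball z0 (2 * r) \<subseteq> - E"
  proof -
    obtain d where "d > 0" "ball z0 d \<subseteq> - E"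
      using \<open>z0 \<in> - E\<close> compact_imp_closed[OF E] open_Compl open_contains_ball by metis
    then show ?thesis using that[of "d/2"] by simp
  qed
  have far: "r \<le> norm (w - z)" if "w \<in> E" "z \<in> ball z0 r" for w z
  proof -
    have "w \<notin> ball z0 (2 * r)" using r that by blast
    then have "2 * r \<le> dist z0 w" by simp
    then show ?thesis using that dist_triangle[of z0 w z] by (simp add: dist_norm norm_minus_commute)
  qed
  have z0r: "z0 \<in> ball z0 r" using r by simp
  define D where "D = (LINT w:E|lborel. 1 / (w - z0)\<^sup>2)"
  have intD: "set_integrable lborel E (\<lambda>w. 1 / (w - z0)\<^sup>2)"
  proof (rule integrable_bounded_on)
    show "norm (1 / (w - z0)\<^sup>2) \<le> 1 / r\<^sup>2" if "w \<in> E" for w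
      using far[OF that, of z0] r by (auto simp: norm_divide norm_power intro!: divide_left_mono power_mono mult_pos_pos)
  qed measurable
  have est: "norm ((cauchy_transform E z - cauchy_transform E z0) / (z - z0) - D)
      \<le> norm (z - z0) * (1 / r ^ 3 * measure lborel E)" if z: "z \<in> ball z0 r" "z \<noteq> z0" for z
  proof -
    let ?h = "\<lambda>w. 1 / ((w - z) * (w - z0)\<^sup>2)"
    have hb: "norm (?h w) \<le> 1 / r ^ 3" if w: "w \<in> E" for w
    proof -
      have "r * r ^ 2 \<le> norm (w - z) * norm (w - z0) ^ 2"
        using far[OF w z(1)] far[OF w, of z0] r by (intro mult_mono power_mono) auto
      then have "r ^ 3 \<le> norm ((w - z) * (w - z0)\<^sup>2)"
        by (simp add: norm_mult norm_power power3_eq_cube power2_eq_square)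
      then show ?thesis
        unfolding norm_divide using r by (intro frac_le) auto
    qed
    have hm: "?h \<in> borel_measurable borel" by measurable
    note h = integrable_bounded_on[OF hm hb]
    have "(LINT w:E|lborel. 1 / (w - z) - 1 / (w - z0) - (z - z0) * (1 / (w - z0)\<^sup>2))
        = cauchy_transform E z - cauchy_transform E z0 - (z - z0) * D"
      unfolding cauchy_transform_def D_def
      using set_integral_diff(2)[OF set_integral_diff(1)[OF kernel_integrable[of z] kernel_integrable[of z0]]
          set_integrable_mult_right[of "z - z0", OF intD]]
        set_integral_diff(2)[OF kernel_integrable[of z] kernel_integrable[of z0]]
      by (simp only: set_integral_mult_right)
    moreover have "(LINT w:E|lborel. 1 / (w - z) - 1 / (w - z0) - (z - z0) * (1 / (w - z0)\<^sup>2))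
        = (LINT w:E|lborel. (z - z0)\<^sup>2 * ?h w)"
    proof (rule set_lebesgue_integral_cong)
      show "\<forall>w. w \<in> E \<longrightarrow> 1 / (w - z) - 1 / (w - z0) - (z - z0) * (1 / (w - z0)\<^sup>2) = (z - z0)\<^sup>2 * ?h w"
      proof (intro allI impI)
        fix w assume "w \<in> E"
        then have "0 < norm (w - z)" "0 < norm (w - z0)"
          using far[OF \<open>w \<in> E\<close> z(1)] far[OF \<open>w \<in> E\<close> z0r] r by linarith+
        then have "w - z \<noteq> 0" "w - z0 \<noteq> 0" by simp_all
        moreover have "1 / a - 1 / b - (b - a) * (1 / b\<^sup>2) = (b - a)\<^sup>2 * (1 / (a * b\<^sup>2))"
          if "a \<noteq> 0" "b \<noteq> 0" for a b :: complex
          using that by (simp add: field_simps power2_eq_square)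
        moreover have "z - z0 = (w - z0) - (w - z)" by simp
        ultimately show "1 / (w - z) - 1 / (w - z0) - (z - z0) * (1 / (w - z0)\<^sup>2) = (z - z0)\<^sup>2 * ?h w"
          by metis
      qed
    qed (rule E_sets)
    ultimately have "cauchy_transform E z - cauchy_transform E z0 - (z - z0) * D = (z - z0)\<^sup>2 * (LINT w:E|lborel. ?h w)"
      by (simp only: set_integral_mult_right)
    then have "(cauchy_transform E z - cauchy_transform E z0) / (z - z0) - D = (z - z0) * (LINT w:E|lborel. ?h w)"
      using z by (simp add: field_simps power2_eq_square)
    then show ?thesis
      using mult_left_mono[OF h(2), of "norm (z - z0)"] by (simp only: norm_mult norm_ge_zero)
  qed
  have "((\<lambda>z. (cauchy_transform E z - cauchy_transform E z0) / (z - z0)) \<longlongrightarrow> D) (at z0)"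
  proof (rule LIM_zero_cancel)
    show "((\<lambda>z. (cauchy_transform E z - cauchy_transform E z0) / (z - z0) - D) \<longlongrightarrow> 0) (at z0)"
    proof (rule Lim_null_comparison)
      show "\<forall>\<^sub>F z in at z0. norm ((cauchy_transform E z - cauchy_transform E z0) / (z - z0) - D)
          \<le> norm (z - z0) * (1 / r ^ 3 * measure lborel E)"
        using est r unfolding eventually_at by (intro exI[of _ r]) (auto simp: dist_commute)
      have "((\<lambda>z. norm (z - z0) * (1 / r ^ 3 * measure lborel E)) \<longlongrightarrow> norm (z0 - z0) * (1 / r ^ 3 * measure lborel E)) (at z0)"
        by (intro tendsto_intros)
      then show "((\<lambda>z. norm (z - z0) * (1 / r ^ 3 * measure lborel E)) \<longlongrightarrow> 0) (at z0)" by simp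
    qed
  qed
  then have "(cauchy_transform E has_field_derivative D) (at z0)" by (simp add: has_field_derivative_iff)
  then show "cauchy_transform E field_differentiable at z0 within - E"
    using field_differentiable_at_within field_differentiable_def by blast
qed

lemma cauchy_transform_decay:
  assumes "\<And>w. w \<in> E \<Longrightarrow> norm w \<le> R" "2 * R \<le> norm z" "z \<noteq> 0"
  shows "norm (cauchy_transform E z) \<le> 2 / norm z * measure lborel E"
  unfolding cauchy_transform_def
proof (rule integrable_bounded_on(2))
  fix w assume "w \<in> E"
  then have "norm z \<le> 2 * norm (w - z)" using assms norm_triangle_ineq3[of z w] by (smt (verit) norm_minus_commute)
  moreover from this have "0 < norm (w - z)" using assms(3) by (smt (verit) zero_less_norm_iff)
  ultimately show "norm (1 / (w - z)) \<le> 2 / norm z" using assms(3) by (simp add: norm_divide field_simps)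
qed measurable

end

section \<open>A totally disconnected set with nontrivial hull\<close>

text \<open>Remove from the unit square a strip around each line Re w = q or Im w = q with q rational. What remains
has no two points with different coordinates in one connected subset, and the strips have total
area at most 1/2.\<close>

lemma fat_totally_disconnected_set:
  obtains E :: "complex set" where "compact E" "totally_disconnected E" "0 < measure lborel E"
    "\<And>w. w \<in> E \<Longrightarrow> 0 \<le> Re w \<and> Re w \<le> 1 \<and> 0 \<le> Im w \<and> Im w \<le> 1"
proof -
  define q where "q = (from_nat_into \<rat> :: nat \<Rightarrow> real)"
  have q: "\<exists>n. x = q n" if "x \<in> \<rat>" for x
    using from_nat_into_surj[OF countable_rat that] by (auto simp: q_def)
  define e where "e n = ((1/2) ^ n / 16 :: real)" for n :: nat
  have e: "0 < e n" for n by (simp add: e_def)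
  define S where "S = cbox (Complex 0 0) (Complex 1 1)"
  define A where "A n = cbox (Complex (q n - e n) 0) (Complex (q n + e n) 1)" for n
  define B where "B n = cbox (Complex 0 (q n - e n)) (Complex 1 (q n + e n))" for n
  define E where "E = S \<inter> (\<Inter>n. {w. e n \<le> \<bar>Re w - q n\<bar> \<and> e n \<le> \<bar>Im w - q n\<bar>})"
  have cl: "closed {w. e n \<le> \<bar>Re w - q n\<bar> \<and> e n \<le> \<bar>Im w - q n\<bar>}" for n
    by (intro closed_Collect_conj closed_Collect_le continuous_intros)
  have comp: "compact E"
    unfolding E_def S_def by (intro compact_Int_closed compact_cbox closed_INT ballI cl)
  have memS: "w \<in> S \<longleftrightarrow> 0 \<le> Re w \<and> Re w \<le> 1 \<and> 0 \<le> Im w \<and> Im w \<le> 1" for w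
    by (auto simp: S_def in_cbox_complex_iff)
  have avoid: "x = y" if T: "connected T" and f: "continuous_on T f" and xy: "x \<in> f ` T" "y \<in> f ` T"
    and sep: "\<And>w n. w \<in> T \<Longrightarrow> e n \<le> \<bar>f w - q n\<bar>" for T and f :: "complex \<Rightarrow> real" and x y
  proof (rule ccontr)
    assume "x \<noteq> y"
    then have "min x y < max x y" by auto
    then obtain z where z: "z \<in> \<rat>" "min x y < z" "z < max x y" using Rats_dense_in_real by blast
    obtain n where n: "z = q n" using q z by blast
    have "connected (f ` T)" using T f by (rule connected_continuous_image[rotated])
    then have "{min x y..max x y} \<subseteq> f ` T"
      using xy by (intro connected_contains_Icc) (auto simp: min_def max_def)
    then have "z \<in> f ` T" using z by auto
    then obtain w where "w \<in> T" "f w = q n" using n by auto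
    then show False using sep[of w n] e[of n] by simp
  qed
  have disc: "totally_disconnected E"
    unfolding totally_disconnected_def
  proof (intro allI impI ballI)
    fix T x y assume T: "T \<subseteq> E" "connected T" "x \<in> T" "y \<in> T"
    have "Re x = Re y" by (rule avoid[OF T(2), of Re]) (use T in \<open>auto simp: E_def intro!: continuous_intros\<close>)
    moreover have "Im x = Im y" by (rule avoid[OF T(2), of Im]) (use T in \<open>auto simp: E_def intro!: continuous_intros\<close>)
    ultimately show "x = y" by (simp add: complex_eq_iff)
  qed
  have sub: "S \<subseteq> E \<union> (\<Union>n. A n \<union> B n)"
  proof
    fix w assume w: "w \<in> S"
    show "w \<in> E \<union> (\<Union>n. A n \<union> B n)"
    proof (cases "w \<in> E")
      case False
      then obtain n where "\<not> (e n \<le> \<bar>Re w - q n\<bar> \<and> e n \<le> \<bar>Im w - q n\<bar>)"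
        using w unfolding E_def by blast
      then have "\<bar>Re w - q n\<bar> < e n \<or> \<bar>Im w - q n\<bar> < e n" by linarith
      then have "w \<in> A n \<union> B n" using w by (auto simp: A_def B_def memS in_cbox_complex_iff abs_less_iff)
      then show ?thesis by blast
    qed simp
  qed
  have "ennreal 1 = emeasure lborel S" unfolding S_def by (subst emeasure_complex_cbox) auto
  also have "\<dots> \<le> emeasure lborel (E \<union> (\<Union>n. A n \<union> B n))"
    using comp by (intro emeasure_mono sub) (auto simp: A_def B_def borel_compact)
  also have "\<dots> \<le> emeasure lborel E + emeasure lborel (\<Union>n. A n \<union> B n)"
    using comp by (intro emeasure_subadditive) (auto simp: A_def B_def borel_compact)
  also have "emeasure lborel (\<Union>n. A n \<union> B n) \<le> (\<Sum>n. emeasure lborel (A n \<union> B n))"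
    by (intro emeasure_subadditive_countably) (auto simp: A_def B_def)
  also have "(\<Sum>n. emeasure lborel (A n \<union> B n)) \<le> (\<Sum>n. ennreal (4 * e n))"
  proof (intro suminf_le)
    fix n
    have "emeasure lborel (A n \<union> B n) \<le> emeasure lborel (A n) + emeasure lborel (B n)"
      by (intro emeasure_subadditive) (auto simp: A_def B_def)
    also have "\<dots> = ennreal (2 * e n) + ennreal (2 * e n)"
      unfolding A_def B_def using e[of n] by (subst (1 2) emeasure_complex_cbox) auto
    also have "\<dots> = ennreal (4 * e n)" using e[of n] by (subst ennreal_plus[symmetric]) auto
    finally show "emeasure lborel (A n \<union> B n) \<le> ennreal (4 * e n)" .
  qed auto
  also have "(\<Sum>n. ennreal (4 * e n)) = ennreal (\<Sum>n. 4 * e n)"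
    by (intro suminf_ennreal2) (auto simp: e_def intro!: summable_mult summable_divide summable_geometric)
  also have "(\<Sum>n. 4 * e n) = 1/2"
  proof -
    have "(\<lambda>n. 4 * e n) = (\<lambda>n. (1/4) * (1/2) ^ n)" by (simp add: e_def fun_eq_iff)
    moreover have "(\<Sum>n. (1/4) * (1/2) ^ n) = (1/4) * (\<Sum>n. (1/2) ^ n :: real)"
      by (rule suminf_mult) (simp add: summable_geometric)
    ultimately show ?thesis by (simp only: suminf_geometric) (simp add: suminf_geometric)
  qed
  finally have le: "ennreal 1 \<le> emeasure lborel E + ennreal (1/2)" by (simp add: add_left_mono)
  have "0 < measure lborel E"
  proof (rule ccontr)
    assume "\<not> 0 < measure lborel E"
    then have "measure lborel E = 0" using measure_nonneg[of lborel E] by linarith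
    then have "emeasure lborel E = 0"
      using emeasure_compact_finite[OF comp] by (simp add: emeasure_eq_ennreal_measure less_top)
    then have "ennreal 1 \<le> ennreal (1/2)" using le by simp
    then show False by (subst (asm) ennreal_le_iff) auto
  qed
  then show ?thesis using that[OF comp disc] memS by (auto simp: E_def)
qed

text \<open>The decay at infinity lets the whole complement of E be treated like a bounded domain.\<close>

lemma maximum_principle_decay:
  assumes E: "compact E" and cont: "continuous_on UNIV h" and hol: "h holomorphic_on - E"
    and lim: "(h \<longlongrightarrow> 0) at_infinity" and B: "\<And>z. z \<in> E \<Longrightarrow> norm (h z) \<le> B" "0 \<le> B"
  shows "norm (h z) \<le> B"
proof (rule field_le_epsilon)
  fix e :: real assume "0 < e"
  have "\<forall>\<^sub>F z in at_infinity. norm (h z) < e" using tendstoD[OF lim \<open>0 < e\<close>] by simp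
  then obtain r where r: "\<And>z. r \<le> norm z \<Longrightarrow> norm (h z) < e" unfolding eventually_at_infinity by blast
  show "norm (h z) \<le> B + e"
  proof (cases "z \<in> E \<or> r \<le> norm z")
    case True
    then show ?thesis using B(1)[of z] r[of z] \<open>0 < e\<close> B(2) by (auto intro: order_less_imp_le add_increasing add_increasing2)
  next
    case False
    let ?S = "ball 0 r - E"
    have op: "open ?S" using compact_imp_closed[OF E] by (intro open_Diff) auto
    show ?thesis
    proof (rule maximum_modulus_frontier[of h ?S])
      show "h holomorphic_on interior ?S" using hol op
        by (metis Diff_subset_conv Un_upper2 holomorphic_on_subset interior_open Compl_eq_Diff_UNIV Diff_mono subset_UNIV order_refl)
      show "continuous_on (closure ?S) h" using cont continuous_on_subset by blast
      show "bounded ?S" by (rule bounded_subset[OF bounded_ball]) auto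
      show "z \<in> ?S" using False by auto
      fix w assume "w \<in> frontier ?S"
      then have "w \<notin> ?S" using op by (auto simp: frontier_def interior_open)
      then consider "w \<in> E" | "r \<le> norm w" by force
      then show "norm (h w) \<le> B + e"
      proof cases
        case 1 then show ?thesis using B(1)[of w] \<open>0 < e\<close> by simp
      next
        case 2 then show ?thesis using r[of w] B(2) by simp
      qed
    qed
  qed
qed

definition embed2 :: "complex \<Rightarrow> complex \<Rightarrow> complex ^ 3" where
  "embed2 a b = (\<chi> i. if i = 1 then a else if i = 2 then b else 0)"

lemma embed2_nth [simp]: "embed2 a b $ 1 = a" "embed2 a b $ 2 = b" "embed2 a b $ 3 = 0"
  by (simp_all add: embed2_def)

lemma embed2_eq_iff: "embed2 a b = embed2 c d \<longleftrightarrow> a = c \<and> b = d"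
  by (metis embed2_nth)

lemma continuous_on_embed2:
  assumes "continuous_on S f" "continuous_on S g"
  shows "continuous_on S (\<lambda>x. embed2 (f x) (g x))"
  unfolding embed2_def
proof (rule continuous_on_vec_lambda)
  fix i :: 3
  show "continuous_on S (\<lambda>x. if i = 1 then f x else if i = 2 then g x else 0)"
    using assms by (cases "i = 1"; cases "i = 2") simp_all
qed

text \<open>The hull inequality at the image of -1 comes from the maximum principle for P^n f, where the factor f
supplies the decay at infinity and its influence disappears on taking n-th roots.\<close>

theorem totally_disconnected_with_hull:
  obtains K :: "(complex ^ 3) set" and y where "compact K" "totally_disconnected K" "\<And>v. v \<in> K \<Longrightarrow> v $ 3 = 0"
    "in_hull K y" "y \<notin> K" "y $ 3 = 0"
proof -
  obtain E where E: "compact E" "totally_disconnected E" "0 < measure lborel E"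
    "\<And>w. w \<in> E \<Longrightarrow> 0 \<le> Re w \<and> Re w \<le> 1 \<and> 0 \<le> Im w \<and> Im w \<le> 1"
    using fat_totally_disconnected_set by blast
  define f where "f = cauchy_transform E"
  have fcont: "continuous_on UNIV f" unfolding f_def by (rule continuous_cauchy_transform[OF E(1)])
  have fhol: "f holomorphic_on - E" unfolding f_def by (rule holomorphic_cauchy_transform[OF E(1)])
  have E2: "norm w \<le> 2" if "w \<in> E" for w
    using cmod_le[of w] E(4)[OF that] by linarith
  have decay: "norm (f z) \<le> 2 * measure lborel E / norm z" if "4 \<le> norm z" for z
  proof -
    have "z \<noteq> 0" using that by auto
    then show ?thesis using cauchy_transform_decay[OF E(1) E2, of z] that by (simp add: f_def)
  qed
  have fnz: "f (-1) \<noteq> 0"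
  proof -
    have int: "integrable lborel (\<lambda>w. indicator E w *\<^sub>R (1 / (w - (-1))))"
      using kernel_integrable[OF E(1), of "-1"] by (simp add: set_integrable_def)
    have "1/9 * measure lborel E = (LINT w|lborel. indicator E w *\<^sub>R (1/9::real))" by simp
    also have "\<dots> \<le> (LINT w|lborel. Re (indicator E w *\<^sub>R (1 / (w - (-1)))))"
    proof (rule integral_mono)
      show "integrable lborel (\<lambda>w. indicator E w *\<^sub>R (1/9::real))" using E_integrable[OF E(1)] by simp
      show "integrable lborel (\<lambda>w. Re (indicator E w *\<^sub>R (1 / (w - (-1)))))" by (rule integrable_Re[OF int])
      show "indicator E w *\<^sub>R (1/9::real) \<le> Re (indicator E w *\<^sub>R (1 / (w - (-1))))" for w
      proof (cases "w \<in> E")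
        case True
        have n: "norm (w + 1) \<le> 3" using E2[OF True] norm_triangle_ineq[of w 1] by simp
        have "1 \<le> Re (w + 1)" using E(4)[OF True] by simp
        then have "w + 1 \<noteq> 0" by (metis not_one_le_zero zero_complex.sel(1))
        then have "0 < (norm (w + 1))\<^sup>2" by simp
        moreover have "(norm (w + 1))\<^sup>2 \<le> 3\<^sup>2" using n by (intro power_mono) auto
        ultimately have "1/9 \<le> Re (w + 1) / (norm (w + 1))\<^sup>2"
          using \<open>1 \<le> Re (w + 1)\<close> by (intro frac_le) auto
        also have "\<dots> = Re (1 / (w + 1))" by (simp add: Re_divide cmod_power2)
        finally show ?thesis using True by simp
      qed simp
    qed
    also have "\<dots> = Re (f (-1))"
      unfolding f_def cauchy_transform_def set_lebesgue_integral_def by (rule integral_Re[OF int])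
    finally show ?thesis using E(3) by auto
  qed
  have flim: "(f \<longlongrightarrow> 0) at_infinity"
  proof (rule Lim_null_comparison)
    show "\<forall>\<^sub>F z in at_infinity. norm (f z) \<le> 2 * measure lborel E / norm z"
      unfolding eventually_at_infinity using decay by blast
    show "((\<lambda>z::complex. 2 * measure lborel E / norm z) \<longlongrightarrow> 0) at_infinity"
      by (intro tendsto_divide_0[OF tendsto_const] filterlim_at_top_imp_at_infinity filterlim_norm_at_top)
  qed
  have bounded_range: "bounded (range g)" if "continuous_on UNIV g" "\<And>z. 4 \<le> norm z \<Longrightarrow> norm (g z) \<le> M"
    for g :: "complex \<Rightarrow> complex" and M
  proof -
    have "compact (g ` cball 0 4)"
      using that(1) by (intro compact_continuous_image) (auto intro: continuous_on_subset)
    then have "bounded (g ` cball 0 4)" by (rule compact_imp_bounded)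
    then obtain M' where "\<forall>x\<in>g ` cball 0 4. norm x \<le> M'" unfolding bounded_iff by blast
    then have M': "norm (g z) \<le> M'" if "norm z \<le> 4" for z using that by simp
    have "norm (g z) \<le> max M M'" for z using that(2)[of z] M'[of z] by (cases "4 \<le> norm z") auto
    then show ?thesis unfolding bounded_iff by blast
  qed
  have fb: "bounded (range f)"
  proof (rule bounded_range[OF fcont])
    fix z :: complex assume z: "4 \<le> norm z"
    then have "2 * measure lborel E / norm z \<le> 2 * measure lborel E / 4" by (intro divide_left_mono) auto
    then show "norm (f z) \<le> 2 * measure lborel E / 4" using decay[OF z] by linarith
  qed
  have zfb: "bounded (range (\<lambda>z. z * f z))"
  proof (rule bounded_range)
    show "continuous_on UNIV (\<lambda>z. z * f z)" by (intro continuous_intros fcont)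
    fix z :: complex assume z: "4 \<le> norm z"
    then have "0 < norm z" by linarith
    then show "norm (z * f z) \<le> 2 * measure lborel E" using decay[OF z] by (simp add: norm_mult field_simps)
  qed
  define F where "F z = embed2 (f z) (z * f z)" for z
  have Fcont: "continuous_on UNIV F"
    unfolding F_def by (intro continuous_on_embed2 continuous_intros fcont)
  have PF: "(\<lambda>z. P (F z)) holomorphic_on - E \<and> continuous_on UNIV (\<lambda>z. P (F z)) \<and> bounded (range (\<lambda>z. P (F z)))"
    if "complex_polynomial P" for P
    using that
  proof (induction P rule: complex_polynomial_induct)
    case (const c)
    then show ?case by (auto simp: bounded_iff)
  next
    case (coord i)
    consider "i = 1" | "i = 2" | "i = 3" using exhaust_3 by blast
    then show ?case
    proof cases
      case 1 then show ?thesis using fcont fhol fb by (simp add: F_def)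
    next
      case 2 then show ?thesis using fcont fhol zfb by (auto simp: F_def intro!: holomorphic_intros continuous_intros)
    next
      case 3 then show ?thesis by (auto simp: F_def bounded_iff)
    qed
  next
    case (add p q)
    then have "bounded (range (\<lambda>z. p (F z) + q (F z)))"
      by (intro bounded_plus_comp) auto
    then show ?case using add by (auto intro!: holomorphic_intros continuous_intros)
  next
    case (mult p q)
    then obtain a b where ab: "\<And>z. norm (p (F z)) \<le> a" "\<And>z. norm (q (F z)) \<le> b"
      unfolding bounded_iff by blast
    have "norm (p (F z) * q (F z)) \<le> a * b" for z
      unfolding norm_mult using ab[of z] by (intro mult_mono) (auto intro: order_trans[OF norm_ge_zero])
    then have "bounded (range (\<lambda>z. p (F z) * q (F z)))" unfolding bounded_iff by blast
    then show ?case using mult by (auto intro!: holomorphic_intros continuous_intros)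
  qed
  have Finj: "a = b" if "F a = F b" "f a \<noteq> 0" for a b
    using that by (auto simp: F_def embed2_eq_iff)
  show ?thesis
  proof (rule that[of "F ` E" "F (-1)"])
    show "compact (F ` E)" using Fcont E(1) by (intro compact_continuous_image) (auto intro: continuous_on_subset)
    show "F (-1) \<notin> F ` E"
    proof
      assume "F (-1) \<in> F ` E"
      then obtain w where "w \<in> E" "F (-1) = F w" by auto
      then have "-1 \<in> E" using Finj[of "-1" w] fnz by auto
      then show False using E(4)[of "-1"] by simp
    qed
    show "v $ 3 = 0" if "v \<in> F ` E" for v using that by (auto simp: F_def)
    show "F (-1) $ 3 = 0" by (simp add: F_def)
    show "totally_disconnected (F ` E)"
      unfolding totally_disconnected_def
    proof (intro allI impI ballI, rule ccontr)
      fix T x y assume T: "T \<subseteq> F ` E" "connected T" "x \<in> T" "y \<in> T" "x \<noteq> y"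
      have *: False if ab: "a \<in> E" "b \<in> E" "F a \<in> T" "F b \<in> T" "F a \<noteq> F b" "f a \<noteq> 0" for a b
      proof -
        \<comment> \<open>A clopen neighbourhood of a that avoids b and the zeros of f has an image disjoint from that of its complement.\<close>
        have "open (- {z. f z = 0})" by (intro open_Compl closed_Collect_eq fcont continuous_on_const)
        then have "open (- {z. f z = 0} - {b})" by (intro open_Diff) auto
        moreover have "a \<in> - {z. f z = 0} - {b}" using ab by auto
        ultimately obtain A where A: "clopen_in E A" "a \<in> A" "A \<subseteq> - {z. f z = 0} - {b}"
          using clopen_separation[OF E(1,2) ab(1)] by metis
        have "compact A" using A(1) E(1) closedin_compact unfolding clopen_in_def by blast
        moreover have "compact (E - A)"
          using A(1) E(1) closedin_compact[of E "E - A"] clopen_in_Diff[OF clopen_in_whole A(1)]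
          unfolding clopen_in_def by blast
        ultimately have "closed (F ` A)" "closed (F ` (E - A))"
          using Fcont by (auto intro!: compact_imp_closed compact_continuous_image intro: continuous_on_subset)
        moreover have "T \<subseteq> F ` A \<union> F ` (E - A)" using T(1) clopen_in_subset[OF A(1)] by blast
        moreover have "F ` A \<inter> F ` (E - A) \<inter> T = {}"
        proof -
          have False if "u \<in> A" "w \<in> E - A" "F u = F w" for u w
          proof -
            have "f u \<noteq> 0" using that A by blast
            then have "u = w" using Finj that by blast
            then show False using that by blast
          qed
          then show ?thesis by blast
        qed
        moreover have "F a \<in> F ` A \<inter> T" "F b \<in> F ` (E - A) \<inter> T" using ab A by auto
        ultimately show False using T(2) unfolding connected_closed by blast
      qed
      obtain a b where ab: "a \<in> E" "b \<in> E" "x = F a" "y = F b" using T by blast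
      have "f a \<noteq> 0 \<or> f b \<noteq> 0" using T(5) ab by (auto simp: F_def)
      then show False using *[of a b] *[of b a] ab T by metis
    qed
    show "in_hull (F ` E) (F (-1))"
      unfolding in_hull_def
    proof (intro allI impI)
      fix P B assume P: "complex_polynomial P" and "\<forall>x\<in>F ` E. norm (P x) \<le> B"
      then have B: "norm (P (F z)) \<le> B" if "z \<in> E" for z using that by blast
      have "E \<noteq> {}" using E(3) by auto
      then have B0: "0 \<le> B" using B norm_ge_zero order_trans by blast
      obtain M where M: "\<And>z. norm (f z) \<le> M" using fb unfolding bounded_iff by blast
      have M0: "0 \<le> M" using M[of 0] norm_ge_zero order_trans by blast
      have pow: "norm (P (F (-1))) ^ n * norm (f (-1)) \<le> B ^ n * M" for n
      proof -
        have "norm (P (F (-1)) ^ n * f (-1)) \<le> B ^ n * M"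
        proof (rule maximum_principle_decay[OF E(1), of "\<lambda>z. P (F z) ^ n * f z" "B ^ n * M" "-1"])
          show "continuous_on UNIV (\<lambda>z. P (F z) ^ n * f z)"
            using PF[OF P] fcont by (intro continuous_intros) auto
          show "(\<lambda>z. P (F z) ^ n * f z) holomorphic_on - E"
            using PF[OF P] fhol by (intro holomorphic_intros) auto
          show "norm (P (F z) ^ n * f z) \<le> B ^ n * M" if "z \<in> E" for z
            unfolding norm_mult norm_power using B[OF that] M[of z] B0 by (intro mult_mono power_mono) auto
          show "0 \<le> B ^ n * M" using B0 M0 by simp
          obtain b where b: "\<And>z. norm (P (F z)) \<le> b" using PF[OF P] unfolding bounded_iff by blast
          show "((\<lambda>z. P (F z) ^ n * f z) \<longlongrightarrow> 0) at_infinity"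
          proof (rule Lim_null_comparison)
            show "\<forall>\<^sub>F z in at_infinity. norm (P (F z) ^ n * f z) \<le> b ^ n * norm (f z)"
              by (intro always_eventually allI)
                (auto simp: norm_mult norm_power intro!: mult_right_mono power_mono b)
            show "((\<lambda>z. b ^ n * norm (f z)) \<longlongrightarrow> 0) at_infinity"
              using tendsto_mult[OF tendsto_const[of "b ^ n"] tendsto_norm[OF flim]] by simp
          qed
        qed
        then show ?thesis by (simp add: norm_mult norm_power)
      qed
      show "norm (P (F (-1))) \<le> B"
      proof (rule ccontr)
        assume "\<not> norm (P (F (-1))) \<le> B"
        then have q: "B < norm (P (F (-1)))" by simp
        then have q0: "0 < norm (P (F (-1)))" using B0 by linarith
        have "B / norm (P (F (-1))) < 1" using q q0 by (simp add: field_simps)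
        then have "(\<lambda>n. (B / norm (P (F (-1)))) ^ n * M) \<longlonglongrightarrow> 0 * M"
          using q B0 by (intro tendsto_mult tendsto_const LIMSEQ_power_zero) auto
        moreover have "norm (f (-1)) \<le> (B / norm (P (F (-1)))) ^ n * M" for n
          using pow[of n] q0 by (simp add: power_divide field_simps)
        ultimately have "norm (f (-1)) \<le> 0 * M" by (intro LIMSEQ_le_const) auto
        then show False using fnz by simp
      qed
    qed
  qed
qed

section \<open>Holomorphic discs and sums of square roots\<close>

text \<open>The equation says that G is a sum of a square root of A and a square root of B. Dividing it by the
square of s and passing to the limit gives (alpha + beta)^2 = 4 alpha beta, since G^2 vanishes to second
order. An equation along a sequence suffices, so no continuation argument is needed. The case B = 0
says that a square root of A is not differentiable unless alpha = 0.\<close>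

lemma two_root_contradiction:
  fixes G A B :: "complex \<Rightarrow> complex"
  assumes G: "G field_differentiable at 0"
    and A: "(A has_field_derivative \<alpha>) (at 0)" "A 0 = 0"
    and B: "(B has_field_derivative \<beta>) (at 0)" "B 0 = 0"
    and s: "s \<longlonglongrightarrow> 0" "\<And>m. s m \<noteq> 0"
    and eq: "\<And>m. ((G (s m))\<^sup>2 - A (s m) - B (s m))\<^sup>2 = 4 * A (s m) * B (s m)"
  shows "\<alpha> = \<beta>"
proof -
  obtain \<gamma> where \<gamma>: "(G has_field_derivative \<gamma>) (at 0)" using G by (auto simp: field_differentiable_def)
  have lim: "(\<lambda>m. f (s m)) \<longlonglongrightarrow> f 0" if "(f has_field_derivative d) (at 0)" for f :: "complex \<Rightarrow> complex" and d
    using DERIV_isCont[OF that] s(1) by (rule isCont_tendsto_compose)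
  have quot: "(\<lambda>m. f (s m) / s m) \<longlonglongrightarrow> d" if "(f has_field_derivative d) (at 0)" "f 0 = 0" for f :: "complex \<Rightarrow> complex" and d
  proof -
    have "((\<lambda>y. f y / y) \<longlongrightarrow> d) (at 0)" using that by (simp add: has_field_derivative_iff)
    moreover have "filterlim s (at 0) sequentially" using s by (simp add: filterlim_at)
    ultimately show ?thesis by (rule filterlim_compose)
  qed
  have "(\<lambda>m. ((G (s m))\<^sup>2 - A (s m) - B (s m))\<^sup>2 - 4 * A (s m) * B (s m)) \<longlonglongrightarrow> ((G 0)\<^sup>2 - A 0 - B 0)\<^sup>2 - 4 * A 0 * B 0"
    by (intro tendsto_intros lim[OF \<gamma>] lim[OF A(1)] lim[OF B(1)])
  then have "(\<lambda>m. 0) \<longlonglongrightarrow> ((G 0)\<^sup>2)\<^sup>2" by (simp add: eq A B)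
  then have "G 0 = 0" using LIMSEQ_unique[OF tendsto_const] by fastforce
  have G2: "(\<lambda>m. (G (s m))\<^sup>2 / s m) \<longlonglongrightarrow> 0 * \<gamma>"
    using tendsto_mult[OF lim[OF \<gamma>] quot[OF \<gamma> \<open>G 0 = 0\<close>]] \<open>G 0 = 0\<close> by (simp add: power2_eq_square)
  have "(\<lambda>m. ((G (s m))\<^sup>2 / s m - A (s m) / s m - B (s m) / s m)\<^sup>2 - 4 * (A (s m) / s m) * (B (s m) / s m))
      \<longlonglongrightarrow> (0 * \<gamma> - \<alpha> - \<beta>)\<^sup>2 - 4 * \<alpha> * \<beta>"
    by (intro tendsto_intros G2 quot A B)
  moreover have "((G (s m))\<^sup>2 / s m - A (s m) / s m - B (s m) / s m)\<^sup>2 - 4 * (A (s m) / s m) * (B (s m) / s m) = 0" for m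
  proof -
    have "((G (s m))\<^sup>2 / s m - A (s m) / s m - B (s m) / s m)\<^sup>2 - 4 * (A (s m) / s m) * (B (s m) / s m)
       = (((G (s m))\<^sup>2 - A (s m) - B (s m))\<^sup>2 - 4 * A (s m) * B (s m)) / (s m)\<^sup>2"
      using s(2)[of m] by (simp add: diff_divide_distrib[symmetric] power_divide power2_eq_square)
    then show ?thesis by (simp add: eq)
  qed
  ultimately have "(\<lambda>m. 0) \<longlonglongrightarrow> (0 * \<gamma> - \<alpha> - \<beta>)\<^sup>2 - 4 * \<alpha> * \<beta>" by simp
  then have "(0 * \<gamma> - \<alpha> - \<beta>)\<^sup>2 - 4 * \<alpha> * \<beta> = 0" using LIMSEQ_unique[OF tendsto_const] by metis
  then have "(\<alpha> - \<beta>)\<^sup>2 = 0" by (simp add: power2_eq_square algebra_simps)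
  then show ?thesis by simp
qed

lemma differentiable_root:
  assumes "P field_differentiable at 0" "P 0 \<noteq> (0::complex)"
  obtains h where "\<And>z. (h z)\<^sup>2 = P z" "h field_differentiable at 0"
proof
  show "(csqrt (P 0) * csqrt (P z / P 0))\<^sup>2 = P z" for z
    using assms(2) by (simp add: power_mult_distrib)
  have "(\<lambda>z. P z / P 0) field_differentiable at 0"
    using assms by (intro derivative_intros) auto
  moreover have "csqrt field_differentiable at (P 0 / P 0)"
    using assms(2) by (intro field_differentiable_at_csqrt) simp
  ultimately have "(csqrt \<circ> (\<lambda>z. P z / P 0)) field_differentiable at 0"
    by (rule field_differentiable_compose)
  then show "(\<lambda>z. csqrt (P 0) * csqrt (P z / P 0)) field_differentiable at 0"
    by (intro derivative_intros) (simp add: o_def)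
qed

text \<open>Here N collects the indices of the roots, other than the k-th, that may branch at 0. For the remaining
ones there is a differentiable root h, and only its sign is unknown. Finitely many sign patterns
share a sequence of points tending to 0, so one of them occurs infinitely often; subtracting the
corresponding sum from g leaves a sum of one or two square roots.\<close>

lemma root_sum_contradiction:
  fixes P :: "nat \<Rightarrow> complex \<Rightarrow> complex" and c :: "nat \<Rightarrow> real"
  assumes g: "g field_differentiable at 0"
    and sums: "\<And>z. z \<in> ball 0 1 \<Longrightarrow> \<exists>r. (\<forall>j<Suc k. (r j)\<^sup>2 = P j z) \<and> g z = (\<Sum>j<Suc k. of_real (c j) * r j)"
    and N: "N \<subseteq> {..<k}" "card N \<le> 1"
    and rootable: "\<And>j. j < k \<Longrightarrow> j \<notin> N \<Longrightarrow>
      \<exists>h. (\<forall>z\<in>ball 0 1. (h z)\<^sup>2 = P j z) \<and> h field_differentiable at 0"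
    and Pk: "(P k has_field_derivative a) (at 0)" "P k 0 = 0" "a \<noteq> 0" "c k \<noteq> 0"
    and PN: "\<And>j. j \<in> N \<Longrightarrow> (P j has_field_derivative b j) (at 0) \<and> P j 0 = 0
      \<and> (of_real (c k))\<^sup>2 * a \<noteq> (of_real (c j))\<^sup>2 * b j"
  shows False
proof -
  define J where "J = {..<k} - N"
  obtain h where h: "\<And>j z. j \<in> J \<Longrightarrow> z \<in> ball 0 1 \<Longrightarrow> (h j z)\<^sup>2 = P j z" "\<And>j. j \<in> J \<Longrightarrow> h j field_differentiable at 0"
  proof -
    have "\<forall>j\<in>J. \<exists>h. (\<forall>z\<in>ball 0 1. (h z)\<^sup>2 = P j z) \<and> h field_differentiable at 0"
      using rootable by (simp add: J_def)
    then obtain H where "\<forall>j\<in>J. (\<forall>z\<in>ball 0 1. (H j z)\<^sup>2 = P j z) \<and> H j field_differentiable at 0"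
      unfolding bchoice_iff by (elim exE)
    then show ?thesis by (intro that[of H]) simp_all
  qed
  have finN: "finite N" and finJ: "finite J" using N by (auto simp: J_def intro: finite_subset)
  define A where "A z = (of_real (c k))\<^sup>2 * P k z" for z
  define B where "B z = (\<Sum>j\<in>N. (of_real (c j))\<^sup>2 * P j z)" for z
  define G where "G e z = g z - (\<Sum>j\<in>J. e j * (of_real (c j) * h j z))" for e :: "nat \<Rightarrow> complex" and z
  let ?S = "PiE J (\<lambda>_. {1, -1 :: complex})"
  define s where "s m = (of_real (inverse (real (Suc (Suc m)))) :: complex)" for m
  have sb: "s m \<in> ball 0 1" "s m \<noteq> 0" for m
  proof -
    have "inverse (real (Suc (Suc m))) < 1" by (intro inverse_less_1_iff[THEN iffD2]) simp
    then show "s m \<in> ball 0 1" unfolding s_def mem_ball_0 norm_of_real by simp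
    show "s m \<noteq> 0" unfolding s_def of_real_eq_0_iff by simp
  qed
  have s0: "s \<longlonglongrightarrow> 0"
  proof -
    have "s = (\<lambda>m. of_real (inverse (real (Suc (Suc m)))))" by (simp only: s_def fun_eq_iff) simp
    then show ?thesis
      using tendsto_of_real[OF LIMSEQ_Suc[OF LIMSEQ_inverse_real_of_nat], where 'a = complex]
      by (simp only: of_real_0)
  qed
  have "\<exists>e\<in>?S. ((G e (s m))\<^sup>2 - A (s m) - B (s m))\<^sup>2 = 4 * A (s m) * B (s m)" for m
  proof -
    obtain r where r: "\<And>j. j < Suc k \<Longrightarrow> (r j)\<^sup>2 = P j (s m)" "g (s m) = (\<Sum>j<Suc k. of_real (c j) * r j)"
      using sums[OF sb(1)] by blast
    have "\<forall>j\<in>J. \<exists>t\<in>{1,-1}. r j = t * h j (s m)"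
    proof
      fix j assume j: "j \<in> J"
      then have "(r j)\<^sup>2 = (h j (s m))\<^sup>2" using r(1)[of j] h(1)[OF j sb(1)] by (simp add: J_def)
      then show "\<exists>t\<in>{1,-1}. r j = t * h j (s m)" by (auto simp: power2_eq_iff)
    qed
    then obtain e where e: "\<And>j. j \<in> J \<Longrightarrow> e j \<in> {1,-1} \<and> r j = e j * h j (s m)" by metis
    let ?e = "restrict e J"
    have "{..<k} = J \<union> N" "J \<inter> N = {}" using N by (auto simp: J_def)
    then have "g (s m) = (\<Sum>j\<in>J. of_real (c j) * r j) + (\<Sum>j\<in>N. of_real (c j) * r j) + of_real (c k) * r k"
      using r(2) finJ finN by (simp add: sum.union_disjoint)
    also have "(\<Sum>j\<in>J. of_real (c j) * r j) = (\<Sum>j\<in>J. ?e j * (of_real (c j) * h j (s m)))"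
      using e by (intro sum.cong) auto
    finally have Gval: "G ?e (s m) = (\<Sum>j\<in>N. of_real (c j) * r j) + of_real (c k) * r k" by (simp add: G_def)
    have b: "(\<Sum>j\<in>N. of_real (c j) * r j)\<^sup>2 = B (s m)"
    proof (cases "N = {}")
      case False
      then have "card N = 1" using N(2) finN by (metis One_nat_def card_0_eq le_Suc_eq le_zero_eq)
      then obtain j where j: "N = {j}" by (auto simp: card_1_singleton_iff)
      then have "(r j)\<^sup>2 = P j (s m)" using r(1)[of j] N(1) by auto
      then show ?thesis by (simp add: j B_def power_mult_distrib)
    qed (simp add: B_def)
    have a: "(of_real (c k) * r k)\<^sup>2 = A (s m)" using r(1)[of k] by (simp add: A_def power_mult_distrib)
    \<comment> \<open>Squaring twice removes the unknown signs of the two branching roots.\<close>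
    have "(((x + y)\<^sup>2 - y\<^sup>2 - x\<^sup>2)\<^sup>2 :: complex) = 4 * y\<^sup>2 * x\<^sup>2" for x y
      by (simp add: power2_eq_square algebra_simps)
    then have "((G ?e (s m))\<^sup>2 - A (s m) - B (s m))\<^sup>2 = 4 * A (s m) * B (s m)"
      unfolding Gval a[symmetric] b[symmetric] .
    moreover have "?e \<in> ?S" using e by auto
    ultimately show ?thesis by blast
  qed
  then have "\<exists>e\<in>?S. infinite {m \<in> UNIV. ((G e (s m))\<^sup>2 - A (s m) - B (s m))\<^sup>2 = 4 * A (s m) * B (s m)}"
    using finJ by (intro pigeonhole_infinite_rel) (auto intro: finite_PiE)
  then obtain e where e: "infinite {m. ((G e (s m))\<^sup>2 - A (s m) - B (s m))\<^sup>2 = 4 * A (s m) * B (s m)}" by auto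
  obtain \<phi> :: "nat \<Rightarrow> nat" where \<phi>: "strict_mono \<phi>"
    "\<And>n. \<phi> n \<in> {m. ((G e (s m))\<^sup>2 - A (s m) - B (s m))\<^sup>2 = 4 * A (s m) * B (s m)}"
    using infinite_enumerate[OF e] by blast
  have "(of_real (c k))\<^sup>2 * a = (\<Sum>j\<in>N. (of_real (c j))\<^sup>2 * b j)"
  proof (rule two_root_contradiction)
    show "G e field_differentiable at 0"
      unfolding G_def using g h(2) by (intro derivative_intros) auto
    show "(A has_field_derivative (of_real (c k))\<^sup>2 * a) (at 0)"
      unfolding A_def by (intro DERIV_cmult Pk)
    show "(B has_field_derivative (\<Sum>j\<in>N. (of_real (c j))\<^sup>2 * b j)) (at 0)"
      unfolding B_def using PN by (intro DERIV_sum DERIV_cmult) blast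
    show "A 0 = 0" "B 0 = 0" using Pk PN by (simp_all add: A_def B_def)
    show "(\<lambda>n. s (\<phi> n)) \<longlonglongrightarrow> 0" using LIMSEQ_subseq_LIMSEQ[OF s0 \<phi>(1)] by (simp add: o_def)
    show "s (\<phi> n) \<noteq> 0" for n using sb by simp
    show "((G e (s (\<phi> n)))\<^sup>2 - A (s (\<phi> n)) - B (s (\<phi> n)))\<^sup>2 = 4 * A (s (\<phi> n)) * B (s (\<phi> n))" for n
      using \<phi>(2)[of n] by simp
  qed
  moreover have "(of_real (c k))\<^sup>2 * a \<noteq> (\<Sum>j\<in>N. (of_real (c j))\<^sup>2 * b j)"
  proof (cases "N = {}")
    case True then show ?thesis using Pk by simp
  next
    case False
    then have "card N = 1" using N(2) finN by (metis One_nat_def card_0_eq le_Suc_eq le_zero_eq)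
    then obtain j where j: "N = {j}" by (auto simp: card_1_singleton_iff)
    then show ?thesis using PN[of j] by simp
  qed
  ultimately show False by blast
qed

text \<open>Every condition is preserved by locally uniform limits. In particular the alternative for the
coordinate i', constant or with derivative bounded below, is split off as the parameter flat because
it would not be closed if it only said nonconstant.\<close>

definition normalized_disc ::
    "bool \<Rightarrow> 'n \<Rightarrow> 'n \<Rightarrow> complex \<Rightarrow> real \<Rightarrow> real \<Rightarrow> (complex \<Rightarrow> complex ^ 'n) \<Rightarrow> bool" where
  "normalized_disc flat i i' a \<alpha> R \<sigma> \<longleftrightarrow>
     (\<forall>l. (\<lambda>z. \<sigma> z $ l) holomorphic_on ball 0 1) \<and> (\<forall>l. \<forall>z\<in>ball 0 1. norm (\<sigma> z $ l) \<le> R) \<and>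
     \<sigma> 0 $ i = a \<and> \<alpha> \<le> norm (deriv (\<lambda>z. \<sigma> z $ i) 0) \<and> norm (deriv (\<lambda>z. \<sigma> z $ i) 0) \<le> 1 / \<alpha> \<and>
     (if flat then \<forall>z\<in>ball 0 1. \<sigma> z $ i' = \<sigma> 0 $ i' else \<alpha> \<le> norm (deriv (\<lambda>z. \<sigma> z $ i') 0))"

lemma bounded_holomorphic_subsequence:
  fixes u :: "nat \<Rightarrow> complex \<Rightarrow> complex"
  assumes "\<And>m. u m holomorphic_on ball 0 1" "\<And>m z. z \<in> ball 0 1 \<Longrightarrow> norm (u m z) \<le> R"
  obtains g r where "g holomorphic_on ball 0 1" "strict_mono (r :: nat \<Rightarrow> nat)"
    "\<And>z. z \<in> ball 0 1 \<Longrightarrow> (\<lambda>m. u (r m) z) \<longlonglongrightarrow> g z" "(\<lambda>m. deriv (u (r m)) 0) \<longlonglongrightarrow> deriv g 0"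
proof -
  obtain g r where g: "g holomorphic_on ball 0 1" "strict_mono (r :: nat \<Rightarrow> nat)"
    "\<And>z. z \<in> ball 0 1 \<Longrightarrow> (\<lambda>m. u (r m) z) \<longlonglongrightarrow> g z"
    "\<And>K. compact K \<Longrightarrow> K \<subseteq> ball 0 1 \<Longrightarrow> uniform_limit K (u \<circ> r) g sequentially"
  proof (rule Montel[of "ball 0 1" "range u" u])
    show "\<exists>B. \<forall>h\<in>range u. \<forall>z\<in>K. norm (h z) \<le> B" if "compact K" "K \<subseteq> ball 0 1" for K
      using assms(2) that by (intro exI[of _ R]) auto
  qed (use assms(1) in auto)
  have "uniform_limit (cball 0 (1/2)) (u \<circ> r) g sequentially" by (rule g(4)) auto
  then have ul: "uniform_limit (ball 0 (1/2)) (u \<circ> r) g sequentially"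
    by (rule uniform_limit_on_subset) auto
  have "((\<lambda>m. deriv ((u \<circ> r) m) 0) \<longlongrightarrow> deriv g 0) sequentially"
  proof (rule deriv_complex_uniform_limit[OF ul])
    show "\<forall>\<^sub>F n in sequentially. (u \<circ> r) n holomorphic_on ball 0 (1/2)"
      by (intro always_eventually allI) (auto intro!: holomorphic_on_subset[OF assms(1)])
  qed auto
  then have "(\<lambda>m. deriv (u (r m)) 0) \<longlonglongrightarrow> deriv g 0" by (simp add: o_def)
  from that[OF g(1-3) this] show ?thesis .
qed

lemma bounded_discs_subsequence:
  fixes \<sigma> :: "nat \<Rightarrow> complex \<Rightarrow> complex ^ 'n"
  assumes hol: "\<And>m l. (\<lambda>z. \<sigma> m z $ l) holomorphic_on ball 0 1"
    and bd: "\<And>m l z. z \<in> ball 0 1 \<Longrightarrow> norm (\<sigma> m z $ l) \<le> R"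
  obtains g r where "strict_mono (r :: nat \<Rightarrow> nat)" "\<And>l. (\<lambda>z. g z $ l) holomorphic_on ball 0 1"
    "\<And>l z. z \<in> ball 0 1 \<Longrightarrow> (\<lambda>m. \<sigma> (r m) z $ l) \<longlonglongrightarrow> g z $ l"
    "\<And>l. (\<lambda>m. deriv (\<lambda>z. \<sigma> (r m) z $ l) 0) \<longlonglongrightarrow> deriv (\<lambda>z. g z $ l) 0"
proof -
  have "\<exists>r f. strict_mono (r :: nat \<Rightarrow> nat) \<and> (\<forall>l\<in>L. f l holomorphic_on ball 0 1 \<and>
      (\<forall>z\<in>ball 0 1. (\<lambda>m. \<sigma> (r m) z $ l) \<longlonglongrightarrow> f l z) \<and>
      (\<lambda>m. deriv (\<lambda>z. \<sigma> (r m) z $ l) 0) \<longlonglongrightarrow> deriv (f l) 0)" if "finite L" for L :: "'n set"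
    using that
  proof (induction L rule: finite_induct)
    case empty
    show ?case by (rule exI[of _ id]) (auto simp: strict_mono_def)
  next
    case (insert l L)
    then obtain r f where r: "strict_mono (r :: nat \<Rightarrow> nat)" and f: "\<And>l. l \<in> L \<Longrightarrow> f l holomorphic_on ball 0 1"
      "\<And>l z. l \<in> L \<Longrightarrow> z \<in> ball 0 1 \<Longrightarrow> (\<lambda>m. \<sigma> (r m) z $ l) \<longlonglongrightarrow> f l z"
      "\<And>l. l \<in> L \<Longrightarrow> (\<lambda>m. deriv (\<lambda>z. \<sigma> (r m) z $ l) 0) \<longlonglongrightarrow> deriv (f l) 0" by metis
    obtain g q where g: "g holomorphic_on ball 0 1" "strict_mono (q :: nat \<Rightarrow> nat)"
      "\<And>z. z \<in> ball 0 1 \<Longrightarrow> (\<lambda>m. \<sigma> (r (q m)) z $ l) \<longlonglongrightarrow> g z"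
      "(\<lambda>m. deriv (\<lambda>z. \<sigma> (r (q m)) z $ l) 0) \<longlonglongrightarrow> deriv g 0"
      using bounded_holomorphic_subsequence[of "\<lambda>m z. \<sigma> (r m) z $ l" R] hol bd by metis
    show ?case
    proof (rule exI[of _ "r \<circ> q"], rule exI[of _ "f(l := g)"], intro conjI ballI)
      show "strict_mono (r \<circ> q)" using r g(2) by (rule strict_mono_o)
      fix l' assume l': "l' \<in> insert l L"
      show "(f(l := g)) l' holomorphic_on ball 0 1" using l' f(1) g(1) by auto
      show "(\<lambda>m. deriv (\<lambda>z. \<sigma> ((r \<circ> q) m) z $ l') 0) \<longlonglongrightarrow> deriv ((f(l := g)) l') 0"
        using l' insert.hyps g(4) LIMSEQ_subseq_LIMSEQ[OF f(3) g(2), of l'] by (auto simp: o_def)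
      fix z :: complex assume z: "z \<in> ball 0 1"
      show "(\<lambda>m. \<sigma> ((r \<circ> q) m) z $ l') \<longlonglongrightarrow> (f(l := g)) l' z"
        using l' insert.hyps g(3)[OF z] LIMSEQ_subseq_LIMSEQ[OF f(2)[OF _ z] g(2), of l'] by (auto simp: o_def)
    qed
  qed
  from this[OF finite, of UNIV] obtain r f where rf: "strict_mono (r :: nat \<Rightarrow> nat) \<and>
      (\<forall>l\<in>UNIV. f l holomorphic_on ball 0 1 \<and>
      (\<forall>z\<in>ball 0 1. (\<lambda>m. \<sigma> (r m) z $ l) \<longlonglongrightarrow> f l z) \<and>
      (\<lambda>m. deriv (\<lambda>z. \<sigma> (r m) z $ l) 0) \<longlonglongrightarrow> deriv (f l) 0)"
    by (elim exE) (rule that)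
  then have r: "strict_mono r" ..
  have f: "f l holomorphic_on ball 0 1" "z \<in> ball 0 1 \<Longrightarrow> (\<lambda>m. \<sigma> (r m) z $ l) \<longlonglongrightarrow> f l z"
      "(\<lambda>m. deriv (\<lambda>z. \<sigma> (r m) z $ l) 0) \<longlonglongrightarrow> deriv (f l) 0" for l z
    using conjunct2[OF rf] by simp_all
  show ?thesis
    by (rule that[OF r, of "\<lambda>z. \<chi> l. f l z"]) (use f in auto)
qed

text \<open>The normalized discs form a compact family by Montel's theorem, and a limit of discs on which Q becomes
uniformly small is a disc on which Q vanishes.\<close>

lemma no_disc_near_zero_set:
  fixes Q :: "complex ^ 'n \<Rightarrow> complex"
  assumes Q: "continuous_on UNIV Q"
    and none: "\<And>\<sigma>. normalized_disc flat i i' a \<alpha> R \<sigma> \<Longrightarrow> \<exists>z\<in>ball 0 1. Q (\<sigma> z) \<noteq> 0"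
  shows "\<exists>\<kappa>>0. \<forall>\<sigma>. normalized_disc flat i i' a \<alpha> R \<sigma> \<longrightarrow> (\<exists>z\<in>ball 0 1. \<kappa> < norm (Q (\<sigma> z)))"
proof (rule ccontr)
  assume "\<not> ?thesis"
  then have "\<exists>\<sigma>. normalized_disc flat i i' a \<alpha> R \<sigma> \<and> (\<forall>z\<in>ball 0 1. norm (Q (\<sigma> z)) \<le> inverse (real (Suc m)))" for m
    by (metis inverse_positive_iff_positive linorder_not_less of_nat_0_less_iff zero_less_Suc)
  then obtain \<sigma> where \<sigma>: "\<And>m. normalized_disc flat i i' a \<alpha> R (\<sigma> m)"
    "\<And>m z. z \<in> ball 0 1 \<Longrightarrow> norm (Q (\<sigma> m z)) \<le> inverse (real (Suc m))" by metis
  have hol: "(\<lambda>z. \<sigma> m z $ l) holomorphic_on ball 0 1" for m l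
    using \<sigma>(1)[of m] by (simp add: normalized_disc_def)
  have bd: "norm (\<sigma> m z $ l) \<le> R" if "z \<in> ball 0 1" for m l z
    using \<sigma>(1)[of m] that by (simp add: normalized_disc_def)
  obtain g r where r: "strict_mono (r :: nat \<Rightarrow> nat)" and g: "\<And>l. (\<lambda>z. g z $ l) holomorphic_on ball 0 1"
    "\<And>l z. z \<in> ball 0 1 \<Longrightarrow> (\<lambda>m. \<sigma> (r m) z $ l) \<longlonglongrightarrow> g z $ l"
    "\<And>l. (\<lambda>m. deriv (\<lambda>z. \<sigma> (r m) z $ l) 0) \<longlonglongrightarrow> deriv (\<lambda>z. g z $ l) 0"
    using bounded_discs_subsequence[of \<sigma> R, OF hol bd] by metis
  have "normalized_disc flat i i' a \<alpha> R g"
    unfolding normalized_disc_def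
  proof (intro conjI allI ballI)
    show "(\<lambda>z. g z $ l) holomorphic_on ball 0 1" for l by (rule g(1))
    show "norm (g z $ l) \<le> R" if "z \<in> ball 0 1" for z l
      by (rule Lim_norm_ubound[OF _ g(2)[OF that]]) (use bd[OF that] in auto)
    have "(\<lambda>m. \<sigma> (r m) 0 $ i) = (\<lambda>m. a)" using \<sigma>(1) by (simp add: normalized_disc_def)
    then show "g 0 $ i = a" using g(2)[of 0 i] LIMSEQ_unique[OF _ tendsto_const] by fastforce
    show "\<alpha> \<le> norm (deriv (\<lambda>z. g z $ i) 0)"
      by (rule Lim_norm_lbound[OF _ g(3)]) (use \<sigma>(1) in \<open>auto simp: normalized_disc_def\<close>)
    show "norm (deriv (\<lambda>z. g z $ i) 0) \<le> 1 / \<alpha>"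
      by (rule Lim_norm_ubound[OF _ g(3)]) (use \<sigma>(1) in \<open>auto simp: normalized_disc_def\<close>)
    show "if flat then \<forall>z\<in>ball 0 1. g z $ i' = g 0 $ i' else \<alpha> \<le> norm (deriv (\<lambda>z. g z $ i') 0)"
    proof (cases flat)
      case True
      have "g z $ i' = g 0 $ i'" if z: "z \<in> ball 0 1" for z
      proof -
        have "\<sigma> (r m) z $ i' = \<sigma> (r m) 0 $ i'" for m
          using \<sigma>(1)[of "r m"] z unfolding normalized_disc_def if_P[OF True] by blast
        then have "(\<lambda>m. \<sigma> (r m) z $ i') \<longlonglongrightarrow> g 0 $ i'" using g(2)[of 0 i'] by simp
        with g(2)[OF z] show ?thesis by (rule LIMSEQ_unique)
      qed
      then show ?thesis unfolding if_P[OF True] by blast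
    next
      case False
      have "\<alpha> \<le> norm (deriv (\<lambda>z. \<sigma> m z $ i') 0)" for m
        using \<sigma>(1)[of m] unfolding normalized_disc_def if_not_P[OF False] by blast
      then have "\<alpha> \<le> norm (deriv (\<lambda>z. g z $ i') 0)"
        by (intro Lim_norm_lbound[OF _ g(3)]) simp_all
      then show ?thesis using False by simp
    qed
  qed
  then obtain z where z: "z \<in> ball 0 1" "Q (g z) \<noteq> 0" using none by blast
  have "(\<lambda>m. \<sigma> (r m) z) \<longlonglongrightarrow> g z" by (rule vec_tendstoI) (rule g(2)[OF z(1)])
  then have "(\<lambda>m. Q (\<sigma> (r m) z)) \<longlonglongrightarrow> Q (g z)"
    using Q by (intro isCont_tendsto_compose[of _ Q]) (auto simp: continuous_on_eq_continuous_at)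
  moreover have "(\<lambda>m. Q (\<sigma> (r m) z)) \<longlonglongrightarrow> 0"
  proof (rule Lim_null_comparison)
    show "\<forall>\<^sub>F m in sequentially. norm (Q (\<sigma> (r m) z)) \<le> inverse (real (Suc (r m)))"
      using \<sigma>(2)[OF z(1)] by simp
    show "(\<lambda>m. inverse (real (Suc (r m)))) \<longlonglongrightarrow> 0"
      using LIMSEQ_subseq_LIMSEQ[OF LIMSEQ_inverse_real_of_nat r] by (simp add: o_def)
  qed
  ultimately show False using z(2) LIMSEQ_unique by blast
qed

section \<open>Adjoining square roots\<close>

lemma shift_nth [simp]: "(v + axis k a :: complex ^ 'n) $ i = (if i = k then v $ i + a else v $ i)"
  by (simp add: axis_def)

lemma norm_axis_complex [simp]: "norm (axis k a :: complex ^ 'n) = norm a"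
proof -
  have "(\<Sum>i\<in>UNIV. (norm ((axis k a :: complex ^ 'n) $ i))\<^sup>2) = (\<Sum>i\<in>UNIV. if i = k then (norm a)\<^sup>2 else 0)"
    by (intro sum.cong) (auto simp: axis_def)
  then show ?thesis by (simp add: norm_vec_def L2_set_def)
qed

text \<open>The functions p n do not depend on the third coordinate, so square roots of all of them can be added
into that coordinate without changing the base.\<close>

locale root_tower =
  fixes p :: "nat \<Rightarrow> complex ^ 3 \<Rightarrow> complex"
  assumes p_poly: "complex_polynomial (p n)"
    and p_shift: "p n (v + axis 3 a) = p n v"
begin

definition root_sums :: "(nat \<Rightarrow> real) \<Rightarrow> nat \<Rightarrow> complex ^ 3 \<Rightarrow> complex set" where
  "root_sums c n v = {\<Sum>j<n. of_real (c j) * r j | r. \<forall>j<n. (r j)\<^sup>2 = p j v}"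

text \<open>The product of v3 - s over all s in root_sums c n v, counted with multiplicity. The
recursion replaces the last root by its two signs; the choice of branch csqrt does not matter.\<close>

primrec root_poly :: "(nat \<Rightarrow> real) \<Rightarrow> nat \<Rightarrow> complex ^ 3 \<Rightarrow> complex" where
  "root_poly c 0 v = v $ 3"
| "root_poly c (Suc n) v = root_poly c n (v + axis 3 (of_real (c n) * csqrt (p n v)))
     * root_poly c n (v + axis 3 (- (of_real (c n) * csqrt (p n v))))"

lemma root_sums_0 [simp]: "root_sums c 0 v = {0}"
  by (simp add: root_sums_def)

lemma root_sums_Suc:
  "root_sums c (Suc n) v = {s + of_real (c n) * r | s r. s \<in> root_sums c n v \<and> r\<^sup>2 = p n v}"
proof (intro equalityI subsetI)
  fix w assume "w \<in> root_sums c (Suc n) v"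
  then obtain r where "w = (\<Sum>j<Suc n. of_real (c j) * r j)" "\<forall>j<Suc n. (r j)\<^sup>2 = p j v"
    by (auto simp: root_sums_def)
  then show "w \<in> {s + of_real (c n) * r | s r. s \<in> root_sums c n v \<and> r\<^sup>2 = p n v}"
    by (intro CollectI exI[of _ "\<Sum>j<n. of_real (c j) * r j"] exI[of _ "r n"]) (auto simp: root_sums_def)
next
  fix w assume "w \<in> {s + of_real (c n) * r | s r. s \<in> root_sums c n v \<and> r\<^sup>2 = p n v}"
  then obtain r q where r: "w = (\<Sum>j<n. of_real (c j) * r j) + of_real (c n) * q"
    "\<forall>j<n. (r j)\<^sup>2 = p j v" "q\<^sup>2 = p n v"
    by (auto simp: root_sums_def)
  then show "w \<in> root_sums c (Suc n) v"
    unfolding root_sums_def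
    by (intro CollectI exI[of _ "r(n := q)"]) (auto simp: less_Suc_eq)
qed

lemma root_sums_shift [simp]: "root_sums c n (v + axis 3 a) = root_sums c n v"
  by (simp add: root_sums_def p_shift)

lemma square_eq_cases: "r\<^sup>2 = (z::complex) \<Longrightarrow> r = csqrt z \<or> r = - csqrt z"
  by (metis power2_csqrt power2_eq_iff)

lemma root_sums_finite: "finite (root_sums c n v) \<and> card (root_sums c n v) \<le> 2 ^ n"
proof (induction n)
  case (Suc n)
  let ?t = "of_real (c n) * csqrt (p n v)"
  have "root_sums c (Suc n) v \<subseteq> (\<lambda>s. s + ?t) ` root_sums c n v \<union> (\<lambda>s. s - ?t) ` root_sums c n v"
    unfolding root_sums_Suc using square_eq_cases by fastforce
  moreover have "card ((\<lambda>s. s + ?t) ` root_sums c n v \<union> (\<lambda>s. s - ?t) ` root_sums c n v) \<le> 2 ^ Suc n"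
    using Suc card_Un_le[of "(\<lambda>s. s + ?t) ` root_sums c n v" "(\<lambda>s. s - ?t) ` root_sums c n v"]
      card_image_le[of "root_sums c n v" "\<lambda>s. s + ?t"] card_image_le[of "root_sums c n v" "\<lambda>s. s - ?t"]
    by simp
  ultimately show ?case
    using Suc by (meson card_mono finite_UnI finite_imageI finite_subset order_trans)
qed simp

lemma root_poly_zero: "v $ 3 \<in> root_sums c n v \<Longrightarrow> root_poly c n v = 0"
proof (induction n arbitrary: v)
  case (Suc n)
  then obtain s r where s: "v $ 3 = s + of_real (c n) * r" "s \<in> root_sums c n v" "r\<^sup>2 = p n v"
    by (auto simp: root_sums_Suc)
  have "root_poly c n (v + axis 3 (- (of_real (c n) * r))) = 0"
    using Suc.IH s by simp
  then show ?case using square_eq_cases[OF s(3)] by auto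
qed simp

text \<open>A product of 2^n factors is at most t^(2^n) only if some factor is at most t.\<close>

lemma root_poly_small:
  assumes "0 \<le> t"
  shows "norm (root_poly c n v) \<le> t ^ (2 ^ n) \<Longrightarrow> \<exists>s\<in>root_sums c n v. norm (v $ 3 - s) \<le> t"
proof (induction n arbitrary: v)
  case (Suc n)
  let ?t = "of_real (c n) * csqrt (p n v)"
  have "norm (root_poly c n (v + axis 3 ?t)) * norm (root_poly c n (v + axis 3 (- ?t))) \<le> t ^ (2 ^ n) * t ^ (2 ^ n)"
    using Suc.prems by (simp add: norm_mult flip: power_add mult_2)
  then consider "norm (root_poly c n (v + axis 3 ?t)) \<le> t ^ (2 ^ n)"
    | "norm (root_poly c n (v + axis 3 (- ?t))) \<le> t ^ (2 ^ n)"
    by (meson assms linorder_not_le mult_strict_mono' zero_le_power)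
  then show ?case
  proof cases
    case 1
    then obtain s where "s \<in> root_sums c n v" "norm (v $ 3 + ?t - s) \<le> t"
      using Suc.IH[OF 1] by auto
    moreover have "s + of_real (c n) * (- csqrt (p n v)) \<in> root_sums c (Suc n) v"
      using calculation(1) unfolding root_sums_Suc
      by (intro CollectI exI[of _ s] exI[of _ "- csqrt (p n v)"]) simp
    ultimately show ?thesis
      by (intro bexI[of _ "s + of_real (c n) * (- csqrt (p n v))"]) (simp add: algebra_simps)
  next
    case 2
    obtain s where "s \<in> root_sums c n (v + axis 3 (- ?t))" "norm ((v + axis 3 (- ?t)) $ 3 - s) \<le> t"
      using Suc.IH[OF 2] by blast
    then have "s \<in> root_sums c n v" "norm (v $ 3 + - ?t - s) \<le> t" by simp_all
    moreover have "s + ?t \<in> root_sums c (Suc n) v"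
      using calculation(1) unfolding root_sums_Suc
      by (intro CollectI exI[of _ s] exI[of _ "csqrt (p n v)"]) simp
    ultimately show ?thesis
      by (intro bexI[of _ "s + ?t"]) (simp add: algebra_simps)
  qed
qed simp

lemma root_poly_poly: "complex_polynomial (root_poly c n)"
proof (induction n)
  case 0
  have "root_poly c 0 = (\<lambda>v. v $ 3)" by (simp add: fun_eq_iff)
  then show ?case using complex_polynomial_coord[of 3] by simp
next
  case (Suc n)
  obtain N where "complex_polynomial N"
    "\<And>v r. r\<^sup>2 = p n v \<Longrightarrow> N v = root_poly c n (v + axis 3 (of_real (c n) * r)) * root_poly c n (v + axis 3 (- (of_real (c n) * r)))"
    using polynomial_norm[OF Suc p_poly, of _ _ "of_real (c n)"] by metis
  moreover have "root_poly c (Suc n) v = N v" for v using calculation(2)[of "csqrt (p n v)" v] by simp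
  then have "root_poly c (Suc n) = N" by (rule ext)
  ultimately show ?case by simp
qed

lemma continuous_on_root_poly: "continuous_on S (root_poly c n)"
  using root_poly_poly continuous_on_complex_polynomial by blast

lemma root_poly_cong: "(\<And>j. j < n \<Longrightarrow> c j = d j) \<Longrightarrow> root_poly c n v = root_poly d n v"
  by (induction n arbitrary: v) auto

lemma root_sums_cong: "(\<And>j. j < n \<Longrightarrow> c j = d j) \<Longrightarrow> root_sums c n v = root_sums d n v"
  by (induction n) (auto simp: root_sums_Suc)

end

definition base :: "complex ^ 3 \<Rightarrow> complex ^ 3" where
  "base v = v + axis 3 (- (v $ 3))"

lemma base_nth: "base v $ i = (if i = 3 then 0 else v $ i)"
  by (simp add: base_def axis_def)

lemma base_plus_axis: "base v + axis 3 (v $ 3) = v"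
  by (simp add: vec_eq_iff base_nth axis_def)

lemma base_shift [simp]: "base (v + axis 3 a) = base v"
  by (simp add: vec_eq_iff base_nth axis_def)

lemma base_id: "v $ 3 = 0 \<Longrightarrow> base v = v"
  by (simp add: vec_eq_iff base_nth)

lemma axis_add_axis: "axis 3 a + axis 3 (b::complex) = (axis 3 (a + b) :: complex ^ 3)"
  by (simp add: vec_eq_iff axis_def)

lemma continuous_on_axis: "continuous_on S (axis k :: complex \<Rightarrow> complex ^ 'n)"
proof -
  have "continuous_on S (\<lambda>x. (\<chi> i. if i = k then x else 0) :: complex ^ 'n)"
  proof (rule continuous_on_vec_lambda)
    show "continuous_on S (\<lambda>x::complex. if i = k then x else 0)" for i by (cases "i = k") simp_all
  qed
  moreover have "(axis k :: complex \<Rightarrow> complex ^ 'n) = (\<lambda>x. \<chi> i. if i = k then x else 0)"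
    by (simp add: fun_eq_iff vec_eq_iff axis_def)
  ultimately show ?thesis by simp
qed

lemma compact_vertical_thickening:
  fixes L :: "(complex ^ 3) set"
  assumes "compact L"
  shows "compact {x + axis 3 d | x d. x \<in> L \<and> norm d \<le> t}"
proof -
  have "{x + axis 3 d | x d. x \<in> L \<and> norm d \<le> t} = (\<lambda>(x, d). x + axis 3 d) ` (L \<times> cball 0 t)"
    by (auto simp: image_iff) blast
  moreover have "continuous_on (L \<times> cball 0 t) (\<lambda>(x, d). x + axis 3 d :: complex ^ 3)"
    unfolding case_prod_unfold
    by (intro continuous_intros continuous_on_compose2[OF continuous_on_axis[of UNIV]]) auto
  ultimately show ?thesis using assms by (simp add: compact_continuous_image compact_Times)
qed

locale root_tower_over = root_tower +
  fixes K :: "(complex ^ 3) set" and c :: "nat \<Rightarrow> real"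
  assumes K: "compact K" "K \<noteq> {}" "\<And>v. v \<in> K \<Longrightarrow> v $ 3 = 0"
    and p_bound: "\<And>v n. v \<in> K \<Longrightarrow> norm (p n v) \<le> 1"
    and c_pos: "\<And>n. 0 < c n" and c_sum: "summable c"
begin

abbreviation partial_sum :: "(nat \<Rightarrow> complex) \<Rightarrow> nat \<Rightarrow> complex" where
  "partial_sum r n \<equiv> \<Sum>j<n. of_real (c j) * r j"

abbreviation series :: "(nat \<Rightarrow> complex) \<Rightarrow> complex" where
  "series r \<equiv> \<Sum>j. of_real (c j) * r j"

definition tail :: "nat \<Rightarrow> real" where "tail n = (\<Sum>j. c (j + n))"

definition level :: "nat \<Rightarrow> (complex ^ 3) set" where
  "level n = {v. base v \<in> K \<and> v $ 3 \<in> root_sums c n v}"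

text \<open>Described by the distances to the partial sums rather than by the full series, so that compactness
is immediate. The full series provide the points that are needed (limit_setI).\<close>

definition limit_set :: "(complex ^ 3) set" where
  "limit_set = {v. base v \<in> K \<and> (\<forall>n. \<exists>s\<in>root_sums c n v. norm (v $ 3 - s) \<le> tail n)}"

lemma p_base: "p n (base v) = p n v"
  by (simp add: base_def p_shift)

lemma root_sums_base: "root_sums c n (base v) = root_sums c n v"
  by (simp add: base_def)

lemma root_bound: "base v \<in> K \<Longrightarrow> r\<^sup>2 = p n v \<Longrightarrow> norm r \<le> 1"
  using p_bound[of "base v" n] by (metis norm_ge_zero norm_power p_base power2_le_imp_le one_power2 zero_le_one)

lemma level_0: "level 0 = K"
proof -
  have "base v \<in> K \<and> v $ 3 = 0 \<longleftrightarrow> v \<in> K" for v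
    using K(3)[of v] base_id[of v] by metis
  then show ?thesis by (auto simp: level_def)
qed

lemma level_Suc: "level (Suc n) = {x + axis 3 (of_real (c n) * r) | x r. x \<in> level n \<and> r\<^sup>2 = p n x}"
proof (intro equalityI subsetI)
  fix v assume "v \<in> level (Suc n)"
  then obtain s r where v: "base v \<in> K" "v $ 3 = s + of_real (c n) * r" "s \<in> root_sums c n v" "r\<^sup>2 = p n v"
    by (auto simp: level_def root_sums_Suc)
  let ?x = "v + axis 3 (- (of_real (c n) * r))"
  have "?x \<in> level n" using v by (simp add: level_def)
  moreover have "?x + axis 3 (of_real (c n) * r) = v" by (simp add: vec_eq_iff axis_def)
  ultimately show "v \<in> {x + axis 3 (of_real (c n) * r) | x r. x \<in> level n \<and> r\<^sup>2 = p n x}"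
    using v p_shift by (intro CollectI exI[of _ ?x] exI[of _ r]) auto
next
  fix v assume "v \<in> {x + axis 3 (of_real (c n) * r) | x r. x \<in> level n \<and> r\<^sup>2 = p n x}"
  then obtain x r where "v = x + axis 3 (of_real (c n) * r)" "x \<in> level n" "r\<^sup>2 = p n x" by blast
  then show "v \<in> level (Suc n)"
    by (auto simp: level_def root_sums_Suc p_shift)
qed

lemma root_series:
  assumes v: "base v \<in> K" and r: "\<And>j. (r j)\<^sup>2 = p j v"
  shows "summable (\<lambda>j. of_real (c j) * r j)"
    and "norm (series r - partial_sum r n) \<le> tail n"
proof -
  have le: "norm (of_real (c j) * r j) \<le> c j" for j
    using root_bound[OF v r] c_pos[of j] mult_left_mono[of "norm (r j)" 1 "c j"] by (simp add: norm_mult)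
  show sm: "summable (\<lambda>j. of_real (c j) * r j)"
    by (rule summable_comparison_test'[OF c_sum]) (rule le)
  have "series r - partial_sum r n = (\<Sum>j. of_real (c (j + n)) * r (j + n))"
    using suminf_split_initial_segment[OF sm, of n] by simp
  also have "norm \<dots> \<le> tail n"
    unfolding tail_def by (rule norm_suminf_le) (use le c_sum in \<open>auto simp: summable_iff_shift\<close>)
  finally show "norm (series r - partial_sum r n) \<le> tail n" .
qed

lemma limit_setI:
  assumes v: "base v \<in> K" and r: "\<And>j. (r j)\<^sup>2 = p j v"
  shows "base v + axis 3 (series r) \<in> limit_set"
  unfolding limit_set_def
proof (intro CollectI conjI allI)
  show "base (base v + axis 3 (series r)) \<in> K"
    using v by (simp add: base_id base_nth)
  fix n
  have "partial_sum r n \<in> root_sums c n v"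
    using r by (auto simp: root_sums_def)
  then show "\<exists>s\<in>root_sums c n (base v + axis 3 (series r)).
      norm ((base v + axis 3 (series r)) $ 3 - s) \<le> tail n"
    using root_series(2)[OF assms, of n] by (auto simp: root_sums_base base_nth)
qed

lemma tail_nonneg: "0 \<le> tail n"
  unfolding tail_def using c_pos c_sum by (intro suminf_nonneg) (auto simp: summable_iff_shift less_imp_le)

lemma tail_tendsto: "tail \<longlonglongrightarrow> 0"
proof -
  have "tail = (\<lambda>n. suminf c - sum c {..<n})"
    using suminf_minus_initial_segment[OF c_sum] by (auto simp: tail_def)
  moreover have "(\<lambda>n. suminf c - sum c {..<n}) \<longlonglongrightarrow> suminf c - suminf c"
    by (intro tendsto_intros summable_LIMSEQ c_sum)
  ultimately show ?thesis by simp
qed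

lemma level_near_limit_set:
  assumes "x \<in> level n"
  obtains y where "y \<in> limit_set" "norm (x - y) \<le> tail n" "base y = base x"
proof -
  obtain r where r: "base x \<in> K" "x $ 3 = partial_sum r n" "\<forall>j<n. (r j)\<^sup>2 = p j x"
    using assms by (auto simp: level_def root_sums_def)
  define q where "q j = (if j < n then r j else csqrt (p j x))" for j
  have q: "(q j)\<^sup>2 = p j x" for j using r by (simp add: q_def)
  have x3: "x $ 3 = partial_sum q n" using r by (simp add: q_def)
  let ?y = "base x + axis 3 (series q)"
  have "?y - x = axis 3 (series q - partial_sum q n)"
    using x3 by (simp add: vec_eq_iff base_nth axis_def)
  then have "norm (x - ?y) = norm (series q - partial_sum q n)"
    by (subst norm_minus_commute) simp
  also have "\<dots> \<le> tail n" using root_series(2)[OF r(1) q] .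
  finally have "norm (x - ?y) \<le> tail n" .
  moreover have "base ?y = base x" by (simp add: base_id base_nth)
  ultimately show ?thesis by (rule that[OF limit_setI[OF r(1) q]])
qed

text \<open>Two points that differ in the sign of a single late root are both close to v, and they are different
because that root is nonzero; so one of them is not v.\<close>

lemma limit_set_islimpt:
  assumes v: "v \<in> limit_set" and nz: "\<And>n. \<exists>m\<ge>n. p m v \<noteq> 0"
  shows "v islimpt limit_set"
  unfolding islimpt_approachable
proof (intro allI impI)
  fix e :: real assume "0 < e"
  have "\<forall>\<^sub>F n in sequentially. tail n < e / 2" using \<open>0 < e\<close> order_tendstoD(2)[OF tail_tendsto, of "e/2"] by simp
  then obtain n where n: "tail n < e / 2" by (auto simp: eventually_sequentially)
  obtain r where r: "base v \<in> K" "norm (v $ 3 - partial_sum r n) \<le> tail n" "\<forall>j<n. (r j)\<^sup>2 = p j v"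
    using v unfolding limit_set_def root_sums_def by blast
  obtain m where m: "m \<ge> n" "p m v \<noteq> 0" using nz by blast
  define q where "q j = (if j < n then r j else csqrt (p j v))" for j
  \<comment> \<open>Index m lies beyond n, so both sequences have the same n-th partial sum.\<close>
  define q' where "q' = q(m := - q m)"
  have q: "(q j)\<^sup>2 = p j v" and q': "(q' j)\<^sup>2 = p j v" for j using r by (auto simp: q_def q'_def)
  have close: "dist (base v + axis 3 (series f)) v < e"
    if f: "\<And>j. (f j)\<^sup>2 = p j v" "\<And>j. j < n \<Longrightarrow> f j = r j" for f
  proof -
    have eq: "partial_sum f n = partial_sum r n" using f by simp
    have "base v + axis 3 (series f) - v = axis 3 (series f - v $ 3)"
      by (simp add: vec_eq_iff base_nth axis_def)
    then have "dist (base v + axis 3 (series f)) v = norm (series f - v $ 3)"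
      by (simp add: dist_norm)
    also have "\<dots> \<le> norm (series f - partial_sum f n)
       + norm (partial_sum r n - v $ 3)"
      using norm_triangle_ineq[of "series f - partial_sum f n"
        "partial_sum r n - v $ 3"] eq by simp
    also have "\<dots> < e" using root_series(2)[OF r(1) f(1), of n] r(2) n by (simp add: norm_minus_commute)
    finally show ?thesis .
  qed
  have "series q \<noteq> series q'"
  proof
    assume eq: "series q = series q'"
    have "(\<lambda>j. of_real (c j) * q j - of_real (c j) * q' j) sums
        (series q - series q')"
      by (intro sums_diff summable_sums root_series(1)[OF r(1)] q q')
    moreover have "(\<lambda>j. of_real (c j) * q j - of_real (c j) * q' j) sums (of_real (c m) * q m - of_real (c m) * q' m)"
      by (rule sums_single[of m "\<lambda>j. of_real (c j) * q j - of_real (c j) * q' j", THEN sums_cong[THEN iffD1, rotated]])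
        (auto simp: q'_def)
    ultimately have "of_real (c m) * q m - of_real (c m) * q' m = 0"
      using eq sums_unique2 by fastforce
    then have "of_real (2 * c m) * q m = 0" by (auto simp: q'_def)
    then have "q m = 0" using c_pos[of m] by simp
    then show False using q[of m] m by simp
  qed
  then obtain f where f: "f = q \<or> f = q'" "series f \<noteq> v $ 3" by metis
  have fr: "(f j)\<^sup>2 = p j v" "j < n \<Longrightarrow> f j = r j" for j
    using f(1) q q' m(1) by (auto simp: q_def q'_def)
  have "base v + axis 3 (series f) \<noteq> v"
    using f(2) by (auto simp: vec_eq_iff base_nth axis_def)
  then show "\<exists>x'\<in>limit_set. x' \<noteq> v \<and> dist x' v < e"
    using limit_setI[OF r(1) fr(1)] close[OF fr] by blast
qed

lemma norm_root_sums: "base v \<in> K \<Longrightarrow> s \<in> root_sums c n v \<Longrightarrow> norm s \<le> suminf c"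
proof -
  assume v: "base v \<in> K" and "s \<in> root_sums c n v"
  then obtain r where r: "s = partial_sum r n" "\<forall>j<n. (r j)\<^sup>2 = p j v"
    by (auto simp: root_sums_def)
  have "norm s \<le> (\<Sum>j<n. c j)"
    unfolding r
  proof (rule sum_norm_le)
    fix j assume "j \<in> {..<n}"
    then have "norm (r j) \<le> 1" using root_bound[OF v] r by auto
    then show "norm (of_real (c j) * r j) \<le> c j"
      using c_pos[of j] mult_left_mono[of "norm (r j)" 1 "c j"] by (simp add: norm_mult)
  qed
  also have "\<dots> \<le> suminf c" using c_sum c_pos by (intro sum_le_suminf) (auto intro: less_imp_le)
  finally show "norm s \<le> suminf c" .
qed

lemma compact_level: "compact (level n)"
proof -
  have "level n = {x + axis 3 d | x d. x \<in> K \<and> norm d \<le> suminf c} \<inter> {v. root_poly c n v = 0}"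
  proof (intro equalityI subsetI IntI)
    fix v assume v: "v \<in> level n"
    then have "norm (v $ 3) \<le> suminf c" using norm_root_sums by (auto simp: level_def)
    then show "v \<in> {x + axis 3 d | x d. x \<in> K \<and> norm d \<le> suminf c}"
      using v base_plus_axis[of v] by (intro CollectI exI[of _ "base v"] exI[of _ "v $ 3"]) (auto simp: level_def)
    show "v \<in> {v. root_poly c n v = 0}" using v root_poly_zero by (auto simp: level_def)
  next
    fix v assume v: "v \<in> {x + axis 3 d | x d. x \<in> K \<and> norm d \<le> suminf c} \<inter> {v. root_poly c n v = 0}"
    then have "base v \<in> K" using K(3) base_id by auto
    moreover have "\<exists>s\<in>root_sums c n v. norm (v $ 3 - s) \<le> 0" using v by (intro root_poly_small) auto
    ultimately show "v \<in> level n" by (auto simp: level_def)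
  qed
  moreover have "closed {v. root_poly c n v = 0}"
    by (intro closed_Collect_eq continuous_on_root_poly continuous_on_const)
  ultimately show ?thesis
    using compact_vertical_thickening[OF K(1), of "suminf c"] by (simp add: compact_Int_closed)
qed

lemma limit_set_eq: "limit_set = (\<Inter>n. {x + axis 3 d | x d. x \<in> level n \<and> norm d \<le> tail n})"
proof -
  have "(\<exists>s\<in>root_sums c n v. norm (v $ 3 - s) \<le> tail n) \<and> base v \<in> K \<longleftrightarrow>
      v \<in> {x + axis 3 d | x d. x \<in> level n \<and> norm d \<le> tail n}" (is "?l \<longleftrightarrow> ?r") for v n
  proof
    assume ?l
    then obtain s where s: "s \<in> root_sums c n v" "norm (v $ 3 - s) \<le> tail n" "base v \<in> K" by blast
    have "base v + axis 3 s + axis 3 (v $ 3 - s) = v"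
      by (simp add: add.assoc axis_add_axis base_plus_axis)
    moreover have "base v + axis 3 s \<in> level n"
      using s by (simp add: level_def root_sums_base base_nth base_id)
    ultimately show ?r using s(2) by (intro CollectI exI[of _ "base v + axis 3 s"] exI[of _ "v $ 3 - s"]) auto
  next
    assume ?r
    then obtain x d where "v = x + axis 3 d" "x \<in> level n" "norm d \<le> tail n" by blast
    then show ?l by (auto simp: level_def intro!: bexI[of _ "x $ 3"])
  qed
  note thick = this
  show ?thesis
  proof (intro equalityI subsetI INT_I)
    fix v n assume "v \<in> limit_set"
    then show "v \<in> {x + axis 3 d | x d. x \<in> level n \<and> norm d \<le> tail n}"
      unfolding thick[symmetric] limit_set_def by blast
  next
    fix v assume "v \<in> (\<Inter>n. {x + axis 3 d | x d. x \<in> level n \<and> norm d \<le> tail n})"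
    then have "\<forall>n. (\<exists>s\<in>root_sums c n v. norm (v $ 3 - s) \<le> tail n) \<and> base v \<in> K"
      unfolding thick by blast
    then show "v \<in> limit_set" by (simp add: limit_set_def)
  qed
qed

lemma compact_limit_set: "compact limit_set"
  unfolding limit_set_eq
  by (rule compact_Inter) (auto intro: compact_vertical_thickening compact_level)

lemma limit_set_nonempty: "limit_set \<noteq> {}"
proof -
  obtain v where "v \<in> level 0" using K level_0 by blast
  then show ?thesis using level_near_limit_set by blast
qed

text \<open>Lifting y one root at a time gives points in the hulls of the levels. They converge, and the levels
approach the limit set uniformly, so the limit point is in its hull.\<close>

lemma in_hull_limit_set:
  assumes y: "in_hull K y" and py: "\<And>n. norm (p n y) \<le> 1"
  obtains z where "in_hull limit_set z" "base z = base y"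
proof -
  define good where "good n z \<longleftrightarrow> in_hull (level n) z \<and> (\<forall>m. p m z = p m y) \<and> base z = base y" for n z
  have "\<exists>f. \<forall>n. good n (f n) \<and> norm (f (Suc n) - f n) \<le> c n"
  proof (rule dependent_nat_choice)
    show "\<exists>x. good 0 x" using y by (auto simp: good_def level_0)
    fix x n assume x: "good n x"
    then obtain r where r: "r\<^sup>2 = p n x" "in_hull (level (Suc n)) (x + axis 3 (of_real (c n) * r))"
      using in_hull_root[OF p_poly, of "level n" x n 3 "of_real (c n)"] unfolding level_Suc good_def by blast
    have "norm (r\<^sup>2) \<le> 1" using r x py by (simp add: good_def)
    then have "norm r \<le> 1" by (simp add: norm_power abs_square_le_1)
    then have "norm (of_real (c n) * r) \<le> c n"
      using c_pos[of n] mult_left_mono[of "norm r" 1 "c n"] by (simp add: norm_mult)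
    then show "\<exists>z. good (Suc n) z \<and> norm (z - x) \<le> c n"
      using r x by (intro exI[of _ "x + axis 3 (of_real (c n) * r)"]) (auto simp: good_def p_shift)
  qed
  then obtain f where f: "\<And>n. good n (f n)" "\<And>n. norm (f (Suc n) - f n) \<le> c n" by blast
  have "summable (\<lambda>n. f (Suc n) - f n)"
    by (rule summable_comparison_test'[OF c_sum]) (rule f(2))
  then have "convergent (\<lambda>n. \<Sum>i<n. f (Suc i) - f i)" by (simp add: summable_iff_convergent)
  then have "convergent (\<lambda>n. f n - f 0)" by (simp add: sum_lessThan_telescope)
  then have "convergent (\<lambda>n. (f n - f 0) + f 0)" by (intro convergent_add convergent_const)
  then obtain z where z: "f \<longlonglongrightarrow> z" by (auto simp: convergent_def)
  show ?thesis
  proof (rule that)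
    have "(\<lambda>n. base (f n)) \<longlonglongrightarrow> base z"
    proof (rule vec_tendstoI)
      fix i show "(\<lambda>n. base (f n) $ i) \<longlonglongrightarrow> base z $ i"
        using tendsto_vec_nth[OF z, of i] by (simp add: base_nth)
    qed
    moreover have "base (f n) = base y" for n using f by (auto simp: good_def)
    ultimately show "base z = base y" using LIMSEQ_unique[OF _ tendsto_const] by auto
    show "in_hull limit_set z"
      unfolding in_hull_def
    proof (intro allI impI)
      fix P B assume P: "complex_polynomial P" and B: "\<forall>x\<in>limit_set. norm (P x) \<le> B"
      have PL: "(\<lambda>n. norm (P (f n))) \<longlonglongrightarrow> norm (P z)"
        using continuous_on_complex_polynomial[OF P, of UNIV] z
        by (intro tendsto_norm) (auto simp: continuous_on_eq_continuous_at isCont_tendsto_compose)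
      have "norm (P z) \<le> B + e" if "0 < e" for e
      proof -
        define D where "D = {x + y | x y. x \<in> limit_set \<and> y \<in> cball 0 (tail 0 + 1)}"
        have "compact D" unfolding D_def by (rule compact_sums[OF compact_limit_set compact_cball])
        then have "uniformly_continuous_on D P"
          using compact_uniformly_continuous continuous_on_complex_polynomial[OF P] by blast
        then obtain d where d: "d > 0" "\<And>x x'. x \<in> D \<Longrightarrow> x' \<in> D \<Longrightarrow> dist x' x < d \<Longrightarrow> dist (P x') (P x) < e"
          using \<open>0 < e\<close> unfolding uniformly_continuous_on_def by metis
        have "\<forall>\<^sub>F n in sequentially. tail n < min d 1"
          using order_tendstoD(2)[OF tail_tendsto, of "min d 1"] d by simp
        then have "\<forall>\<^sub>F n in sequentially. norm (P (f n)) \<le> B + e"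
        proof (rule eventually_mono)
          fix n assume n: "tail n < min d 1"
          have "in_hull (level n) (f n)" using f by (simp add: good_def)
          then show "norm (P (f n)) \<le> B + e"
          proof (rule in_hullD[OF _ P])
            fix x assume "x \<in> level n"
            then obtain w where w: "w \<in> limit_set" "norm (x - w) \<le> tail n" using level_near_limit_set by metis
            have "x \<in> D" unfolding D_def
              using w n tail_nonneg[of 0] by (intro CollectI exI[of _ w] exI[of _ "x - w"]) simp
            moreover have "w \<in> D" unfolding D_def
              using w n tail_nonneg[of 0] by (intro CollectI exI[of _ w] exI[of _ 0]) simp
            ultimately have "dist (P x) (P w) < e" using d(2)[of w x] w n by (simp add: dist_norm)
            then show "norm (P x) \<le> B + e"
              using bspec[OF B w(1)] norm_triangle_ineq2[of "P x" "P w"] by (simp add: dist_norm)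
          qed
        qed
        then show ?thesis using tendsto_upperbound[OF PL] by simp
      qed
      then show "norm (P z) \<le> B" by (rule field_le_epsilon)
    qed
  qed
qed

end

section \<open>Choice of branch points and coefficients\<close>

lemma coordinate_enumeration:
  obtains idx :: "nat \<Rightarrow> 3 \<times> complex" where "inj idx" "\<And>n. fst (idx n) \<in> {1, 2}"
    "\<And>i U N. i \<in> {1, 2} \<Longrightarrow> open U \<Longrightarrow> U \<noteq> {} \<Longrightarrow> \<exists>k\<ge>N. fst (idx k) = i \<and> snd (idx k) \<in> U"
proof -
  obtain D :: "complex set" where D: "countable D" "\<And>X. open X \<Longrightarrow> X \<noteq> {} \<Longrightarrow> \<exists>d\<in>D. d \<in> X"
    using countable_dense_exists by metis
  define S where "S = {1, 2 :: 3} \<times> D"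
  have "infinite D"
  proof
    assume "finite D"
    then have "open (- D)" by (intro open_Compl finite_imp_closed)
    moreover have "- D \<noteq> {}"
    proof
      assume "- D = {}"
      then have "D = UNIV" by blast
      then show False using \<open>finite D\<close> infinite_UNIV_char_0 by metis
    qed
    ultimately show False using D(2)[of "- D"] by blast
  qed
  then have S: "countable S" "infinite S"
    using D(1) by (auto simp: S_def finite_cartesian_product_iff)
  define idx where "idx = from_nat_into S"
  have bij: "bij_betw idx UNIV S" unfolding idx_def by (rule bij_betw_from_nat_into[OF S])
  show ?thesis
  proof (rule that[of idx])
    show "inj idx" using bij by (simp add: bij_betw_def)
    show "fst (idx n) \<in> {1, 2}" for n
    proof -
      have "idx n \<in> S" using bij by (auto simp: bij_betw_def)
      then show ?thesis by (auto simp: S_def)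
    qed
    fix i :: 3 and U :: "complex set" and N :: nat
    assume i: "i \<in> {1, 2}" and U: "open U" "U \<noteq> {}"
    show "\<exists>k\<ge>N. fst (idx k) = i \<and> snd (idx k) \<in> U"
    proof -
      let ?F = "(snd \<circ> idx) ` {..<N}"
      have "open (U - ?F)" using U by (intro open_Diff finite_imp_closed) auto
      moreover have "U - ?F \<noteq> {}"
      proof
        assume "U - ?F = {}"
        then have "finite U" by (intro finite_subset[of U ?F]) auto
        then show False using U finite_imp_not_open by blast
      qed
      ultimately obtain d where d: "d \<in> D" "d \<in> U - ?F" using D(2) by blast
      then have "(i, d) \<in> S" using i by (simp add: S_def)
      then obtain k where k: "idx k = (i, d)" using bij by (metis bij_betw_imp_surj_on imageE)
      then have "k \<ge> N" using d(2) by (force simp: not_less[symmetric])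
      then show ?thesis using k d by (intro exI[of _ k]) auto
    qed
  qed
qed

text \<open>Each term has to be small compared with bounds H m c that were fixed by the terms before m, for all
m up to the current index, with geometrically decreasing shares of each bound.\<close>

lemma choose_sequence:
  fixes H :: "nat \<Rightarrow> (nat \<Rightarrow> real) \<Rightarrow> real"
  assumes pos: "\<And>n c. (\<And>j. j < n \<Longrightarrow> 0 < c j) \<Longrightarrow> 0 < H n c"
    and cong: "\<And>n c d. (\<And>j. j < n \<Longrightarrow> c j = d j) \<Longrightarrow> H n c = H n d"
  obtains c where "\<And>n. 0 < c n" "summable c" "\<And>n. (\<Sum>j. c (j + n)) \<le> H n c"
proof -
  define V where "V n f = Min ((\<lambda>m. H m f * (1/2) ^ (n + 1 - m)) ` {..n})" for n f
  define F where "F = rec_nat (\<lambda>j. 0 :: real) (\<lambda>n f. f(n := V n f))"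
  have F: "F (Suc n) = (F n)(n := V n (F n))" for n by (simp add: F_def)
  define c where "c n = F (Suc n) n" for n
  have Fc: "F n j = c j" if "j < n" for n j
    using that
  proof (induction n)
    case (Suc n)
    show ?case
    proof (cases "j = n")
      case False
      then show ?thesis using Suc by (simp add: F)
    qed (simp add: c_def)
  qed simp
  \<comment> \<open>F n agrees with c below n, which is all that the bounds up to index n can see.\<close>
  have HF: "H m (F n) = H m c" if "m \<le> n" for m n
    by (rule cong) (use Fc that in simp)
  have cV: "c n = Min ((\<lambda>m. H m c * (1/2) ^ (n + 1 - m)) ` {..n})" for n
  proof -
    have "c n = V n (F n)" by (simp add: c_def F)
    also have "\<dots> = Min ((\<lambda>m. H m c * (1/2) ^ (n + 1 - m)) ` {..n})"
      unfolding V_def by (intro arg_cong[where f = Min] image_cong refl) (simp add: HF)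
    finally show ?thesis .
  qed
  have cpos: "0 < c n" for n
  proof (induction n rule: less_induct)
    case (less n)
    have *: "0 < H m c * (1/2) ^ (n + 1 - m)" if "m \<le> n" for m
    proof (rule mult_pos_pos)
      show "0 < H m c" by (rule pos) (use less that in simp)
    qed simp
    have "c n \<in> (\<lambda>m. H m c * (1/2) ^ (n + 1 - m)) ` {..n}"
      unfolding cV[of n] by (rule Min_in) auto
    then show ?case using * by auto
  qed
  have le: "c n \<le> H m c * (1/2) ^ (n + 1 - m)" if "m \<le> n" for m n
    unfolding cV[of n] using that by (intro Min_le) auto
  have Hpos: "0 < H n c" for n by (rule pos) (rule cpos)
  have sm: "summable (\<lambda>j. H n c * (1/2) ^ (j + 1))" for n
    using summable_mult[OF summable_mult[OF summable_geometric[of "1/2 :: real"], of "1/2"], of "H n c"]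
    by simp
  have le': "c (j + n) \<le> H n c * (1/2) ^ (j + 1)" for j n
    using le[of n "j + n"] by simp
  have "summable c"
    by (rule summable_comparison_test'[OF sm[of 0]]) (use le'[of _ 0] cpos in \<open>simp add: less_imp_le\<close>)
  moreover have "(\<Sum>j. c (j + n)) \<le> H n c" for n
  proof -
    have "(\<Sum>j. c (j + n)) \<le> (\<Sum>j. H n c * (1/2) ^ (j + 1))"
      by (rule suminf_le[OF le']) (use sm \<open>summable c\<close> in \<open>auto simp: summable_iff_shift\<close>)
    also have "\<dots> = H n c"
    proof -
      have "(\<lambda>j. (1/2) ^ (Suc j)) sums (1 :: real)" by (rule power_half_series)
      then have "(\<lambda>j. H n c * (1/2) ^ (j + 1)) sums (H n c * 1)"
        using sums_mult[of "\<lambda>j. (1/2) ^ (Suc j)" 1 "H n c"] by simp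
      then show ?thesis by (simp add: sums_iff)
    qed
    finally show ?thesis .
  qed
  ultimately show ?thesis using that cpos by blast
qed

text \<open>The distances from x to the points of T fill an interval, whose length is at most the total length of
2^n intervals of length 2 / 4^n.\<close>

lemma thin_connected_singleton:
  fixes T :: "complex set"
  assumes T: "connected T" and cover: "\<And>n. \<exists>S. finite S \<and> card S \<le> 2 ^ n \<and> (\<forall>w\<in>T. \<exists>s\<in>S. norm (w - s) \<le> (1/4) ^ n)"
    and xy: "x \<in> T" "y \<in> T"
  shows "x = y"
proof -
  define d where "d = dist x y"
  have ivl: "{0..d} \<subseteq> dist x ` T"
  proof -
    have "connected (dist x ` T)"
      using T by (intro connected_continuous_image) (auto intro!: continuous_intros)
    then show ?thesis using xy by (intro connected_contains_Icc) (auto simp: d_def intro: image_eqI[of _ _ x])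
  qed
  have "d \<le> 2 * (1/2) ^ n" for n
  proof -
    obtain S where S: "finite S" "card S \<le> 2 ^ n" "\<forall>w\<in>T. \<exists>s\<in>S. norm (w - s) \<le> (1/4) ^ n" using cover by blast
    let ?I = "\<lambda>s. {dist x s - (1/4) ^ n .. dist x s + (1/4) ^ n}"
    have "{0..d} \<subseteq> (\<Union>s\<in>S. ?I s)"
    proof
      fix t assume "t \<in> {0..d}"
      then obtain w where w: "w \<in> T" "t = dist x w" using ivl by blast
      then obtain s where "s \<in> S" "norm (w - s) \<le> (1/4) ^ n" using S by blast
      moreover have "\<bar>dist x w - dist x s\<bar> \<le> dist w s"
        using abs_dist_diff_le[of w x s] by (simp add: dist_commute)
      ultimately have "t \<in> ?I s" using w by (auto simp: dist_norm abs_le_iff)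
      then show "t \<in> (\<Union>s\<in>S. ?I s)" using \<open>s \<in> S\<close> by blast
    qed
    then have "emeasure lborel {0..d} \<le> emeasure lborel (\<Union>s\<in>S. ?I s)"
      using S(1) by (intro emeasure_mono sets.finite_UN) auto
    also have "\<dots> \<le> (\<Sum>s\<in>S. emeasure lborel (?I s))"
      using S(1) by (intro emeasure_subadditive_finite) auto
    also have "\<dots> = ennreal (\<Sum>s\<in>S. 2 * (1/4) ^ n)" by (subst sum_ennreal[symmetric]) simp_all
    finally have "ennreal d \<le> ennreal (real (card S) * (2 * (1/4) ^ n))" by (simp add: d_def)
    then have "d \<le> real (card S) * (2 * (1/4) ^ n)" by (subst (asm) ennreal_le_iff) auto
    also have "\<dots> \<le> 2 ^ n * (2 * (1/4) ^ n)"
    proof (rule mult_right_mono)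
      have "real (card S) \<le> real (2 ^ n)" using S(2) by (rule of_nat_mono)
      then show "real (card S) \<le> 2 ^ n" by simp
    qed simp
    also have "\<dots> = 2 * (1/2) ^ n"
      by (simp add: power_divide field_simps flip: power_mult_distrib)
    finally show ?thesis .
  qed
  then have "\<exists>N. \<forall>n\<ge>N. d \<le> 2 * (1/2) ^ n" by blast
  moreover have "(\<lambda>n. 2 * (1/2 :: real) ^ n) \<longlonglongrightarrow> 2 * 0"
    by (intro tendsto_intros LIMSEQ_power_zero) simp
  ultimately have "d \<le> 2 * 0" by (rule LIMSEQ_le_const[rotated])
  then show ?thesis by (simp add: d_def)
qed

definition other :: "3 \<Rightarrow> 3" where "other i = (if i = 1 then 2 else 1)"

locale coordinate_tower =
  fixes idx :: "nat \<Rightarrow> 3 \<times> complex" and R :: real and K :: "(complex ^ 3) set"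
  assumes inj: "inj idx" and idx12: "\<And>n. fst (idx n) \<in> {1, 2}"
    and dense: "\<And>i U N. i \<in> {1, 2} \<Longrightarrow> open U \<Longrightarrow> U \<noteq> {} \<Longrightarrow> \<exists>k\<ge>N. fst (idx k) = i \<and> snd (idx k) \<in> U"
    and R: "1 \<le> R" and K: "compact K" "K \<noteq> {}" "\<And>v. v \<in> K \<Longrightarrow> v $ 3 = 0"
    and KR: "\<And>v l. v \<in> K \<Longrightarrow> norm (v $ l) \<le> R"
begin

definition scale :: "nat \<Rightarrow> real" where "scale n = 1 / (R + norm (snd (idx n)))"

definition p :: "nat \<Rightarrow> complex ^ 3 \<Rightarrow> complex" where
  "p n v = of_real (scale n) * (v $ fst (idx n) - snd (idx n))"

lemma scale_pos: "0 < scale n"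
  using R by (simp add: scale_def add_pos_nonneg)

lemma p_le_1: "(\<And>l. norm (v $ l) \<le> R) \<Longrightarrow> norm (p n v) \<le> 1"
proof -
  assume v: "\<And>l. norm (v $ l) \<le> R"
  have "norm (v $ fst (idx n) - snd (idx n)) \<le> R + norm (snd (idx n))"
    using norm_triangle_ineq4[of "v $ fst (idx n)" "snd (idx n)"] v[of "fst (idx n)"] by linarith
  moreover have "0 < R + norm (snd (idx n))" using R norm_ge_zero[of "snd (idx n)"] by linarith
  ultimately have "scale n * norm (v $ fst (idx n) - snd (idx n)) \<le> 1"
    by (simp add: scale_def divide_le_eq)
  then show "norm (p n v) \<le> 1"
    using scale_pos[of n] by (simp add: p_def norm_mult)
qed

sublocale root_tower p
proof
  show "complex_polynomial (p n)" for n
    unfolding p_def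
    by (intro complex_polynomial_mult complex_polynomial_diff complex_polynomial_const complex_polynomial_coord)
  have "fst (idx n) \<noteq> 3" for n using idx12[of n] by auto
  then show "p n (v + axis 3 a) = p n v" for n v a by (simp add: p_def axis_def)
qed

lemma p_eq_0: "p n v = 0 \<longleftrightarrow> v $ fst (idx n) = snd (idx n)"
  using scale_pos[of n] by (auto simp: p_def)

lemma p_nonzero_beyond: "\<exists>m\<ge>n. p m v \<noteq> 0"
proof (rule ccontr)
  assume "\<not> ?thesis"
  then have z: "idx m = (fst (idx m), v $ fst (idx m))" if "m \<ge> n" for m
    using that p_eq_0[of m v] by (metis prod.collapse)
  then have "idx ` {n..n+2} \<subseteq> {(1, v $ 1), (2, v $ 2)}"
  proof (intro image_subsetI)
    fix m assume "m \<in> {n..n+2}"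
    then show "idx m \<in> {(1, v $ 1), (2, v $ 2)}" using z[of m] idx12[of m] by auto
  qed
  then have "card (idx ` {n..n+2}) \<le> card {(1 :: 3, v $ 1), (2, v $ 2)}" by (intro card_mono) auto
  also have "\<dots> \<le> 2" by (simp add: card_insert_if)
  finally show False using card_image[OF inj_on_subset[OF inj subset_UNIV], of "{n..n+2}"] by simp
qed

text \<open>The coefficients decrease so fast that two roots branching at the same point, with derivatives
bounded as in a normalized disc, cannot cancel: the derivatives of c_k^2 p_k and c_j^2 p_j along the disc
have different absolute values.\<close>

definition ratio_ok :: "(nat \<Rightarrow> real) \<Rightarrow> nat \<Rightarrow> bool" where
  "ratio_ok c k \<longleftrightarrow> 0 < c k \<and> (\<forall>j<k. (c k)\<^sup>2 * scale k * (real k + 1)\<^sup>2 < (c j)\<^sup>2 * scale j)"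

abbreviation disc_at :: "nat \<Rightarrow> bool \<Rightarrow> (complex \<Rightarrow> complex ^ 3) \<Rightarrow> bool" where
  "disc_at k flat \<equiv> normalized_disc flat (fst (idx k)) (other (fst (idx k))) (snd (idx k)) (1 / (real k + 1)) R"

text \<open>At the centre of the disc p k has a simple zero. No other p j in the same coordinate vanishes there, and
in the other coordinate at most one does. If that coordinate is constant along the disc, the
corresponding p j vanishes identically and has the root 0; otherwise its zero is simple.\<close>

lemma no_disc_in_level:
  assumes c: "ratio_ok c k" and \<sigma>: "disc_at k flat \<sigma>"
  shows "\<exists>z\<in>ball 0 1. root_poly c (Suc k) (\<sigma> z) \<noteq> 0"
proof (rule ccontr)
  assume "\<not> ?thesis"
  then have zero: "root_poly c (Suc k) (\<sigma> z) = 0" if "z \<in> ball 0 1" for z using that by blast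
  let ?i = "fst (idx k)" and ?i' = "other (fst (idx k))" and ?a = "snd (idx k)"
  define P where "P j z = p j (\<sigma> z)" for j z
  define N where "N = {j. j < k \<and> P j 0 = 0 \<and> \<not> (\<forall>z\<in>ball 0 1. P j z = 0)}"
  have hol: "(\<lambda>z. \<sigma> z $ l) holomorphic_on ball 0 1" for l using \<sigma> by (simp add: normalized_disc_def)
  define u' where "u' l = deriv (\<lambda>z. \<sigma> z $ l) 0" for l
  have der: "((\<lambda>z. \<sigma> z $ l) has_field_derivative u' l) (at 0)" for l
    unfolding u'_def by (rule holomorphic_derivI[OF hol open_ball]) simp
  have Pder: "(P j has_field_derivative of_real (scale j) * u' (fst (idx j))) (at 0)" for j
    unfolding P_def p_def by (rule DERIV_cmult) (rule DERIV_cong[OF DERIV_diff[OF der DERIV_const]], simp)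
  have \<sigma>a: "\<sigma> 0 $ ?i = ?a" and u'1: "1 / (real k + 1) \<le> norm (u' ?i)" "norm (u' ?i) \<le> real k + 1"
    using \<sigma> by (auto simp: normalized_disc_def u'_def)
  have N': "idx j = (?i', \<sigma> 0 $ ?i')" if "j \<in> N" for j
  proof -
    have j: "j < k" "\<sigma> 0 $ fst (idx j) = snd (idx j)" using that by (auto simp: N_def P_def p_eq_0)
    have "fst (idx j) \<noteq> ?i"
    proof
      assume eq: "fst (idx j) = ?i"
      then have "idx j = idx k" using j \<sigma>a by (simp add: prod_eq_iff)
      then show False using j inj by (auto dest: injD)
    qed
    then have "fst (idx j) = ?i'" using idx12[of j] idx12[of k] by (auto simp: other_def)
    then show ?thesis using j by (simp add: prod_eq_iff)
  qed
  show False
  proof (rule root_sum_contradiction[where P = P and c = c and k = k and N = N and g = "\<lambda>z. \<sigma> z $ 3"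
        and a = "of_real (scale k) * u' ?i" and b = "\<lambda>j. of_real (scale j) * u' (fst (idx j))"])
    show "(\<lambda>z. \<sigma> z $ 3) field_differentiable at 0" using der[of 3] by (auto simp: field_differentiable_def)
    show "\<exists>r. (\<forall>j<Suc k. (r j)\<^sup>2 = P j z) \<and> \<sigma> z $ 3 = (\<Sum>j<Suc k. of_real (c j) * r j)"
      if z: "z \<in> ball 0 1" for z
    proof -
      have "\<exists>s\<in>root_sums c (Suc k) (\<sigma> z). norm (\<sigma> z $ 3 - s) \<le> 0"
        using zero[OF z] by (intro root_poly_small) auto
      then have "\<sigma> z $ 3 \<in> root_sums c (Suc k) (\<sigma> z)" by auto
      then show ?thesis unfolding root_sums_def P_def by blast
    qed
    show "N \<subseteq> {..<k}" by (auto simp: N_def)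
    then have "finite N" by (rule finite_subset) simp
    moreover have "\<forall>x\<in>N. \<forall>y\<in>N. x = y"
      using N' inj by (metis injD)
    ultimately show "card N \<le> 1" by (metis One_nat_def card_le_Suc0_iff_eq)
    show "\<exists>h. (\<forall>z\<in>ball 0 1. (h z)\<^sup>2 = P j z) \<and> h field_differentiable at 0" if "j < k" "j \<notin> N" for j
    proof (cases "P j 0 = 0")
      case True
      then have "\<forall>z\<in>ball 0 1. P j z = 0" using that by (auto simp: N_def)
      then show ?thesis by (intro exI[of _ "\<lambda>_. 0"]) auto
    next
      case False
      have "P j field_differentiable at 0" using Pder by (auto simp: field_differentiable_def)
      then show ?thesis using differentiable_root[of "P j"] False by metis
    qed
    show "(P k has_field_derivative of_real (scale k) * u' ?i) (at 0)" by (rule Pder)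
    show "P k 0 = 0" using \<sigma>a by (simp add: P_def p_eq_0)
    have "0 < 1 / (real k + 1)" by simp
    then have "u' ?i \<noteq> 0" using u'1(1) by (metis norm_zero not_le)
    then show "of_real (scale k) * u' ?i \<noteq> 0" using scale_pos[of k] by simp
    show "c k \<noteq> 0" using c by (auto simp: ratio_ok_def)
    fix j assume j: "j \<in> N"
    have ij: "fst (idx j) = ?i'" using N'[OF j] by simp
    have jk: "j < k" using j by (simp add: N_def)
    have "\<not> flat"
    proof
      assume flat
      then have const: "\<sigma> z $ ?i' = \<sigma> 0 $ ?i'" if "z \<in> ball 0 1" for z
        using \<sigma> that unfolding normalized_disc_def if_P[OF \<open>flat\<close>] by blast
      have "P j z = 0" if "z \<in> ball 0 1" for z
      proof -
        have "P j 0 = 0" using j by (simp add: N_def)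
        then show ?thesis using const[OF that] ij by (simp add: P_def p_eq_0)
      qed
      then show False using j by (simp add: N_def)
    qed
    then have u'2: "1 / (real k + 1) \<le> norm (u' ?i')" using \<sigma> by (simp add: normalized_disc_def u'_def)
    have "norm ((of_real (c k))\<^sup>2 * (of_real (scale k) * u' ?i)) = (c k)\<^sup>2 * scale k * norm (u' ?i)"
      using scale_pos[of k] by (simp add: norm_mult norm_power)
    also have "\<dots> \<le> (c k)\<^sup>2 * scale k * (real k + 1)"
      using u'1(2) scale_pos[of k] by (intro mult_left_mono) auto
    also have "\<dots> = ((c k)\<^sup>2 * scale k * (real k + 1)\<^sup>2) / (real k + 1)" by (simp add: power2_eq_square)
    also have "\<dots> < ((c j)\<^sup>2 * scale j) / (real k + 1)"
      using c jk by (intro divide_strict_right_mono) (auto simp: ratio_ok_def)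
    also have "\<dots> = (c j)\<^sup>2 * scale j * (1 / (real k + 1))" by simp
    also have "\<dots> \<le> (c j)\<^sup>2 * scale j * norm (u' ?i')"
      using u'2 scale_pos[of j] by (intro mult_left_mono) auto
    also have "\<dots> = norm ((of_real (c j))\<^sup>2 * (of_real (scale j) * u' (fst (idx j))))"
      using scale_pos[of j] ij by (simp add: norm_mult norm_power)
    finally show "(P j has_field_derivative of_real (scale j) * u' (fst (idx j))) (at 0) \<and> P j 0 = 0 \<and>
        (of_real (c k))\<^sup>2 * (of_real (scale k) * u' ?i) \<noteq> (of_real (c j))\<^sup>2 * (of_real (scale j) * u' (fst (idx j)))"
      using Pder j by (auto simp: N_def)
  qed
qed

text \<open>The second bound makes the fibres of the hull thin, the third condition excludes the discs that branch
at the last index below n.\<close>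

definition separating :: "nat \<Rightarrow> (nat \<Rightarrow> real) \<Rightarrow> real \<Rightarrow> bool" where
  "separating n c \<kappa> \<longleftrightarrow> 0 < \<kappa> \<and> \<kappa> \<le> ((1/4) ^ n) ^ (2 ^ n) \<and>
     (\<forall>k flat \<sigma>. n = Suc k \<longrightarrow> ratio_ok c k \<longrightarrow> disc_at k flat \<sigma> \<longrightarrow> (\<exists>z\<in>ball 0 1. \<kappa> < norm (root_poly c n (\<sigma> z))))"

lemma separating_exists: "\<exists>\<kappa>. separating n c \<kappa>"
proof (cases "\<exists>k. n = Suc k \<and> ratio_ok c k")
  case True
  then obtain k where k: "n = Suc k" "ratio_ok c k" by blast
  have "\<exists>\<kappa>>0. \<forall>\<sigma>. disc_at k flat \<sigma> \<longrightarrow> (\<exists>z\<in>ball 0 1. \<kappa> < norm (root_poly c n (\<sigma> z)))" for flat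
    unfolding k(1) by (rule no_disc_near_zero_set[OF continuous_on_root_poly]) (rule no_disc_in_level[OF k(2)])
  then obtain \<kappa> where \<kappa>: "\<And>flat. 0 < \<kappa> flat"
    "\<And>flat \<sigma>. disc_at k flat \<sigma> \<Longrightarrow> \<exists>z\<in>ball 0 1. \<kappa> flat < norm (root_poly c n (\<sigma> z))" by metis
  define \<mu> where "\<mu> = min (min (\<kappa> True) (\<kappa> False)) (((1/4) ^ n) ^ (2 ^ n))"
  have "\<mu> \<le> \<kappa> flat" for flat by (cases flat) (auto simp: \<mu>_def)
  then have "\<exists>z\<in>ball 0 1. \<mu> < norm (root_poly c n (\<sigma> z))" if "disc_at k flat \<sigma>" for flat \<sigma>
    using \<kappa>(2)[OF that] by (meson order_le_less_trans)
  moreover have "0 < \<mu>" using \<kappa>(1) by (simp add: \<mu>_def)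
  ultimately have "separating n c \<mu>" unfolding separating_def using k by (auto simp: \<mu>_def)
  then show ?thesis by blast
next
  case False
  then show ?thesis by (intro exI[of _ "((1/4) ^ n) ^ (2 ^ n)"]) (auto simp: separating_def)
qed

text \<open>A bound for the tail of the series from index n on, and thereby for c n, that depends only on the
coefficients before n.\<close>

definition admissible :: "nat \<Rightarrow> (nat \<Rightarrow> real) \<Rightarrow> real \<Rightarrow> bool" where
  "admissible n c \<eta> \<longleftrightarrow> 0 < \<eta> \<and> \<eta> \<le> 1 \<and>
     (\<forall>j<n. \<eta>\<^sup>2 * scale n * (real n + 1)\<^sup>2 < (c j)\<^sup>2 * scale j) \<and>
     (\<exists>\<kappa>. separating n c \<kappa> \<and> (\<forall>x d. base x \<in> K \<longrightarrow> x $ 3 \<in> root_sums c n x \<longrightarrow> norm d \<le> \<eta> \<longrightarrow>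
        norm (root_poly c n (x + axis 3 d)) \<le> \<kappa>))"

lemma admissible_cong:
  assumes "\<And>j. j < n \<Longrightarrow> c j = d j"
  shows "admissible n c = admissible n d"
proof -
  have 1: "root_poly c n = root_poly d n" "root_sums c n = root_sums d n"
    by (intro ext root_poly_cong root_sums_cong assms; assumption)+
  have 2: "ratio_ok c k = ratio_ok d k" if "n = Suc k" for k
    using assms that by (simp add: ratio_ok_def)
  have "separating n c \<kappa> = separating n d \<kappa>" for \<kappa>
    unfolding separating_def 1 using 2 by metis
  then show ?thesis
    unfolding admissible_def[abs_def] 1 using assms by (intro ext) auto
qed

lemma root_tower_over: "(\<And>n. 0 < c n) \<Longrightarrow> summable c \<Longrightarrow> root_tower_over p K c"
  by unfold_locales (use K KR p_le_1 in auto)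

text \<open>Only the values c j with j < n matter, so they may be continued by a geometric series; uniform
continuity of root_poly near its zero set, the compact n-th level, gives the bound.\<close>

lemma admissible_exists:
  assumes c: "\<And>j. j < n \<Longrightarrow> 0 < c j"
  shows "\<exists>\<eta>. admissible n c \<eta>"
proof -
  define d where "d j = (if j < n then c j else (1/2) ^ j)" for j
  have dpos: "0 < d j" for j using c by (simp add: d_def)
  have "summable d"
  proof -
    have "summable (\<lambda>j. (1/2 :: real) ^ j)" by (rule summable_geometric) simp
    moreover have "\<forall>\<^sub>F j in sequentially. d j = (1/2) ^ j"
      by (rule eventually_mono[OF eventually_ge_at_top[of n]]) (simp add: d_def)
    ultimately show ?thesis using summable_cong by fastforce
  qed
  then interpret T: root_tower_over p K d by (rule root_tower_over[OF dpos])
  obtain \<kappa> where \<kappa>: "separating n d \<kappa>" using separating_exists by blast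
  then have k0: "0 < \<kappa>" by (simp add: separating_def)
  define D where "D = {x + axis 3 e | x e. x \<in> T.level n \<and> norm (e::complex) \<le> 1}"
  have "compact D" unfolding D_def by (rule compact_vertical_thickening[OF T.compact_level])
  then have "uniformly_continuous_on D (root_poly d n)"
    by (intro compact_uniformly_continuous continuous_on_root_poly)
  then obtain \<delta> where \<delta>: "0 < \<delta>" "\<And>x x'. x \<in> D \<Longrightarrow> x' \<in> D \<Longrightarrow> dist x' x < \<delta> \<Longrightarrow>
      dist (root_poly d n x') (root_poly d n x) < \<kappa>"
    using k0 unfolding uniformly_continuous_on_def by metis
  define \<mu> where "\<mu> = Min (insert 1 ((\<lambda>j. (d j)\<^sup>2 * scale j) ` {..<n}))"
  have \<mu>: "0 < \<mu>" "\<And>j. j < n \<Longrightarrow> \<mu> \<le> (d j)\<^sup>2 * scale j"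
  proof -
    have "0 < (d j)\<^sup>2 * scale j" for j using dpos[of j] scale_pos[of j] by simp
    then show "0 < \<mu>" "\<And>j. j < n \<Longrightarrow> \<mu> \<le> (d j)\<^sup>2 * scale j" by (auto simp: \<mu>_def)
  qed
  define A where "A = scale n * (real n + 1)\<^sup>2"
  have A: "0 < A" using scale_pos by (simp add: A_def)
  \<comment> \<open>The three entries serve the normalisation, uniform continuity and the ratio condition.\<close>
  define \<eta> where "\<eta> = Min {1, \<delta> / 2, \<mu> / (2 * A)}"
  have \<eta>: "0 < \<eta>" "\<eta> \<le> 1" "\<eta> \<le> \<delta> / 2" "\<eta> \<le> \<mu> / (2 * A)"
    using \<delta> \<mu> A by (auto simp: \<eta>_def)
  have "admissible n d \<eta>"
    unfolding admissible_def
  proof (intro conjI allI impI exI[of _ \<kappa>])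
    show "0 < \<eta>" "\<eta> \<le> 1" "separating n d \<kappa>" using \<eta> \<kappa> by auto
    show "\<eta>\<^sup>2 * scale n * (real n + 1)\<^sup>2 < (d j)\<^sup>2 * scale j" if "j < n" for j
    proof -
      have "\<eta>\<^sup>2 * A \<le> \<eta> * A" using \<eta> A by (intro mult_right_mono) (auto simp: power2_eq_square mult_left_le)
      also have "\<dots> \<le> \<mu> / 2" using \<eta>(4) A by (simp add: field_simps)
      also have "\<dots> < \<mu>" using \<mu> by simp
      also have "\<dots> \<le> (d j)\<^sup>2 * scale j" by (rule \<mu>(2)[OF that])
      finally show ?thesis by (simp add: A_def mult.assoc)
    qed
    fix x e assume x: "base x \<in> K" "x $ 3 \<in> root_sums d n x" and e: "norm (e::complex) \<le> \<eta>"
    have xl: "x \<in> T.level n" using x by (simp add: T.level_def)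
    have "x \<in> D" unfolding D_def using xl by (intro CollectI exI[of _ x] exI[of _ 0]) (simp add: vec_eq_iff axis_def)
    moreover have "x + axis 3 e \<in> D" unfolding D_def using xl e \<eta> by (intro CollectI exI[of _ x] exI[of _ e]) auto
    moreover have "dist (x + axis 3 e) x < \<delta>" using e \<eta> \<delta> by (simp add: dist_norm)
    ultimately have "dist (root_poly d n (x + axis 3 e)) (root_poly d n x) < \<kappa>" by (intro \<delta>(2))
    then show "norm (root_poly d n (x + axis 3 e)) \<le> \<kappa>" using root_poly_zero[OF x(2)] by simp
  qed
  moreover have "admissible n d = admissible n c" by (rule admissible_cong) (simp add: d_def)
  ultimately show ?thesis by auto
qed

lemma coefficients_exist:
  obtains c \<eta> where "\<And>n. 0 < c n" "summable c" "\<And>n. (\<Sum>j. c (j + n)) \<le> \<eta> n" "\<And>n. admissible n c (\<eta> n)"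
proof -
  define H where "H n c = (SOME \<eta>. admissible n c \<eta>)" for n c
  have H: "admissible n c (H n c)" if "\<And>j. j < n \<Longrightarrow> 0 < c j" for n c
    unfolding H_def using admissible_exists[OF that] by (rule someI_ex)
  have pos: "0 < H n c" if "\<And>j. j < n \<Longrightarrow> 0 < c j" for n c
    using H[OF that] by (simp add: admissible_def)
  have cong: "H n c = H n d" if "\<And>j. j < n \<Longrightarrow> c j = d j" for n c d
    using admissible_cong[of n c d, OF that] by (simp add: H_def)
  show ?thesis
  proof (rule choose_sequence[of H, OF pos cong])
    fix c assume c: "\<And>n. 0 < c n" "summable c" "\<And>n. (\<Sum>j. c (j + n)) \<le> H n c"
    show ?thesis by (rule that[of c "\<lambda>n. H n c"]) (use c H in simp_all)
  qed
qed

end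

lemma nonconstant_deriv:
  fixes u :: "complex \<Rightarrow> complex"
  assumes u: "u holomorphic_on ball 0 1" and nc: "\<exists>z\<in>ball 0 1. u z \<noteq> u 0"
  shows "\<exists>z\<in>ball 0 1. deriv u z \<noteq> 0"
proof (rule ccontr)
  assume "\<not> ?thesis"
  then have "(u has_field_derivative 0) (at z within ball 0 1)" if "z \<in> ball 0 1" for z
    using holomorphic_derivI[OF u open_ball that] that by (metis has_field_derivative_at_within)
  then obtain c where "\<And>z. z \<in> ball 0 1 \<Longrightarrow> u z = c"
    using has_field_derivative_zero_constant[of "ball 0 1" u] by auto
  then show False using nc by (metis centre_in_ball zero_less_one)
qed

text \<open>If neither u nor v is constant, the zeros of their derivatives are isolated, so both derivatives are
bounded away from zero on some small disc.\<close>

lemma nonvanishing_derivatives: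
  fixes u v :: "complex \<Rightarrow> complex"
  assumes u: "u holomorphic_on ball 0 1" "\<exists>z\<in>ball 0 1. u z \<noteq> u 0" and v: "v holomorphic_on ball 0 1"
  obtains \<zeta> \<rho> m M where "0 < \<rho>" "0 < m" "ball \<zeta> (2 * \<rho>) \<subseteq> ball 0 1"
    "\<And>z. z \<in> ball \<zeta> (2 * \<rho>) \<Longrightarrow> m \<le> norm (deriv u z) \<and> norm (deriv u z) \<le> M \<and>
        ((\<forall>z\<in>ball 0 1. v z = v 0) \<or> m \<le> norm (deriv v z))"
proof -
  have du: "deriv u holomorphic_on ball 0 1" and dv: "deriv v holomorphic_on ball 0 1"
    using u v by (auto intro: holomorphic_deriv)
  have cont: "(f \<longlongrightarrow> f z) (nhds z)" if "f holomorphic_on ball 0 1" "z \<in> ball 0 1" for f :: "complex \<Rightarrow> complex" and z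
    using holomorphic_on_imp_continuous_on[OF that(1)] that(2)
    by (simp add: continuous_on_eq_continuous_at isCont_def tendsto_at_iff_tendsto_nhds)
  let ?flat = "\<forall>z\<in>ball 0 1. v z = v 0"
  obtain \<zeta> where \<zeta>: "\<zeta> \<in> ball 0 1" "deriv u \<zeta> \<noteq> 0" "?flat \<or> deriv v \<zeta> \<noteq> 0"
  proof -
    obtain z1 where z1: "z1 \<in> ball 0 1" "deriv u z1 \<noteq> 0" using nonconstant_deriv[OF u] by blast
    show ?thesis
    proof (cases ?flat)
      case True then show ?thesis using that z1 by blast
    next
      case False
      then obtain z2 where z2: "z2 \<in> ball 0 1" "deriv v z2 \<noteq> 0" using nonconstant_deriv[OF v] by blast
      have "\<exists>z\<in>ball 0 1. deriv u z \<noteq> 0 \<and> deriv v z \<noteq> 0"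
      proof (rule ccontr)
        assume no: "\<not> ?thesis"
        have "\<forall>\<^sub>F z in nhds z1. deriv u z \<noteq> 0 \<and> z \<in> ball 0 1"
          using tendsto_imp_eventually_ne[OF cont[OF du z1(1)] z1(2)] eventually_nhds_in_open[OF open_ball z1(1)]
          by (rule eventually_conj)
        then obtain S where S: "open S" "z1 \<in> S" "\<forall>z\<in>S. deriv u z \<noteq> 0 \<and> z \<in> ball 0 1"
          unfolding eventually_nhds by blast
        have "deriv v z2 = (\<lambda>_. 0) z2"
          by (rule analytic_continuation_open[of S "ball 0 1" "deriv v" "\<lambda>_. 0"]) (use S no z2 dv in auto)
        then show False using z2 by simp
      qed
      then show ?thesis using that by blast
    qed
  qed
  define m where "m = min (norm (deriv u \<zeta>) / 2) (if ?flat then 1 else norm (deriv v \<zeta>) / 2)"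
  define M where "M = 2 * norm (deriv u \<zeta>)"
  have m: "0 < m" using \<zeta> by (auto simp: m_def)
  have e1: "\<forall>\<^sub>F z in nhds \<zeta>. z \<in> ball 0 1" by (rule eventually_nhds_in_open[OF open_ball \<zeta>(1)])
  have e2: "\<forall>\<^sub>F z in nhds \<zeta>. m < norm (deriv u z)"
    by (rule order_tendstoD(1)[OF tendsto_norm[OF cont[OF du \<zeta>(1)]]]) (use \<zeta> in \<open>auto simp: m_def min_less_iff_disj\<close>)
  have e3: "\<forall>\<^sub>F z in nhds \<zeta>. norm (deriv u z) < M"
    by (rule order_tendstoD(2)[OF tendsto_norm[OF cont[OF du \<zeta>(1)]]]) (use \<zeta> in \<open>auto simp: M_def\<close>)
  have e4: "\<forall>\<^sub>F z in nhds \<zeta>. ?flat \<or> m < norm (deriv v z)"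
  proof (cases ?flat)
    case False
    then have "\<forall>\<^sub>F z in nhds \<zeta>. m < norm (deriv v z)"
      by (intro order_tendstoD(1)[OF tendsto_norm[OF cont[OF dv \<zeta>(1)]]]) (use \<zeta> in \<open>auto simp: m_def min_less_iff_disj\<close>)
    then show ?thesis by (rule eventually_mono) blast
  next
    case True
    then show ?thesis by (intro always_eventually allI disjI1)
  qed
  have "\<forall>\<^sub>F z in nhds \<zeta>. z \<in> ball 0 1 \<and> m < norm (deriv u z) \<and> norm (deriv u z) < M \<and> (?flat \<or> m < norm (deriv v z))"
    by (rule eventually_conj[OF e1 eventually_conj[OF e2 eventually_conj[OF e3 e4]]])
  then obtain d where d: "0 < d" "\<And>z. dist z \<zeta> < d \<Longrightarrow> z \<in> ball 0 1 \<and> m < norm (deriv u z) \<and> norm (deriv u z) < M \<and> (?flat \<or> m < norm (deriv v z))"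
    unfolding eventually_nhds_metric by blast
  have d': "z \<in> ball 0 1 \<and> m < norm (deriv u z) \<and> norm (deriv u z) < M \<and> (?flat \<or> m < norm (deriv v z))"
    if "z \<in> ball \<zeta> (2 * (d/2))" for z
  proof (rule d(2))
    show "dist z \<zeta> < d" using that by (simp add: dist_commute)
  qed
  show ?thesis
  proof (rule that[of "d/2" m \<zeta> M])
    show "0 < d/2" "0 < m" using d(1) m by auto
    show "ball \<zeta> (2 * (d/2)) \<subseteq> ball 0 1" using d' by blast
    show "m \<le> norm (deriv u z) \<and> norm (deriv u z) \<le> M \<and> (?flat \<or> m \<le> norm (deriv v z))"
      if "z \<in> ball \<zeta> (2 * (d/2))" for z using d'[OF that] by (meson less_imp_le)
  qed
qed

context coordinate_tower begin

theorem cantor_set_over: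
  assumes disc: "totally_disconnected K" and y0: "in_hull K y0" "y0 \<notin> K" "y0 $ 3 = 0"
  shows "\<exists>X :: (complex ^ 3) set. is_cantor_set X \<and> nontrivial_polynomial_hull X \<and>
    contains_no_analytic_discs (polynomial_hull X)"
proof -
  obtain c \<eta> where c: "\<And>n. 0 < c n" "summable c" and tail_le: "\<And>n. (\<Sum>j. c (j + n)) \<le> \<eta> n"
    and adm: "\<And>n. admissible n c (\<eta> n)"
    using coefficients_exist by metis
  interpret L: root_tower_over p K c by (rule root_tower_over[OF c])
  define X where "X = L.limit_set"
  have X: "compact X" "X \<noteq> {}" unfolding X_def by (rule L.compact_limit_set L.limit_set_nonempty)+
  have hull_iff: "y \<in> polynomial_hull X \<longleftrightarrow> in_hull X y" for y by (rule polynomial_hull_iff[OF X])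
  have \<eta>1: "0 < \<eta> n" "\<eta> n \<le> 1" for n using adm[of n] by (auto simp: admissible_def)
  have tail\<eta>: "L.tail n \<le> \<eta> n" for n unfolding L.tail_def by (rule tail_le)
  obtain \<kappa> where \<kappa>: "\<And>n. separating n c (\<kappa> n)" "\<And>n x d. base x \<in> K \<Longrightarrow> x $ 3 \<in> root_sums c n x \<Longrightarrow>
      norm d \<le> \<eta> n \<Longrightarrow> norm (root_poly c n (x + axis 3 d)) \<le> \<kappa> n"
    using adm unfolding admissible_def by metis
  have ratio: "ratio_ok c k" for k
    unfolding ratio_ok_def
  proof (intro conjI allI impI)
    show "0 < c k" by (rule c)
    fix j assume j: "j < k"
    have "c (0 + k) \<le> (\<Sum>j. c (j + k))"
      using sum_le_suminf[of "\<lambda>j. c (j + k)" "{0}"] c by (simp add: summable_iff_shift less_imp_le)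
    then have "c k \<le> \<eta> k" using tail_le[of k] by simp
    then have "(c k)\<^sup>2 \<le> (\<eta> k)\<^sup>2" using c(1)[of k] by (intro power_mono) auto
    then have "(c k)\<^sup>2 * scale k * (real k + 1)\<^sup>2 \<le> (\<eta> k)\<^sup>2 * scale k * (real k + 1)\<^sup>2"
      using scale_pos[of k] by (intro mult_right_mono) auto
    also have "\<dots> < (c j)\<^sup>2 * scale j" using adm[of k] j by (simp add: admissible_def)
    finally show "(c k)\<^sup>2 * scale k * (real k + 1)\<^sup>2 < (c j)\<^sup>2 * scale j" .
  qed
  have small: "norm (root_poly c n y) \<le> \<kappa> n" if "in_hull X y" for n y
  proof (rule in_hullD[OF that root_poly_poly])
    fix x assume "x \<in> X"
    then obtain w d where w: "x = w + axis 3 d" "w \<in> L.level n" "norm d \<le> L.tail n"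
      unfolding X_def L.limit_set_eq by blast
    then show "norm (root_poly c n x) \<le> \<kappa> n"
      unfolding w(1) using tail\<eta>[of n] by (intro \<kappa>(2)) (auto simp: L.level_def)
  qed
  have near: "\<exists>s\<in>root_sums c n y. norm (y $ 3 - s) \<le> (1/4) ^ n" if "in_hull X y" for n y
  proof (rule root_poly_small)
    show "norm (root_poly c n y) \<le> ((1/4) ^ n) ^ (2 ^ n)"
      using small[OF that, of n] \<kappa>(1)[of n] by (simp add: separating_def)
  qed simp
  have X_hull: "in_hull X x" if "x \<in> X" for x using that by (auto simp: in_hull_def)
  have base_X: "base x \<in> K" if "x \<in> X" for x using that by (simp add: X_def L.limit_set_def)
  have hullR: "norm (y $ l) \<le> R" if "in_hull X y" for y l
  proof (rule in_hullD[OF that complex_polynomial_coord])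
    fix x assume x: "x \<in> X"
    show "norm (x $ l) \<le> R"
    proof (cases "l = 3")
      case False
      then show ?thesis using KR[OF base_X[OF x], of l] by (simp add: base_nth)
    next
      case True
      have "\<exists>s\<in>root_sums c 0 x. norm (x $ 3 - s) \<le> L.tail 0"
        using x unfolding X_def L.limit_set_def by blast
      then have "norm (x $ 3) \<le> L.tail 0" by simp
      then show ?thesis using True tail\<eta>[of 0] \<eta>1(2)[of 0] R by simp
    qed
  qed
  have "is_cantor_set X"
  proof (rule is_cantor_setI[OF X(1) _ X(2)])
    show "x islimpt X" if "x \<in> X" for x
      using that p_nonzero_beyond unfolding X_def by (rule L.limit_set_islimpt)
    show "totally_disconnected X"
      unfolding totally_disconnected_def
    proof (intro allI impI ballI)
      fix T x y assume T: "T \<subseteq> X" "connected T" "x \<in> T" "y \<in> T"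
      have bc: "continuous_on T base"
        unfolding base_def
        by (intro continuous_intros continuous_on_compose2[OF continuous_on_axis[of UNIV]]) auto
      have "connected (base ` T)" by (rule connected_continuous_image[OF bc T(2)])
      moreover have "base ` T \<subseteq> K" using T(1) base_X by blast
      ultimately have bT: "base w = base x" if "w \<in> T" for w
        using disc T(3) that unfolding totally_disconnected_def by blast
      have "x $ 3 = y $ 3"
      proof (rule thin_connected_singleton)
        show "connected ((\<lambda>v. v $ 3) ` T)"
          using T(2) by (intro connected_continuous_image continuous_intros)
        show "\<exists>S. finite S \<and> card S \<le> 2 ^ n \<and> (\<forall>w\<in>(\<lambda>v. v $ 3) ` T. \<exists>s\<in>S. norm (w - s) \<le> (1/4) ^ n)" for n
        proof (intro exI[of _ "root_sums c n x"] conjI ballI)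
          show "finite (root_sums c n x)" "card (root_sums c n x) \<le> 2 ^ n" using root_sums_finite by auto
          fix w assume "w \<in> (\<lambda>v. v $ 3) ` T"
          then obtain v where v: "v \<in> T" "w = v $ 3" by blast
          have "root_sums c n v = root_sums c n x" using bT[OF v(1)] L.root_sums_base by metis
          then show "\<exists>s\<in>root_sums c n x. norm (w - s) \<le> (1/4) ^ n"
            using near[OF X_hull, of v n] v T(1) by auto
        qed
      qed (use T in auto)
      then show "x = y" using bT[OF T(4)] base_plus_axis by metis
    qed
  qed
  moreover have "nontrivial_polynomial_hull X"
  proof -
    have "norm (p n y0) \<le> 1" for n
      by (rule p_le_1) (rule in_hullD[OF y0(1) complex_polynomial_coord KR])
    then obtain z where z: "in_hull X z" "base z = base y0"
      using L.in_hull_limit_set[OF y0(1)] unfolding X_def by metis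
    have "z \<notin> X" using base_X[of z] z(2) y0 base_id by auto
    then show ?thesis using z(1) hull_iff unfolding nontrivial_polynomial_hull_def by blast
  qed
  moreover have "contains_no_analytic_discs (polynomial_hull X)"
    unfolding contains_no_analytic_discs_def
  proof (rule notI, elim exE conjE)
    fix \<sigma> :: "complex \<Rightarrow> complex ^ 3"
    assume ad: "analytic_disc \<sigma>" and "\<sigma> ` ball 0 1 \<subseteq> polynomial_hull X"
    then have \<sigma>: "in_hull X (\<sigma> z)" if "z \<in> ball 0 1" for z using that hull_iff by blast
    have hol: "(\<lambda>z. \<sigma> z $ l) holomorphic_on ball 0 1" for l using ad by (simp add: analytic_disc_def)
    have inj\<sigma>: "inj_on \<sigma> (ball 0 1)" using ad by (simp add: analytic_disc_def)
    show False
    proof (cases "\<forall>i\<in>{1,2}. \<forall>z\<in>ball 0 1. \<sigma> z $ i = \<sigma> 0 $ i")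
      case True
      have bs: "base (\<sigma> z) = base (\<sigma> 0)" if "z \<in> ball 0 1" for z
      proof -
        have "\<sigma> z $ 1 = \<sigma> 0 $ 1" "\<sigma> z $ 2 = \<sigma> 0 $ 2" using True that by blast+
        then show ?thesis unfolding vec_eq_iff forall_3 by (simp add: base_nth)
      qed
      have half: "(1/2 :: complex) \<in> ball 0 1" by simp
      have "\<sigma> (1/2) $ 3 = \<sigma> 0 $ 3"
      proof (rule thin_connected_singleton)
        show "connected ((\<lambda>z. \<sigma> z $ 3) ` ball 0 1)"
          by (intro connected_continuous_image holomorphic_on_imp_continuous_on hol) auto
        show "\<exists>S. finite S \<and> card S \<le> 2 ^ n \<and> (\<forall>w\<in>(\<lambda>z. \<sigma> z $ 3) ` ball 0 1. \<exists>s\<in>S. norm (w - s) \<le> (1/4) ^ n)" for n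
        proof (intro exI[of _ "root_sums c n (\<sigma> 0)"] conjI ballI)
          show "finite (root_sums c n (\<sigma> 0))" "card (root_sums c n (\<sigma> 0)) \<le> 2 ^ n" using root_sums_finite by auto
          fix w assume "w \<in> (\<lambda>z. \<sigma> z $ 3) ` ball 0 1"
          then obtain z where z: "z \<in> ball 0 1" "w = \<sigma> z $ 3" by blast
          have "root_sums c n (\<sigma> z) = root_sums c n (\<sigma> 0)" using bs[OF z(1)] L.root_sums_base by metis
          then show "\<exists>s\<in>root_sums c n (\<sigma> 0). norm (w - s) \<le> (1/4) ^ n"
            using near[OF \<sigma>[OF z(1)], of n] z(2) by simp
        qed
        show "\<sigma> (1/2) $ 3 \<in> (\<lambda>z. \<sigma> z $ 3) ` ball 0 1" using half by blast
        show "\<sigma> 0 $ 3 \<in> (\<lambda>z. \<sigma> z $ 3) ` ball 0 1" by simp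
      qed
      then have "\<sigma> (1/2) = \<sigma> 0" using bs[OF half] base_plus_axis by metis
      then have "(1/2 :: complex) = 0" by (rule inj_onD[OF inj\<sigma> _ half]) simp
      then show False by simp
    next
      case False
      then obtain i where i: "i \<in> {1,2}" "\<exists>z\<in>ball 0 1. \<sigma> z $ i \<noteq> \<sigma> 0 $ i" by blast
      define flat where "flat \<longleftrightarrow> (\<forall>z\<in>ball 0 1. \<sigma> z $ other i = \<sigma> 0 $ other i)"
      obtain \<zeta> \<rho> m M where \<rho>: "0 < \<rho>" and m: "0 < m" and sub: "ball \<zeta> (2 * \<rho>) \<subseteq> ball 0 1"
        and D: "\<And>z. z \<in> ball \<zeta> (2 * \<rho>) \<Longrightarrow> m \<le> norm (deriv (\<lambda>z. \<sigma> z $ i) z) \<and> norm (deriv (\<lambda>z. \<sigma> z $ i) z) \<le> M \<and>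
        (flat \<or> m \<le> norm (deriv (\<lambda>z. \<sigma> z $ other i) z))"
      proof (rule nonvanishing_derivatives[OF hol i(2) hol[of "other i"]])
        fix \<zeta> \<rho> m M
        assume a: "0 < \<rho>" "0 < m" "ball \<zeta> (2 * \<rho>) \<subseteq> ball 0 1"
          "\<And>z. z \<in> ball \<zeta> (2 * \<rho>) \<Longrightarrow> m \<le> norm (deriv (\<lambda>z. \<sigma> z $ i) z) \<and> norm (deriv (\<lambda>z. \<sigma> z $ i) z) \<le> M \<and>
            ((\<forall>z\<in>ball 0 1. \<sigma> z $ other i = \<sigma> 0 $ other i) \<or> m \<le> norm (deriv (\<lambda>z. \<sigma> z $ other i) z))"
        show thesis by (rule that[OF a(1-3) a(4)[folded flat_def]])
      qed
      let ?U = "(\<lambda>z. \<sigma> z $ i) ` ball \<zeta> \<rho>"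
      have sub1: "ball \<zeta> \<rho> \<subseteq> ball 0 1" using sub \<rho> by (intro subset_trans[OF subset_ball sub]) simp
      have "open ?U"
      proof (rule open_mapping_thm[OF hol[of i] open_ball _ open_ball sub1])
        show "\<not> (\<lambda>z. \<sigma> z $ i) constant_on ball 0 1"
          using i(2) unfolding constant_on_def by (metis centre_in_ball zero_less_one)
      qed simp
      moreover have "?U \<noteq> {}" using \<rho> by simp
      moreover obtain N :: nat where N: "max (1 / (\<rho> * m)) (\<rho> * M) \<le> real N" using real_arch_simple by blast
      ultimately obtain k where k: "k \<ge> N" "fst (idx k) = i" "snd (idx k) \<in> ?U"
        using dense[OF i(1), of ?U N] by blast
      then obtain \<xi> where \<xi>: "\<xi> \<in> ball \<zeta> \<rho>" "\<sigma> \<xi> $ i = snd (idx k)" by auto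
      have kN: "1 / (\<rho> * m) \<le> real k + 1" "\<rho> * M \<le> real k + 1" using N k(1) by auto
      have km: "1 / (real k + 1) \<le> \<rho> * m"
        using kN(1) \<rho> m by (simp add: field_simps)
      \<comment> \<open>Rescaling keeps the derivatives between 1/(k+1) and k+1 because k may be taken large.\<close>
      define \<tau> where "\<tau> z = \<sigma> (\<xi> + of_real \<rho> * z)" for z
      have arg: "\<xi> + of_real \<rho> * z \<in> ball \<zeta> (2 * \<rho>)" if "z \<in> ball 0 1" for z
      proof -
        have "norm (of_real \<rho> * z) < \<rho>" using that \<rho> by (simp add: norm_mult)
        moreover have "norm (\<zeta> - \<xi>) < \<rho>" using \<xi>(1) by (simp add: dist_norm)
        ultimately show ?thesis
          using norm_triangle_ineq4[of "\<zeta> - \<xi>" "of_real \<rho> * z"] by (simp add: dist_norm algebra_simps)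
      qed
      have arg1: "\<xi> + of_real \<rho> * z \<in> ball 0 1" if "z \<in> ball 0 1" for z using arg[OF that] sub by blast
      have \<xi>2: "\<xi> \<in> ball \<zeta> (2 * \<rho>)" "\<xi> \<in> ball 0 1" using \<xi>(1) \<rho> sub1 by auto
      have d\<tau>: "deriv (\<lambda>z. \<tau> z $ l) 0 = deriv (\<lambda>z. \<sigma> z $ l) \<xi> * of_real \<rho>" for l
      proof (rule DERIV_imp_deriv)
        have "((\<lambda>z. \<sigma> z $ l) has_field_derivative deriv (\<lambda>z. \<sigma> z $ l) \<xi>) (at (\<xi> + of_real \<rho> * 0))"
          using holomorphic_derivI[OF hol[of l] open_ball \<xi>2(2)] by simp
        moreover have "((\<lambda>z. \<xi> + of_real \<rho> * z) has_field_derivative of_real \<rho>) (at 0)"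
          by (auto intro!: derivative_eq_intros)
        ultimately show "((\<lambda>z. \<tau> z $ l) has_field_derivative deriv (\<lambda>z. \<sigma> z $ l) \<xi> * of_real \<rho>) (at 0)"
          unfolding \<tau>_def by (rule DERIV_chain2)
      qed
      have "disc_at k flat \<tau>"
        unfolding normalized_disc_def k(2) d\<tau>
      proof (intro conjI allI ballI)
        show "(\<lambda>z. \<tau> z $ l) holomorphic_on ball 0 1" for l
          unfolding \<tau>_def
          by (rule holomorphic_on_compose_gen[OF _ hol[of l], unfolded o_def])
            (use arg1 in \<open>auto intro!: holomorphic_intros\<close>)
        show "norm (\<tau> z $ l) \<le> R" if "z \<in> ball 0 1" for l z
          unfolding \<tau>_def by (rule hullR[OF \<sigma>[OF arg1[OF that]]])
        show "\<tau> 0 $ i = snd (idx k)" using \<xi>(2) by (simp add: \<tau>_def)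
        have Dx: "m \<le> norm (deriv (\<lambda>z. \<sigma> z $ i) \<xi>)" "norm (deriv (\<lambda>z. \<sigma> z $ i) \<xi>) \<le> M"
          "flat \<or> m \<le> norm (deriv (\<lambda>z. \<sigma> z $ other i) \<xi>)" using D[OF \<xi>2(1)] by blast+
        show "1 / (real k + 1) \<le> norm (deriv (\<lambda>z. \<sigma> z $ i) \<xi> * of_real \<rho>)"
          using order_trans[OF km mult_left_mono[OF Dx(1), of \<rho>]] \<rho> by (simp add: norm_mult mult.commute)
        show "norm (deriv (\<lambda>z. \<sigma> z $ i) \<xi> * of_real \<rho>) \<le> 1 / (1 / (real k + 1))"
          using order_trans[OF mult_left_mono[OF Dx(2), of \<rho>] kN(2)] \<rho> by (simp add: norm_mult mult.commute)
        show "if flat then \<forall>z\<in>ball 0 1. \<tau> z $ other i = \<tau> 0 $ other i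
          else 1 / (real k + 1) \<le> norm (deriv (\<lambda>z. \<sigma> z $ other i) \<xi> * of_real \<rho>)"
        proof (cases flat)
          case True
          have "\<tau> z $ other i = \<tau> 0 $ other i" if "z \<in> ball 0 1" for z
          proof -
            have "\<sigma> (\<xi> + of_real \<rho> * z) $ other i = \<sigma> 0 $ other i" using True arg1[OF that] unfolding flat_def by blast
            moreover have "\<sigma> \<xi> $ other i = \<sigma> 0 $ other i" using True \<xi>2(2) unfolding flat_def by blast
            ultimately show ?thesis by (simp add: \<tau>_def)
          qed
          then show ?thesis unfolding if_P[OF True] by blast
        next
          case False
          then have "m \<le> norm (deriv (\<lambda>z. \<sigma> z $ other i) \<xi>)" using Dx(3) by blast
          then have "1 / (real k + 1) \<le> norm (deriv (\<lambda>z. \<sigma> z $ other i) \<xi> * of_real \<rho>)"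
            using order_trans[OF km mult_left_mono[of m "norm (deriv (\<lambda>z. \<sigma> z $ other i) \<xi>)" \<rho>]] \<rho>
            by (simp add: norm_mult mult.commute)
          then show ?thesis unfolding if_not_P[OF False] .
        qed
      qed
      then obtain z where z: "z \<in> ball 0 1" "\<kappa> (Suc k) < norm (root_poly c (Suc k) (\<tau> z))"
        using \<kappa>(1)[of "Suc k"] ratio[of k] unfolding separating_def by blast
      moreover have "norm (root_poly c (Suc k) (\<tau> z)) \<le> \<kappa> (Suc k)"
        unfolding \<tau>_def by (rule small[OF \<sigma>[OF arg1[OF z(1)]]])
      ultimately show False by simp
    qed
  qed
  ultimately show ?thesis by blast
qed

end

theorem mainTheorem2:
  shows "\<exists>X :: (complex ^ 3) set.
    is_cantor_set X \<and> nontrivial_polynomial_hull X \<and>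
    contains_no_analytic_discs (polynomial_hull X)"
proof -
  obtain K :: "(complex ^ 3) set" and y where KY: "compact K" "totally_disconnected K" "\<And>v. v \<in> K \<Longrightarrow> v $ 3 = 0"
    "in_hull K y" "y \<notin> K" "y $ 3 = 0"
    using totally_disconnected_with_hull by metis
  obtain idx :: "nat \<Rightarrow> 3 \<times> complex" where idx: "inj idx" "\<And>n. fst (idx n) \<in> {1, 2}"
    "\<And>i U N. i \<in> {1, 2} \<Longrightarrow> open U \<Longrightarrow> U \<noteq> {} \<Longrightarrow> \<exists>k\<ge>N. fst (idx k) = i \<and> snd (idx k) \<in> U"
    using coordinate_enumeration by metis
  obtain B where B: "\<And>v. v \<in> K \<Longrightarrow> norm v \<le> B"
    using compact_imp_bounded[OF KY(1)] unfolding bounded_iff by blast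
  interpret coordinate_tower idx "max 1 B" K
  proof
    show "norm (v $ l) \<le> max 1 B" if "v \<in> K" for v l
      using B[OF that] Finite_Cartesian_Product.norm_nth_le[of v l] by simp
  qed (use idx KY in_hull_nonempty[OF KY(4)] in auto)
  show ?thesis by (rule cantor_set_over[OF KY(2,4,5,6)])
qed

end
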